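(* Let $k$ be a field of characteristic zero, and let $h=(1,h_1=r,h_2,\dots,h_e)$ be an $h$-vector with $r\le 3$. Then there exists a unique socle-vector associated to $h$ (i.e. all standard graded artinian $k$-algebras with $h$-vector $h$ have the same socle-vector) if and only if, for every $i\ge 2$, the inequality $((h_i)_{(i)})_{-1}^{-1}\neq h_{i-1}$ implies the equality $((h_i)_{(i)})_{+1}^{+1}=h_{i+1}$.
   Context: Algebras are standard graded artinian $k$-algebras $A=R/I$, with $R=k[x_1,\dots,x_r]$, $k$ a field of characteristic zero, and $I$ a homogeneous ideal containing no non-zero forms of degree 1. The $h$-vector of $A$ is $h(A)=(h_0,h_1,\dots,h_e)$, where $h_i=\dim_k A_i$ and $e\ge 1$ is the last index with $A_e\neq 0$; thus $h_0=1$ and $h_1=r$. Set $h_i=0$ for $i>e$. The socle of $A$ is $soc(A)=\{a\in A : a\overline{m}=0\}$, where $\overline m=(\overline{x_1},\dots,\overline{x_r})$, and the socle-vector of $A$ is $s(A)=(s_0,s_1,\dots,s_e)$ with $s_i=\dim_k soc(A)_i$. "An $h$-vector" means a tuple that is the $h$-vector of some such algebra. For positive integers $n,i$, the $i$-binomial expansion of $n$ is the unique expression $n_{(i)}=\binom{n_i}{i}+\binom{n_{i-1}}{i-1}+\dots+\binom{n_j}{j}$ with $n_i>n_{i-1}>\dots>n_j\ge j\ge 1$. For an integer $a$, $(n_{(i)})_a^a=\binom{n_i+a}{i+a}+\binom{n_{i-1}+a}{i-1+a}+\dots+\binom{n_j+a}{j+a}$ (with $\binom{m}{0}=1$ for $m\ge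 0$). By convention $(0_{(i)})_a^a=0$. *)

theory Defs
  imports
    "HOL-Library.Poly_Mapping"
    "HOL-Algebra.QuotRing"
    "HOL-Algebra.Embedded_Algebras"
begin

section \<open>The polynomial ring in \<open>r\<close> variables\<close>

text \<open>
  A monomial is a finitely supported exponent function on the variable indices, a polynomial a
  finitely supported coefficient function on the monomials; the product on
  \<open>(nat \<Rightarrow>\<^sub>0 nat) \<Rightarrow>\<^sub>0 'k\<close> is convolution. The variables of the ring in \<open>r\<close> variables are those
  with index \<open>0, \<dots>, r - 1\<close>.
\<close>

type_synonym 'k mpoly = "(nat \<Rightarrow>\<^sub>0 nat) \<Rightarrow>\<^sub>0 'k"

definition mpoly_ring :: "nat \<Rightarrow> 'k::comm_ring_1 mpoly ring" where
  "mpoly_ring r =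
     \<lparr>carrier = {p. \<forall>m \<in> Poly_Mapping.keys p. Poly_Mapping.keys m \<subseteq> {..<r}},
      mult = (*), one = 1, zero = 0, add = (+)\<rparr>"

definition mpoly_var :: "nat \<Rightarrow> 'k::comm_ring_1 mpoly" where
  "mpoly_var j = Poly_Mapping.single (Poly_Mapping.single j 1) 1"

definition mpoly_const :: "'k::comm_ring_1 \<Rightarrow> 'k mpoly" where
  "mpoly_const c = Poly_Mapping.single 0 c"

definition monom_degree :: "(nat \<Rightarrow>\<^sub>0 nat) \<Rightarrow> nat" where
  "monom_degree m = (\<Sum>j \<in> Poly_Mapping.keys m. Poly_Mapping.lookup m j)"

text \<open>Zero is a form of every degree.\<close>

definition forms :: "nat \<Rightarrow> nat \<Rightarrow> 'k::comm_ring_1 mpoly set" where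
  "forms r d = {p \<in> carrier (mpoly_ring r). \<forall>m \<in> Poly_Mapping.keys p. monom_degree m = d}"

definition homogeneous_ideal :: "nat \<Rightarrow> 'k::comm_ring_1 mpoly set \<Rightarrow> bool" where
  "homogeneous_ideal r I \<longleftrightarrow> (\<exists>F \<subseteq> (\<Union>d. forms r d). I = Idl\<^bsub>mpoly_ring r\<^esub> F)"

section \<open>Standard graded artinian algebras\<close>

definition artinian_ring :: "('a, 'b) ring_scheme \<Rightarrow> bool" where
  "artinian_ring A \<longleftrightarrow>
     ring A \<and>
     (\<forall>J :: nat \<Rightarrow> 'a set.
        (\<forall>n. ideal (J n) A) \<and> (\<forall>n. J (Suc n) \<subseteq> J n) \<longrightarrow> (\<exists>N. \<forall>n\<ge>N. J n = J N))"

definition quot_alg :: "nat \<Rightarrow> 'k::field mpoly set \<Rightarrow> 'k mpoly set ring" where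
  "quot_alg r I = mpoly_ring r Quot I"

definition residue_class :: "nat \<Rightarrow> 'k::field mpoly set \<Rightarrow> 'k mpoly \<Rightarrow> 'k mpoly set" where
  "residue_class r I p = I +>\<^bsub>mpoly_ring r\<^esub> p"

definition graded_part :: "nat \<Rightarrow> 'k::field mpoly set \<Rightarrow> nat \<Rightarrow> 'k mpoly set set" where
  "graded_part r I d = residue_class r I ` forms r d"

text \<open>The base field, embedded in the (non-zero) algebra \<open>R/I\<close> as the classes of the constants.\<close>

definition base_field :: "nat \<Rightarrow> 'k::field mpoly set \<Rightarrow> 'k mpoly set set" where
  "base_field r I = range (\<lambda>c. residue_class r I (mpoly_const c))"

definition alg_dim :: "nat \<Rightarrow> 'k::field mpoly set \<Rightarrow> 'k mpoly set set \<Rightarrow> nat" where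
  "alg_dim r I V = (THE n. ring.dimension (quot_alg r I) n (base_field r I) V)"

definition graded_artinian_algebra :: "nat \<Rightarrow> 'k::field mpoly set \<Rightarrow> bool" where
  "graded_artinian_algebra r I \<longleftrightarrow>
     homogeneous_ideal r I \<and>
     I \<inter> forms r 1 \<subseteq> {0} \<and>
     artinian_ring (quot_alg r I) \<and>
     (\<exists>e\<ge>1. graded_part r I e \<noteq> {\<zero>\<^bsub>quot_alg r I\<^esub>} \<and>
            (\<forall>i>e. graded_part r I i = {\<zero>\<^bsub>quot_alg r I\<^esub>}))"

text \<open>
  The tuples \<open>(h\<^sub>0, \<dots>, h\<^sub>e)\<close> and \<open>(s\<^sub>0, \<dots>, s\<^sub>e)\<close> are extended by zero to functions on the
  natural numbers; \<open>e\<close> is recovered as the last index at which the \<open>h\<close>-vector does not vanish.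
\<close>

definition h_vector :: "nat \<Rightarrow> 'k::field mpoly set \<Rightarrow> nat \<Rightarrow> nat" where
  "h_vector r I i = alg_dim r I (graded_part r I i)"

definition irrelevant_ideal :: "nat \<Rightarrow> 'k::field mpoly set \<Rightarrow> 'k mpoly set set" where
  "irrelevant_ideal r I = Idl\<^bsub>quot_alg r I\<^esub> ((\<lambda>j. residue_class r I (mpoly_var j)) ` {..<r})"

definition socle :: "nat \<Rightarrow> 'k::field mpoly set \<Rightarrow> 'k mpoly set set" where
  "socle r I = {a \<in> carrier (quot_alg r I).
     \<forall>b \<in> irrelevant_ideal r I. a \<otimes>\<^bsub>quot_alg r I\<^esub> b = \<zero>\<^bsub>quot_alg r I\<^esub>}"

definition socle_vector :: "nat \<Rightarrow> 'k::field mpoly set \<Rightarrow> nat \<Rightarrow> nat" where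
  "socle_vector r I i = alg_dim r I (socle r I \<inter> graded_part r I i)"

definition is_h_vector :: "'k::field itself \<Rightarrow> (nat \<Rightarrow> nat) \<Rightarrow> bool" where
  "is_h_vector _ h \<longleftrightarrow>
     (\<exists>r (I :: 'k mpoly set). graded_artinian_algebra r I \<and> h_vector r I = h)"

definition is_socle_vector_for :: "'k::field itself \<Rightarrow> (nat \<Rightarrow> nat) \<Rightarrow> (nat \<Rightarrow> nat) \<Rightarrow> bool" where
  "is_socle_vector_for _ h s \<longleftrightarrow>
     (\<exists>r (I :: 'k mpoly set).
        graded_artinian_algebra r I \<and> h_vector r I = h \<and> socle_vector r I = s)"

section \<open>Binomial expansions\<close>

text \<open>Only the values of \<open>c\<close> on \<open>{j..i}\<close> matter: \<open>c t\<close> is the upper entry over \<open>t\<close>.\<close>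

definition binomial_expansion :: "nat \<Rightarrow> nat \<Rightarrow> nat \<Rightarrow> (nat \<Rightarrow> nat) \<Rightarrow> bool" where
  "binomial_expansion n i j c \<longleftrightarrow>
     1 \<le> j \<and> j \<le> i \<and> j \<le> c j \<and> strict_mono_on {j..i} c \<and> n = (\<Sum>t=j..i. c t choose t)"

text \<open>
  The binomial coefficient with integer entries vanishes for a negative lower entry. In
  \<open>binomial_shift\<close> the upper entry is at least the lower one, so whenever the lower entry is
  non-negative the upper one is too, and no truncation occurs.
\<close>

definition int_choose :: "int \<Rightarrow> int \<Rightarrow> nat" where
  "int_choose m l = (if l < 0 then 0 else nat m choose nat l)"

definition binomial_shift :: "int \<Rightarrow> nat \<Rightarrow> nat \<Rightarrow> nat" where
  "binomial_shift a n i =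
     (if n = 0 then 0
      else THE v. \<exists>j c. binomial_expansion n i j c \<and>
             v = (\<Sum>t=j..i. int_choose (int (c t) + a) (int t + a)))"

end

theory Submission
  imports Defs "HOL-Computational_Algebra.Polynomial"
begin

text \<open>
  Let \<open>V\<^sub>i = I\<^sub>i\<close>, of codimension \<open>n = h\<^sub>i\<close> (only \<open>V\<^sub>i \<noteq> 0\<close> matters), and write \<open>R\<^sub>1\<close> for the space of linear forms. The socle
  in degree \<open>i - 1\<close> has dimension \<open>h\<^sub>i\<^sub>-\<^sub>1\<close> minus the codimension of \<open>(V\<^sub>i : R\<^sub>1)\<close>. By Green's
  restriction theorem, a general linear form \<open>l\<close> satisfies \<open>codim (V\<^sub>i + l R\<^sub>i\<^sub>-\<^sub>1) \<le> a\<close>, where \<open>a\<close> is the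
  number of binomials \<open>(t+1 choose t)\<close> in the expansion of \<open>n\<close>; so \<open>codim (V\<^sub>i : R\<^sub>1) \<ge> codim (V\<^sub>i : l)\<close>
  is at least \<open>n - a\<close>, the value of the shift by \<open>-1\<close>. It also gives Macaulay's bound
  \<open>codim (R\<^sub>1 V\<^sub>i) \<le> n + a\<close>, the shift by \<open>1\<close>, and equality there forces \<open>(R\<^sub>1 V\<^sub>i : l) = V\<^sub>i\<close>. Then
  \<open>l f \<in> V\<^sub>i\<close> implies \<open>l (x f) \<in> R\<^sub>1 V\<^sub>i\<close> and so \<open>x f \<in> V\<^sub>i\<close> for all \<open>x \<in> R\<^sub>1\<close>, that is
  \<open>(V\<^sub>i : l) = (V\<^sub>i : R\<^sub>1)\<close>, whose codimension is \<open>n - a\<close>. Hence the condition makes the socle unique.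
  If it fails at \<open>i\<close>, the lexicographic ideal has a socle element in degree \<open>i - 1\<close> and a generator in
  degree \<open>i + 1\<close>; exchanging its last monomial of degree \<open>i\<close> for the next one preserves \<open>h\<close>
  and lowers the socle.
\<close>

section \<open>Finite-dimensional subspaces\<close>

text \<open>Three variables make Green's theorem elementary. Modulo two general linear forms
  \<open>l\<close>, \<open>l'\<close> only one variable is left, so \<open>V + l R + l' R\<close> is
  everything as soon as \<open>V\<close> contains a form that does not vanish at the common zero of
  \<open>l\<close> and \<open>l'\<close>; a non-zero form has this property for general
  \<open>l\<close>, \<open>l'\<close>. This fullness drives the induction on the degree behind
  Green's bound and, multiplied by \<open>R_1\<close>, gives Macaulay's. Three variables also
  restrict the expansions. Apart from \<open>n = (i + 2 choose i)\<close>, where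
  \<open>V_i = 0\<close>, there are \<open>a\<close> entries \<open>t + 1\<close> over
  \<open>t\<close>, followed by \<open>b\<close> entries \<open>t\<close> over \<open>t\<close>. So
  \<open>n\<close> is coded by the pair \<open>(a, b)\<close>, and the shifts by -1 and 1 subtract
  and add \<open>a\<close>. The same pair consists of the exponents of the two larger variables in
  the monomial of lexicographic rank \<open>n\<close>, which links expansions to lexicographic
  ideals. Uniqueness has two cases. If the shift of \<open>h_i\<close> by -1 equals
  \<open>h_(i-1)\<close>, the lower bound for the codimension of \<open>(V_i : R_1)\<close> leaves
  no room for a socle in degree \<open>i - 1\<close>. Otherwise \<open>R_1 V_i\<close>, being
  contained in \<open>V_(i+1)\<close>, inherits equality in Macaulay's bound.\<close>

locale vec_space = vector_space
begin

text \<open>The space of all polynomials is infinite-dimensional, and \<open>dim\<close> is the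
  cardinality of a basis, hence 0 for infinite bases. Monotonicity of \<open>dim\<close> therefore
  needs finiteness as a hypothesis that is carried along.\<close>

definition findim :: "'b set \<Rightarrow> bool" where
  "findim V \<longleftrightarrow> (\<exists>B. finite B \<and> V \<subseteq> span B)"

lemma findimI: "finite B \<Longrightarrow> V \<subseteq> span B \<Longrightarrow> findim V"
  by (auto simp: findim_def)

lemma findim_subset: "findim T \<Longrightarrow> S \<subseteq> T \<Longrightarrow> findim S"
  by (auto simp: findim_def)

lemma findim_basis:
  assumes "findim V"
  obtains B where "B \<subseteq> V" "independent B" "V \<subseteq> span B" "finite B" "card B = dim V"
proof -
  obtain B where B: "B \<subseteq> V" "independent B" "V \<subseteq> span B" "card B = dim V"
    using basis_exists by blast
  obtain C where "finite C" "V \<subseteq> span C"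
    using assms by (auto simp: findim_def)
  then have "finite B"
    using independent_span_bound[of C B] B by auto
  with B show ?thesis using that by blast
qed

lemma dim_mono_findim: "findim T \<Longrightarrow> S \<subseteq> T \<Longrightarrow> dim S \<le> dim T"
proof -
  assume T: "findim T" and S: "S \<subseteq> T"
  obtain B where "T \<subseteq> span B" "finite B" "card B = dim T"
    using findim_basis[OF T] by metis
  then show ?thesis using dim_le_card[of S B] S by auto
qed

lemma span_insert_span: "span (insert x (span B)) = span (insert x B)"
proof
  have "span B \<subseteq> span (insert x B)" by (intro span_mono) auto
  then show "span (insert x (span B)) \<subseteq> span (insert x B)"
    by (intro span_minimal) (auto intro: span_base)
  show "span (insert x B) \<subseteq> span (insert x (span B))"
    by (intro span_mono) (auto intro: span_base)
qed

lemma dim_insert_findim: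
  assumes "findim V" "subspace V" "x \<notin> V"
  shows "dim (span (insert x V)) = Suc (dim V)"
proof -
  obtain B where B: "B \<subseteq> V" "independent B" "V \<subseteq> span B" "finite B" "card B = dim V"
    using assms(1) findim_basis by blast
  have sB: "span B = V"
    using B assms(2) span_minimal by blast
  then have "x \<notin> span B" using assms by simp
  then have ind: "independent (insert x B)"
    using B independent_insertI by blast
  have "span (insert x B) = span (insert x V)"
    using sB span_insert_span by metis
  then have "dim (span (insert x V)) = card (insert x B)"
    by (metis dim_eq_card_independent dim_span ind)
  moreover have "x \<notin> B" using \<open>x \<notin> V\<close> B by blast
  ultimately show ?thesis using B by simp
qed

lemma span_insert_subset: "subspace T \<Longrightarrow> x \<in> T \<Longrightarrow> S \<subseteq> T \<Longrightarrow> span (insert x S) \<subseteq> T"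
  by (simp add: span_minimal)

lemma findim_insert: "findim V \<Longrightarrow> findim (span (insert x V))"
proof -
  assume "findim V"
  then obtain B where B: "finite B" "V \<subseteq> span B" by (auto simp: findim_def)
  have "insert x V \<subseteq> span (insert x B)"
    using B span_mono[of B "insert x B"] span_base[of x "insert x B"] by blast
  then have "span (insert x V) \<subseteq> span (insert x B)"
    by (simp add: span_minimal)
  with B(1) show ?thesis by (intro findimI[of "insert x B"]) auto
qed

lemma subspace_eqI_dim:
  assumes "subspace S" "S \<subseteq> T" "findim T" "dim T \<le> dim S"
  shows "S = T"
proof (rule ccontr)
  assume "S \<noteq> T"
  then obtain x where x: "x \<in> T" "x \<notin> S" using assms(2) by blast
  have "findim S" using assms findim_subset by blast
  then have "dim (insert x S) = Suc (dim S)"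
    using dim_insert_findim assms x by (metis dim_span)
  moreover have "dim (insert x S) \<le> dim T"
    using x assms by (intro dim_mono_findim) auto
  ultimately show False using assms by simp
qed

definition ssum :: "'b set \<Rightarrow> 'b set \<Rightarrow> 'b set" where
  "ssum S T = {x + y | x y. x \<in> S \<and> y \<in> T}"

lemma ssumI: "x \<in> S \<Longrightarrow> y \<in> T \<Longrightarrow> x + y \<in> ssum S T"
  by (auto simp: ssum_def)

lemma subspace_ssum: "subspace S \<Longrightarrow> subspace T \<Longrightarrow> subspace (ssum S T)"
  unfolding ssum_def by (rule subspace_sums)

lemma ssum_upper:
  "subspace T \<Longrightarrow> S \<subseteq> ssum S T" "subspace S \<Longrightarrow> T \<subseteq> ssum S T"
proof -
  show "S \<subseteq> ssum S T" if "subspace T"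
    using ssumI[of _ S 0 T] that subspace_0 by auto
  show "T \<subseteq> ssum S T" if "subspace S"
    using ssumI[of 0 S _ T] that subspace_0 by auto
qed

lemma ssum_least: "subspace U \<Longrightarrow> S \<subseteq> U \<Longrightarrow> T \<subseteq> U \<Longrightarrow> ssum S T \<subseteq> U"
  by (auto simp: ssum_def subspace_add subsetD)

lemma mem_span_insert:
  assumes "subspace T" "y \<in> span (insert b T)"
  obtains k t where "t \<in> T" "y = scale k b + t"
proof -
  obtain k where "y - scale k b \<in> span T"
    using assms span_breakdown_eq by blast
  then have "y - scale k b \<in> T" using assms by (metis span_eq_iff)
  then show ?thesis using that[of "y - scale k b" k] by simp
qed

lemma ssum_insert_right:
  assumes "subspace S" "subspace T"
  shows "ssum S (span (insert b T)) = span (insert b (ssum S T))"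
proof
  show "ssum S (span (insert b T)) \<subseteq> span (insert b (ssum S T))"
    using assms ssum_upper[of T S] ssum_upper[of S T]
    by (intro ssum_least subspace_span span_mono insert_mono) (auto intro: span_base)
next
  have "b \<in> ssum S (span (insert b T))"
    using ssum_upper(2)[of S "span (insert b T)"] assms span_base[of b] by blast
  moreover have "ssum S T \<subseteq> ssum S (span (insert b T))"
    using span_superset[of "insert b T"] by (auto simp: ssum_def)
  ultimately show "span (insert b (ssum S T)) \<subseteq> ssum S (span (insert b T))"
    using assms by (intro span_insert_subset subspace_ssum) auto
qed

text \<open>A new vector \<open>b\<close> outside \<open>T = span B\<close> raises the dimension of
  \<open>T\<close> by one. If \<open>b = s + t\<close> lies in \<open>S + T\<close>, the sum stays
  and the intersection gains the line of \<open>s\<close>; otherwise the sum grows and the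
  intersection stays.\<close>

lemma dim_ssum_Int_span:
  assumes S: "subspace S" "findim S" and "finite B"
  shows "findim (ssum S (span B)) \<and> dim (ssum S (span B)) + dim (S \<inter> span B) = dim S + dim (span B)"
  using \<open>finite B\<close>
proof (induction B)
  case empty
  have "ssum S (span {}) = S" by (auto simp: ssum_def)
  moreover have "S \<inter> span {} = span {}" using S subspace_0 by auto
  ultimately show ?case using S by simp
next
  case (insert b B)
  define T where "T = span B"
  have T: "subspace T" "findim T" using insert by (auto simp: T_def intro: findimI)
  have T': "span (insert b B) = span (insert b T)"
    unfolding T_def by (simp add: span_insert_span)
  have IH: "findim (ssum S T)" "dim (ssum S T) + dim (S \<inter> T) = dim S + dim T"
    using insert by (auto simp: T_def)
  show ?case
  proof (cases "b \<in> T")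
    case True
    then have "span (insert b B) = T"
      unfolding T_def by (rule span_redundant)
    then show ?thesis using IH by simp
  next
    case bT: False
    then have dT: "dim (span (insert b T)) = Suc (dim T)"
      using T dim_insert_findim by blast
    have sub: "subspace (ssum S T)" using S T subspace_ssum by blast
    show ?thesis
    proof (cases "b \<in> ssum S T")
      case True
      then obtain s t where st: "s \<in> S" "t \<in> T" "b = s + t" by (auto simp: ssum_def)
      have eq1: "ssum S (span (insert b T)) = ssum S T"
        using ssum_insert_right[OF S(1) T(1), of b] True sub
        by (simp add: insert_absorb span_eq_iff[THEN iffD2])
      have "s \<notin> T" using st bT T by (auto simp: subspace_add)
      have b: "b \<in> span (insert b T)" "T \<subseteq> span (insert b T)"
        using span_superset[of "insert b T"] by auto
      have "s = b - t" using st by simp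
      then have s: "s \<in> span (insert b T)"
        using b st span_diff by blast
      have "S \<inter> span (insert b T) = span (insert s (S \<inter> T))"
      proof
        show "span (insert s (S \<inter> T)) \<subseteq> S \<inter> span (insert b T)"
          using S T s b st by (intro span_insert_subset) (auto simp: subspace_inter)
        show "S \<inter> span (insert b T) \<subseteq> span (insert s (S \<inter> T))"
        proof
          fix y assume y: "y \<in> S \<inter> span (insert b T)"
          then obtain k u where u: "u \<in> T" "y = scale k b + u"
            using mem_span_insert T by blast
          have "y - scale k s \<in> S" using y st S by (simp add: subspace_diff subspace_scale)
          moreover have "y - scale k s = scale k t + u"
            using u st by (simp add: scale_right_distrib)
          moreover have "scale k t + u \<in> T" using u st T by (simp add: subspace_add subspace_scale)
          ultimately have "y - scale k s \<in> S \<inter> T" by simp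
          then show "y \<in> span (insert s (S \<inter> T))"
            using span_breakdown_eq span_base by blast
        qed
      qed
      then have "dim (S \<inter> span (insert b T)) = Suc (dim (S \<inter> T))"
        using dim_insert_findim[of "S \<inter> T" s] \<open>s \<notin> T\<close> S T findim_subset[of S "S \<inter> T"] 
        by (simp add: subspace_inter)
      then show ?thesis using IH dT eq1 T' by simp
    next
      case False
      have "S \<inter> span (insert b T) = S \<inter> T"
      proof
        show "S \<inter> T \<subseteq> S \<inter> span (insert b T)" using span_superset[of "insert b T"] by auto
        show "S \<inter> span (insert b T) \<subseteq> S \<inter> T"
        proof
          fix y assume y: "y \<in> S \<inter> span (insert b T)"
          then obtain k u where u: "u \<in> T" "y = scale k b + u"
            using mem_span_insert T by blast
          have "k = 0"
          proof (rule ccontr)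
            assume "k \<noteq> 0"
            have "scale k b = y + (- u)" using u by simp
            also have "\<dots> \<in> ssum S T" using y u T ssumI[of y S "-u" T] by (simp add: subspace_neg)
            finally have "scale (1/k) (scale k b) \<in> ssum S T" using sub by (blast intro: subspace_scale)
            then show False using False \<open>k \<noteq> 0\<close> by simp
          qed
          then show "y \<in> S \<inter> T" using y u by simp
        qed
      qed
      moreover have "dim (ssum S (span (insert b T))) = Suc (dim (ssum S T))"
        using ssum_insert_right[OF S(1) T(1), of b] dim_insert_findim IH sub False by simp
      moreover have "findim (ssum S (span (insert b T)))"
        using ssum_insert_right[OF S(1) T(1), of b] findim_insert IH by simp
      ultimately show ?thesis using IH dT T' by simp
    qed
  qed
qed

lemma dim_ssum_Int:
  assumes "subspace S" "findim S" "subspace T" "findim T"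
  shows "dim (ssum S T) + dim (S \<inter> T) = dim S + dim T"
proof -
  obtain B where B: "B \<subseteq> T" "T \<subseteq> span B" "finite B"
    using findim_basis[OF assms(4)] by metis
  then have "span B = T" using span_minimal[OF B(1) assms(3)] by simp
  then show ?thesis using dim_ssum_Int_span[OF assms(1,2) B(3)] by simp
qed

end

section \<open>Spaces of forms\<close>

abbreviation coef :: "('a \<Rightarrow>\<^sub>0 'b::zero) \<Rightarrow> 'a \<Rightarrow> 'b" where
  "coef \<equiv> Poly_Mapping.lookup"

abbreviation supp :: "('a \<Rightarrow>\<^sub>0 'b::zero) \<Rightarrow> 'a set" where
  "supp \<equiv> Poly_Mapping.keys"

text \<open>Scalars act as constant polynomials. Thus ideals are subspaces by absorption, and the
  classes of the scalars form \<open>base_field\<close>.\<close>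

definition scal :: "'k::field \<Rightarrow> 'k mpoly \<Rightarrow> 'k mpoly" where
  "scal c p = mpoly_const c * p"

lemma mpoly_const_add: "mpoly_const (a + b) = mpoly_const a + mpoly_const b"
  by (simp add: mpoly_const_def single_add)

lemma mpoly_const_mult: "mpoly_const (a * b) = mpoly_const a * mpoly_const b"
  by (simp add: mpoly_const_def mult_single)

lemma mpoly_const_1 [simp]: "mpoly_const 1 = 1"
  by (simp add: mpoly_const_def)

lemma mpoly_const_0 [simp]: "mpoly_const 0 = 0"
  by (simp add: mpoly_const_def)

interpretation mp: vec_space "scal :: 'k::field \<Rightarrow> 'k mpoly \<Rightarrow> 'k mpoly"
  by unfold_locales
    (simp_all add: scal_def mpoly_const_add mpoly_const_mult algebra_simps)

lemma scal_mult_left: "scal c p * q = scal c (p * q)"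
  by (simp add: scal_def mult.assoc)

lemma scal_mult_right: "p * scal c q = scal c (p * q)"
  by (simp add: scal_def ac_simps)

lemma coef_scal [simp]: "coef (scal c p) m = c * coef p m"
  unfolding scal_def mpoly_const_def mult_map_scale_conv_mult[symmetric]
  by (simp add: Poly_Mapping.map.rep_eq when_def)

lemma coef_single_mult: "coef (Poly_Mapping.single k (1::'k::field) * p) (k + m) = coef p m"
  for k :: "nat \<Rightarrow>\<^sub>0 nat"
  by (simp add: lookup_mult lookup_single when_mult)

lemma coef_single_mult_0:
  fixes k :: "nat \<Rightarrow>\<^sub>0 nat"
  assumes "\<And>m. n \<noteq> k + m"
  shows "coef (Poly_Mapping.single k (1::'k::field) * p) n = 0"
  using keys_mult[of "Poly_Mapping.single k (1::'k)" p] assms by (fastforce simp: in_keys_iff)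

lemma supp_single_mult: "supp (Poly_Mapping.single k (1::'k::field) * p) = (+) k ` supp p"
  for k :: "nat \<Rightarrow>\<^sub>0 nat"
proof -
  have "n \<in> supp (Poly_Mapping.single k 1 * p) \<longleftrightarrow> n \<in> (+) k ` supp p" for n
  proof (cases "\<exists>m. n = k + m")
    case True
    then show ?thesis by (auto simp: in_keys_iff coef_single_mult)
  next
    case False
    then show ?thesis using coef_single_mult_0[of n k p] by (auto simp: in_keys_iff)
  qed
  then show ?thesis by blast
qed

definition monoms :: "nat \<Rightarrow> nat \<Rightarrow> (nat \<Rightarrow>\<^sub>0 nat) set" where
  "monoms r d = {m. supp m \<subseteq> {..<r} \<and> monom_degree m = d}"

lemma monom_degree_eq: "finite A \<Longrightarrow> supp m \<subseteq> A \<Longrightarrow> monom_degree m = (\<Sum>j\<in>A. coef m j)"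
  unfolding monom_degree_def by (intro sum.mono_neutral_left) (auto simp: in_keys_iff)

lemma supp_plus_nat: "supp (m + n) = supp m \<union> supp n" for m n :: "nat \<Rightarrow>\<^sub>0 nat"
  by (auto simp: in_keys_iff lookup_add)

lemma monom_degree_plus: "monom_degree (m + n) = monom_degree m + monom_degree n"
  using monom_degree_eq[of "supp m \<union> supp n" "m + n"] monom_degree_eq[of "supp m \<union> supp n" m]
    monom_degree_eq[of "supp m \<union> supp n" n]
  by (simp add: supp_plus_nat lookup_add sum.distrib)

lemma monom_degree_single [simp]: "monom_degree (Poly_Mapping.single j k) = k"
  by (simp add: monom_degree_def)

lemma monom_degree_0_iff: "monom_degree m = 0 \<longleftrightarrow> m = 0"
  by (auto simp: monom_degree_def in_keys_iff intro!: poly_mapping_eqI)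

lemma monoms_plus: "m \<in> monoms r d \<Longrightarrow> n \<in> monoms r e \<Longrightarrow> m + n \<in> monoms r (d + e)"
  by (auto simp: monoms_def supp_plus_nat monom_degree_plus)

lemma monoms_plus_iff: "n \<in> monoms r e \<Longrightarrow> n + m \<in> monoms r (e + d) \<longleftrightarrow> m \<in> monoms r d"
  by (auto simp: monoms_def supp_plus_nat monom_degree_plus)

lemma monoms_var: "Poly_Mapping.single j 1 \<in> monoms r 1 \<longleftrightarrow> j < r"
  by (simp add: monoms_def)

lemma coef_le_monom_degree: "coef m j \<le> monom_degree m"
proof (cases "j \<in> supp m")
  case True
  then show ?thesis unfolding monom_degree_def by (intro member_le_sum) auto
qed (simp add: in_keys_iff)

lemma finite_monoms: "finite (monoms r d)"
proof -
  have "coef ` monoms r d \<subseteq> {f. \<forall>x. (x \<in> {..<r} \<longrightarrow> f x \<in> {..d}) \<and> (x \<notin> {..<r} \<longrightarrow> f x = 0)}"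
    using coef_le_monom_degree by (auto simp: monoms_def in_keys_iff)
  moreover have "finite {f. \<forall>x. (x \<in> {..<r} \<longrightarrow> f x \<in> {..d}) \<and> (x \<notin> {..<r} \<longrightarrow> f x = 0)}"
    by (intro finite_set_of_finite_funs) auto
  ultimately have "finite (coef ` monoms r d)" by (rule finite_subset)
  moreover have "inj_on coef (monoms r d)"
    by (intro inj_onI poly_mapping_eqI) simp
  ultimately show ?thesis by (rule finite_imageD)
qed

definition polys :: "(nat \<Rightarrow>\<^sub>0 nat) set \<Rightarrow> 'k::comm_ring_1 mpoly set" where
  "polys M = {p. supp p \<subseteq> M}"

lemma polys_iff: "p \<in> polys M \<longleftrightarrow> (\<forall>m. m \<notin> M \<longrightarrow> coef p m = 0)"
  by (auto simp: polys_def in_keys_iff)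

lemma subspace_polys: "mp.subspace (polys M)"
  by (rule mp.subspaceI) (auto simp: polys_iff lookup_add)

lemma polys_decomp: "p = (\<Sum>m\<in>supp p. scal (coef p m) (Poly_Mapping.single m 1))"
proof (rule poly_mapping_eqI)
  fix k
  have "(\<Sum>m\<in>supp p. coef (scal (coef p m) (Poly_Mapping.single m 1)) k)
      = (\<Sum>m\<in>supp p. if k = m then coef p m else 0)"
    by (intro sum.cong) (auto simp: lookup_single when_def)
  then show "coef p k = coef (\<Sum>m\<in>supp p. scal (coef p m) (Poly_Mapping.single m 1)) k"
    by (simp add: lookup_sum in_keys_iff)
qed

lemma single_in_polys: "m \<in> M \<Longrightarrow> Poly_Mapping.single m c \<in> polys M"
  by (auto simp: polys_def)

lemma inj_mono: "inj_on (\<lambda>m. Poly_Mapping.single m (1::'k::field)) M"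
  by (rule inj_onI) (metis lookup_single_eq lookup_single_not_eq zero_neq_one)

lemma span_mono_polys:
  assumes "finite M"
  shows "mp.span ((\<lambda>m. Poly_Mapping.single m (1::'k::field)) ` M) = polys M"
proof
  show "mp.span ((\<lambda>m. Poly_Mapping.single m (1::'k)) ` M) \<subseteq> polys M"
    by (intro mp.span_minimal subspace_polys) (auto intro: single_in_polys)
  show "polys M \<subseteq> mp.span ((\<lambda>m. Poly_Mapping.single m (1::'k)) ` M)"
  proof
    fix p :: "'k mpoly" assume "p \<in> polys M"
    then have "supp p \<subseteq> M" by (simp add: polys_def)
    then have "(\<Sum>m\<in>supp p. scal (coef p m) (Poly_Mapping.single m 1))
        \<in> mp.span ((\<lambda>m. Poly_Mapping.single m (1::'k)) ` M)"
      by (intro mp.span_sum mp.span_scale mp.span_base) auto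
    then show "p \<in> mp.span ((\<lambda>m. Poly_Mapping.single m (1::'k)) ` M)"
      using polys_decomp[of p] by simp
  qed
qed

lemma independent_monoms: "mp.independent ((\<lambda>m. Poly_Mapping.single m (1::'k::field)) ` M)"
  unfolding mp.dependent_def
proof (clarify)
  fix m assume m: "m \<in> M"
    "Poly_Mapping.single m (1::'k) \<in> mp.span ((\<lambda>m. Poly_Mapping.single m 1) ` M - {Poly_Mapping.single m 1})"
  have "mp.span ((\<lambda>m. Poly_Mapping.single m (1::'k)) ` M - {Poly_Mapping.single m 1}) \<subseteq> polys (M - {m})"
    by (intro mp.span_minimal subspace_polys) (auto intro!: single_in_polys)
  then have "Poly_Mapping.single m (1::'k) \<in> polys (M - {m})" using m by blast
  then show False by (simp add: polys_def)
qed

lemma findim_polys: "finite M \<Longrightarrow> mp.findim (polys M)"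
  using span_mono_polys by (metis finite_imageI mp.findimI order_refl)

lemma dim_polys:
  assumes "finite M"
  shows "mp.dim (polys M :: 'k::field mpoly set) = card M"
proof -
  have "mp.dim (polys M :: 'k mpoly set) = card ((\<lambda>m. Poly_Mapping.single m (1::'k)) ` M)"
    using mp.dim_span_eq_card_independent[OF independent_monoms] span_mono_polys[OF assms] by metis
  then show ?thesis using card_image[OF inj_mono] by metis
qed

lemma forms_eq: "forms r d = polys (monoms r d)"
  by (auto simp: forms_def polys_def monoms_def mpoly_ring_def)

lemmas subspace_forms = subspace_polys[of "monoms r d" for r d, folded forms_eq]
lemmas findim_forms = findim_polys[OF finite_monoms, folded forms_eq]
lemmas dim_forms = dim_polys[OF finite_monoms, folded forms_eq]

lemma forms_mult: "p \<in> forms r d \<Longrightarrow> q \<in> forms r e \<Longrightarrow> p * q \<in> forms r (d + e)"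
  unfolding forms_eq polys_def using keys_mult[of p q] monoms_plus by blast

lemma var_form: "j < r \<Longrightarrow> mpoly_var j \<in> forms r 1"
  unfolding forms_eq mpoly_var_def by (intro single_in_polys) (simp only: monoms_var)

lemma var_mult_form_iff:
  assumes "j < r"
  shows "mpoly_var j * (p :: 'k::field mpoly) \<in> forms r (Suc d) \<longleftrightarrow> p \<in> forms r d"
proof -
  have "mpoly_var j * p \<in> forms r (1 + d) \<longleftrightarrow> (\<forall>m\<in>supp p. Poly_Mapping.single j 1 + m \<in> monoms r (1 + d))"
    unfolding forms_eq polys_def mpoly_var_def by (auto simp: supp_single_mult)
  also have "\<dots> \<longleftrightarrow> p \<in> forms r d"
    unfolding forms_eq polys_def using monoms_plus_iff[of "Poly_Mapping.single j 1" r 1 _ d] monoms_var[of j r] assms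
    by blast
  finally show ?thesis by simp
qed

lemma mult_form1: "l \<in> forms r 1 \<Longrightarrow> f \<in> forms r d \<Longrightarrow> l * f \<in> forms r (Suc d)"
  using forms_mult[of l r 1 f d] by simp

text \<open>Polynomials form a domain, so multiplication by \<open>l\<close> is injective and
  carries a basis to a basis.\<close>

lemma dim_mult_image:
  fixes l :: "'k::field mpoly"
  assumes "l \<noteq> 0" "mp.subspace V" "mp.findim V"
  shows "mp.dim ((*) l ` V) = mp.dim V" "mp.subspace ((*) l ` V)" "mp.findim ((*) l ` V)"
proof -
  have lin: "Vector_Spaces.linear scal scal ((*) l)"
    unfolding Vector_Spaces.linear_iff
    by (auto simp: mp.vector_space_axioms algebra_simps scal_mult_right)
  interpret L: Vector_Spaces.linear scal scal "(*) l" by fact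
  interpret vp: vector_space_pair scal "scal :: 'k \<Rightarrow> _" by unfold_locales
  obtain B where B: "B \<subseteq> V" "mp.independent B" "V \<subseteq> mp.span B" "finite B" "card B = mp.dim V"
    using mp.findim_basis[OF assms(3)] by metis
  have sB: "mp.span B = V" using B assms(2) mp.span_minimal by blast
  have inj: "inj_on ((*) l) X" for X
    using assms(1) by (auto intro: inj_onI)
  have ind: "mp.independent ((*) l ` B)"
    using vp.linear_independent_injective_image[OF lin B(2) inj] .
  have sp: "(*) l ` V = mp.span ((*) l ` B)"
    using L.span_image[of B] sB by metis
  show "mp.dim ((*) l ` V) = mp.dim V"
    using sp ind mp.dim_span_eq_card_independent[OF ind] card_image[OF inj] B by metis
  show "mp.subspace ((*) l ` V)" using sp by simp
  show "mp.findim ((*) l ` V)" using sp B by (metis finite_imageI mp.findimI order_refl)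
qed

section \<open>Codimension in a fixed degree, colon spaces and sums with multiples of a linear
  form\<close>

definition codim :: "nat \<Rightarrow> nat \<Rightarrow> 'k::field mpoly set \<Rightarrow> nat" where
  "codim r d V = mp.dim (forms r d :: 'k mpoly set) - mp.dim V"

text \<open>This is \<open>(V : l)\<close>, and the next definition is \<open>V + l R_d\<close>. In
  both, \<open>d\<close> is the degree of the cofactor of \<open>l\<close>, while \<open>V\<close>
  sits in degree \<open>d + 1\<close>.\<close>

definition form_colon :: "nat \<Rightarrow> nat \<Rightarrow> 'k::field mpoly set \<Rightarrow> 'k mpoly \<Rightarrow> 'k mpoly set" where
  "form_colon r d V l = {f \<in> forms r d. l * f \<in> V}"

definition form_sum_space :: "nat \<Rightarrow> nat \<Rightarrow> 'k::field mpoly set \<Rightarrow> 'k mpoly \<Rightarrow> 'k mpoly set" where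
  "form_sum_space r d V l = mp.ssum V ((*) l ` forms r d)"

definition form_space :: "nat \<Rightarrow> nat \<Rightarrow> 'k::field mpoly set \<Rightarrow> bool" where
  "form_space r d V \<longleftrightarrow> mp.subspace V \<and> V \<subseteq> forms r d"

lemma form_space_findim: "form_space r d V \<Longrightarrow> mp.findim V"
  unfolding form_space_def using findim_forms mp.findim_subset by blast

lemma form_space_dim_le: "form_space r d V \<Longrightarrow> mp.dim V \<le> mp.dim (forms r d :: 'k mpoly set)"
  for V :: "'k::field mpoly set"
  unfolding form_space_def using mp.dim_mono_findim[OF findim_forms] by blast

lemma dim_codim: "form_space r d V \<Longrightarrow> mp.dim V + codim r d V = mp.dim (forms r d :: 'k mpoly set)"
  for V :: "'k::field mpoly set"
  unfolding codim_def using form_space_dim_le[of r d V] by simp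

lemma codim_antimono: "form_space r d V \<Longrightarrow> form_space r d W \<Longrightarrow> V \<subseteq> W \<Longrightarrow> codim r d W \<le> codim r d V"
  unfolding codim_def using mp.dim_mono_findim[of W V] form_space_findim[of r d W] by simp

lemma codim_eqD: "form_space r d V \<Longrightarrow> form_space r d W \<Longrightarrow> V \<subseteq> W \<Longrightarrow> codim r d V \<le> codim r d W \<Longrightarrow> V = W"
  for V :: "'k::field mpoly set"
  using mp.subspace_eqI_dim[of V W] form_space_findim[of r d W] dim_codim[of r d V] dim_codim[of r d W]
  by (simp add: form_space_def)

lemma form_space_forms: "form_space r d (forms r d)"
  by (simp add: form_space_def subspace_forms)

lemma codim_forms [simp]: "codim r d (forms r d) = 0"
  by (simp add: codim_def)

lemma codim_0_iff: "form_space r d V \<Longrightarrow> codim r d V = 0 \<longleftrightarrow> V = forms r d"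
  using codim_eqD[OF _ form_space_forms] by (auto simp: form_space_def)

lemma form_space_form_colon:
  assumes "form_space r (Suc d) V"
  shows "form_space r d (form_colon r d V l)"
proof -
  have V: "mp.subspace V" using assms by (simp add: form_space_def)
  show ?thesis
    unfolding form_space_def form_colon_def
    using mp.subspace_0[OF V] mp.subspace_add[OF V] mp.subspace_scale[OF V]
      mp.subspace_0[OF subspace_forms] mp.subspace_add[OF subspace_forms] mp.subspace_scale[OF subspace_forms]
    by (auto intro!: mp.subspaceI simp: distrib_left scal_mult_right)
qed

lemma subspace_mult_forms: "mp.subspace ((*) l ` forms r d)"
proof (cases "l = 0")
  case True
  have "(0 :: 'a mpoly) \<in> forms r d" by (rule mp.subspace_0[OF subspace_forms])
  then have "(*) l ` forms r d = {0}" using True by auto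
  then show ?thesis by (simp add: mp.subspace_single_0)
qed (simp add: dim_mult_image findim_forms subspace_forms)

lemma form_space_form_sum_space:
  assumes "form_space r (Suc d) V" "l \<in> forms r 1"
  shows "form_space r (Suc d) (form_sum_space r d V l)"
  using assms subspace_mult_forms[of l r d] subspace_forms mult_form1[of l r _ d]
  unfolding form_space_def form_sum_space_def
  by (metis image_subsetI mp.ssum_least mp.subspace_ssum)

lemma form_sum_space_upper:
  assumes "form_space r (Suc d) V"
  shows "V \<subseteq> form_sum_space r d V l" "f \<in> forms r d \<Longrightarrow> l * f \<in> form_sum_space r d V l"
  using assms mp.ssum_upper[of "(*) l ` forms r d" V] mp.ssum_upper[of V "(*) l ` forms r d"]
    subspace_mult_forms[of l r d]
  unfolding form_space_def form_sum_space_def by auto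

lemma form_sum_space_least:
  assumes "mp.subspace U" "V \<subseteq> U" "\<And>f. f \<in> forms r d \<Longrightarrow> l * f \<in> U"
  shows "form_sum_space r d V l \<subseteq> U"
  unfolding form_sum_space_def using assms by (intro mp.ssum_least) auto

text \<open>The exact sequence \<open>0 -> R_d / (V : l) -> R_(d+1) / V -> R_(d+1) / (V + l R_d) ->
  0\<close>, obtained from \<open>V \<inter> l R_d = l (V : l)\<close> and the dimension
  formula.\<close>

lemma codim_split:
  fixes l :: "'k::field mpoly"
  assumes V: "form_space r (Suc d) V" and l: "l \<in> forms r 1" "l \<noteq> 0"
  shows "codim r (Suc d) V = codim r d (form_colon r d V l) + codim r (Suc d) (form_sum_space r d V l)"
proof -
  note L = dim_mult_image[OF l(2) subspace_forms[of r d] findim_forms]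
  have Q: "form_space r d (form_colon r d V l)" using V form_space_form_colon by blast
  have "V \<inter> (*) l ` forms r d = (*) l ` form_colon r d V l"
    by (auto simp: form_colon_def)
  then have "mp.dim (V \<inter> (*) l ` forms r d) = mp.dim (form_colon r d V l)"
    using dim_mult_image(1)[OF l(2)] Q form_space_findim[OF Q] by (simp add: form_space_def)
  moreover have "mp.dim (form_sum_space r d V l) + mp.dim (V \<inter> (*) l ` forms r d)
      = mp.dim V + mp.dim ((*) l ` forms r d)"
    unfolding form_sum_space_def using V L form_space_findim by (intro mp.dim_ssum_Int) (auto simp: form_space_def)
  ultimately show ?thesis
    using L(1) 
 dim_codim[OF V] dim_codim[OF Q] dim_codim[OF form_space_form_sum_space[OF V l(1)]] by simp
qed

section \<open>Lexicographic ranks\<close>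

text \<open>
  In degree \<open>i\<close> there are \<open>lex_count a i\<close> monomials in three variables in which the largest variable has
  exponent less than \<open>a\<close>.
\<close>

definition lex_count :: "nat \<Rightarrow> nat \<Rightarrow> nat" where
  "lex_count a i = (\<Sum>t<a. i + 1 - t)"

lemma lex_count_0 [simp]: "lex_count 0 i = 0"
  by (simp add: lex_count_def)

lemma lex_count_Suc: "lex_count (Suc a) i = lex_count a i + (i + 1 - a)"
  by (simp add: lex_count_def)

lemma lex_count_mono: "a \<le> a' \<Longrightarrow> lex_count a i \<le> lex_count a' i"
  unfolding lex_count_def by (intro sum_mono2) auto

text \<open>Truncated subtraction makes the summands with \<open>t > i\<close> vanish, so the count
  saturates at \<open>a = i + 1\<close>, where all monomials of degree \<open>i\<close> in three
  variables are counted.\<close>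

lemma lex_count_le_full: "lex_count a i \<le> lex_count (i + 1) i"
proof (cases "a \<le> i + 1")
  case False
  then have "lex_count a i = lex_count (i + 1) i"
    unfolding lex_count_def by (intro sum.mono_neutral_right) auto
  then show ?thesis by simp
qed (rule lex_count_mono)

lemma lex_count_Suc_le: "lex_count a (Suc i) \<le> lex_count a i + a"
  by (induction a) (auto simp: lex_count_Suc)

lemma lex_count_Suc_right: "a \<le> i + 1 \<Longrightarrow> lex_count a (Suc i) = lex_count a i + a"
  by (induction a) (auto simp: lex_count_Suc)

text \<open>The binomial expansion in arithmetic form: \<open>a\<close> is the number of complete
  blocks below \<open>n\<close>, and \<open>b\<close> is the position in block \<open>a\<close>.
  That block has \<open>i + 1 - a\<close> members, whence the bounds on \<open>a\<close> and
  \<open>b\<close>.\<close>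

lemma lex_count_decomp:
  assumes "n < lex_count k i"
  obtains a b where "a < k" "a \<le> i" "b \<le> i - a" "n = lex_count a i + b"
  using assms
proof (induction k arbitrary: thesis)
  case (Suc k)
  show ?case
  proof (cases "n < lex_count k i")
    case True
    then obtain a b where "a < k" "a \<le> i" "b \<le> i - a" "n = lex_count a i + b"
      using Suc.IH by blast
    then show ?thesis using Suc.prems(1)[of a b] by simp
  next
    case False
    then show ?thesis using Suc.prems(1)[of k "n - lex_count k i"] Suc.prems(2) by (auto simp: lex_count_Suc)
  qed
qed simp

text \<open>The value stays inside block \<open>a\<close>, so numbers are ordered as their pairs
  \<open>(a, b)\<close> are lexicographically.\<close>

lemma lex_count_lex_less:
  assumes "a < a'" "a \<le> i" "b \<le> i - a"
  shows "lex_count a i + b < lex_count a' i"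
proof -
  have "lex_count a i + b < lex_count (Suc a) i" using assms(2,3) unfolding lex_count_Suc by linarith
  also have "\<dots> \<le> lex_count a' i" using assms(1) by (intro lex_count_mono) simp
  finally show ?thesis .
qed

lemma lex_count_inj:
  assumes "a \<le> i" "b \<le> i - a" "a' \<le> i" "b' \<le> i - a'" "lex_count a i + b = lex_count a' i + b'"
  shows "a = a' \<and> b = b'"
proof (cases a a' rule: linorder_cases)
  case less
  then show ?thesis using lex_count_lex_less[OF less assms(1,2)] assms(5) by linarith
next
  case greater
  then show ?thesis using lex_count_lex_less[OF greater assms(3,4)] assms(5) by linarith
qed (use assms in simp)

text \<open>
  The variables with index 2, 1, 0 are taken in decreasing order, so that the monomials in fewer
  variables come last. The rank counts the smaller monomials of the same degree.
\<close>

definition lex_rank :: "(nat \<Rightarrow>\<^sub>0 nat) \<Rightarrow> nat" where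
  "lex_rank m = lex_count (coef m 2) (monom_degree m) + coef m 1"

definition mon :: "nat \<Rightarrow> nat \<Rightarrow> nat \<Rightarrow> nat \<Rightarrow>\<^sub>0 nat" where
  "mon a b c = Poly_Mapping.single 2 a + Poly_Mapping.single 1 b + Poly_Mapping.single 0 c"

lemma coef_mon: "coef (mon a b c) j = (if j = 2 then a else if j = 1 then b else if j = 0 then c else 0)"
  by (auto simp: mon_def lookup_add lookup_single)

lemma degree_mon [simp]: "monom_degree (mon a b c) = a + b + c"
  by (simp add: mon_def monom_degree_plus)

lemma mon_plus: "mon a b c + mon a' b' c' = mon (a + a') (b + b') (c + c')"
  by (rule poly_mapping_eqI) (simp add: coef_mon lookup_add)

lemma mon_inject [simp]: "mon a b c = mon a' b' c' \<longleftrightarrow> a = a' \<and> b = b' \<and> c = c'"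
proof
  assume *: "mon a b c = mon a' b' c'"
  have "coef (mon a b c) j = coef (mon a' b' c') j" for j using * by simp
  from this[of 0] this[of 1] this[of 2] show "a = a' \<and> b = b' \<and> c = c'"
    by (simp add: coef_mon)
qed simp

lemma single_eq_mon:
  "Poly_Mapping.single 0 k = mon 0 0 k" "Poly_Mapping.single (Suc 0) k = mon 0 k 0"
  "Poly_Mapping.single 2 k = mon k 0 0"
  by (simp_all add: mon_def)

lemma supp_subset_iff: "supp m \<subseteq> {..<r} \<longleftrightarrow> (\<forall>j\<ge>r. coef m j = 0)" for m :: "nat \<Rightarrow>\<^sub>0 nat"
proof -
  have "supp m \<subseteq> {..<r} \<longleftrightarrow> (\<forall>j. coef m j \<noteq> 0 \<longrightarrow> j < r)"
    by (simp add: subset_iff in_keys_iff)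
  then show ?thesis by (meson not_less)
qed

lemma mon_in_monoms:
  "mon a b c \<in> monoms r d \<longleftrightarrow> a + b + c = d \<and> (r \<le> 2 \<longrightarrow> a = 0) \<and> (r \<le> 1 \<longrightarrow> b = 0) \<and> (r = 0 \<longrightarrow> c = 0)"
proof -
  have "(\<forall>j\<ge>r. coef (mon a b c) j = 0) \<longleftrightarrow> (r \<le> 2 \<longrightarrow> a = 0) \<and> (r \<le> 1 \<longrightarrow> b = 0) \<and> (r = 0 \<longrightarrow> c = 0)" (is "?L = ?R")
  proof
    assume ?L
    from this[rule_format, of 2] this[rule_format, of 1] this[rule_format, of 0] show ?R
      by (simp add: coef_mon)
  next
    assume ?R
    then show ?L by (simp add: coef_mon)
  qed
  then show ?thesis unfolding monoms_def supp_subset_iff by auto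
qed

lemma monoms_mon:
  assumes "m \<in> monoms r d" "r \<le> 3"
  obtains a b c where "m = mon a b c" "a + b + c = d"
proof -
  have "m = mon (coef m 2) (coef m 1) (coef m 0)"
    using assms by (intro poly_mapping_eqI) (auto simp: coef_mon monoms_def supp_subset_iff)
  moreover from this have "coef m 2 + coef m 1 + coef m 0 = d"
    using assms degree_mon[of "coef m 2" "coef m 1" "coef m 0"] by (simp add: monoms_def)
  ultimately show ?thesis using that by blast
qed

lemma lex_rank_mon [simp]: "lex_rank (mon a b c) = lex_count a (a + b + c) + b"
  by (simp add: lex_rank_def coef_mon)

lemma inj_on_lex_rank: "r \<le> 3 \<Longrightarrow> inj_on lex_rank (monoms r d)"
proof (rule inj_onI)
  fix m m' assume *: "r \<le> 3" "m \<in> monoms r d" "m' \<in> monoms r d" "lex_rank m = lex_rank m'"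
  obtain a b c where m: "m = mon a b c" "a + b + c = d" using * monoms_mon by blast
  obtain a' b' c' where m': "m' = mon a' b' c'" "a' + b' + c' = d" using * monoms_mon by blast
  have "a = a' \<and> b = b'"
    using m m' *(4) by (intro lex_count_inj[of a d b a' b']) auto
  then show "m = m'" using m m' by auto
qed

definition monom_count :: "nat \<Rightarrow> nat \<Rightarrow> nat" where
  "monom_count r d = (if r = 3 then lex_count (d + 1) d else if r = 2 then d + 1 else 1)"

text \<open>Since monomials in fewer variables come last, the ranks fill an initial segment for each
  of \<open>r = 1, 2, 3\<close>. Any prescribed codimension can thus be realised by cutting off at a
  rank.\<close>

lemma lex_rank_image:
  assumes "r \<in> {1,2,3}"
  shows "lex_rank ` monoms r d = {..<monom_count r d}"
proof
  show "lex_rank ` monoms r d \<subseteq> {..<monom_count r d}"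
  proof clarify
    fix m assume m: "m \<in> monoms r d"
    obtain a b c where abc: "m = mon a b c" "a + b + c = d"
      by (rule monoms_mon[OF m]) (use assms in auto)
    have "lex_count a d + b < lex_count (d + 1) d"
      using abc by (intro lex_count_lex_less) auto
    then show "lex_rank m < monom_count r d"
      using m abc assms by (auto simp: monom_count_def mon_in_monoms)
  qed
  show "{..<monom_count r d} \<subseteq> lex_rank ` monoms r d"
  proof clarify
    fix n assume n: "n < monom_count r d"
    consider "r = 3" | "r = 2" | "r = 1" using assms by auto
    then show "n \<in> lex_rank ` monoms r d"
    proof cases
      case 1
      then obtain a b where "a \<le> d" "b \<le> d - a" "n = lex_count a d + b"
        using n lex_count_decomp[of n "d + 1" d] by (auto simp: monom_count_def)
      then show ?thesis using 1
        by (intro image_eqI[of _ _ "mon a b (d - a - b)"]) (auto simp: mon_in_monoms)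
    next
      case 2
      then show ?thesis using n
        by (intro image_eqI[of _ _ "mon 0 n (d - n)"]) (auto simp: mon_in_monoms monom_count_def)
    next
      case 3
      then show ?thesis using n
        by (intro image_eqI[of _ _ "mon 0 0 d"]) (auto simp: mon_in_monoms monom_count_def)
    qed
  qed
qed

lemma card_monoms: "r \<in> {1,2,3} \<Longrightarrow> card (monoms r d) = monom_count r d"
  using card_image[OF inj_on_lex_rank, of r d] lex_rank_image[of r d] by auto

lemma card_lex_rank_less:
  assumes "r \<in> {1,2,3}" "n \<le> monom_count r d"
  shows "card {m \<in> monoms r d. lex_rank m < n} = n"
proof -
  have "lex_rank ` {m \<in> monoms r d. lex_rank m < n} = {..<n}"
  proof
    show "{..<n} \<subseteq> lex_rank ` {m \<in> monoms r d. lex_rank m < n}"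
    proof
      fix k assume k: "k \<in> {..<n}"
      then have "k \<in> lex_rank ` monoms r d" using lex_rank_image[OF assms(1), of d] assms(2) by simp
      then show "k \<in> lex_rank ` {m \<in> monoms r d. lex_rank m < n}" using k by auto
    qed
  qed auto
  moreover have "inj_on lex_rank {m \<in> monoms r d. lex_rank m < n}"
    using assms by (intro inj_on_subset[OF inj_on_lex_rank[of r d]]) auto
  ultimately show ?thesis using card_image[of lex_rank "{m \<in> monoms r d. lex_rank m < n}"] by simp
qed

section \<open>General linear forms and reduction modulo two of them\<close>

lemma forms_Suc_subset:
  fixes U :: "'k::field mpoly set"
  assumes "mp.subspace U" "\<And>j f. j < r \<Longrightarrow> f \<in> forms r d \<Longrightarrow> mpoly_var j * f \<in> U"
  shows "forms r (Suc d) \<subseteq> U"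
proof -
  have "Poly_Mapping.single m (1::'k) \<in> U" if m: "m \<in> monoms r (Suc d)" for m
  proof -
    have "monom_degree m \<noteq> 0" using m by (simp add: monoms_def)
    then have "m \<noteq> 0" by (simp add: monom_degree_0_iff)
    then obtain j where j: "j \<in> supp m" using keys_eq_empty[of m] by blast
    then have jr: "j < r" using m by (auto simp: monoms_def)
    define n where "n = m - Poly_Mapping.single j 1"
    have mn: "m = Poly_Mapping.single j 1 + n"
      using j by (intro poly_mapping_eqI) (auto simp: n_def lookup_add lookup_minus lookup_single when_def in_keys_iff)
    have "n \<in> monoms r d"
      using m monoms_plus_iff[of "Poly_Mapping.single j 1" r 1 n d] monoms_var[of j r] jr mn by simp
    then have "mpoly_var j * Poly_Mapping.single n (1::'k) \<in> U"
      using jr by (intro assms(2)) (auto simp: forms_eq intro: single_in_polys)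
    then show ?thesis by (simp add: mpoly_var_def mult_single mn)
  qed
  then have "mp.span ((\<lambda>m. Poly_Mapping.single m (1::'k)) ` monoms r (Suc d)) \<subseteq> U"
    using assms(1) by (intro mp.span_minimal) auto
  then show ?thesis by (simp add: span_mono_polys finite_monoms forms_eq)
qed

lemma linear_form_in:
  fixes U :: "'k::field mpoly set"
  assumes "mp.subspace U" "\<And>j. j < r \<Longrightarrow> mpoly_var j \<in> U" "l \<in> forms r 1"
  shows "l \<in> U"
proof -
  have "mpoly_var j * f \<in> U" if "j < r" "f \<in> forms r 0" for j and f :: "'k mpoly"
  proof -
    have f: "f = mpoly_const (coef f 0)"
      using that(2) by (intro poly_mapping_eqI)
        (auto simp: forms_eq polys_iff monoms_def monom_degree_0_iff mpoly_const_def lookup_single when_def)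
    have "mpoly_var j * f = scal (coef f 0) (mpoly_var j)"
      by (subst f) (simp add: scal_def mult.commute)
    then show ?thesis using assms(1,2) that(1) by (simp add: mp.subspace_scale)
  qed
  then show ?thesis using forms_Suc_subset[OF assms(1), of r 0] assms(3) by auto
qed

text \<open>The coefficients lie on the moment curve, so that any \<open>r\<close> members are linearly independent.\<close>

definition pencil :: "nat \<Rightarrow> 'k::field \<Rightarrow> 'k mpoly" where
  "pencil r c = (\<Sum>j<r. scal (c ^ j) (mpoly_var j))"

lemma pencil_form: "pencil r c \<in> forms r 1"
  unfolding pencil_def
  by (intro mp.subspace_sum[OF subspace_forms] mp.subspace_scale[OF subspace_forms] var_form) simp

text \<open>The coefficient is \<open>c ^ 0 = 1\<close>, also at \<open>c = 0\<close>; hence no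
  member of the pencil vanishes.\<close>

lemma coef_pencil: "0 < r \<Longrightarrow> coef (pencil r c) (Poly_Mapping.single 0 1) = 1"
proof -
  assume "0 < r"
  have "coef (pencil r c) (Poly_Mapping.single 0 1) = (\<Sum>j<r. if j = 0 then 1 else 0)"
    unfolding pencil_def lookup_sum mpoly_var_def
    by (intro sum.cong) (auto simp: lookup_single when_def inj_eq[OF inj_single] dest!: arg_cong[where f = "\<lambda>m. coef m 0"])
  then show ?thesis using \<open>0 < r\<close> by simp
qed

lemma pencil_nonzero: "0 < r \<Longrightarrow> pencil r c \<noteq> 0"
  using coef_pencil[of r c] by auto

text \<open>
  By Vieta, the common zero of the members with parameters \<open>c\<close> and \<open>c'\<close> has the coordinates
  \<open>(c c', - (c + c'), 1)\<close>.
\<close>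

lemma mod_two_pencil:
  fixes U :: "'k::field mpoly set"
  assumes U: "mp.subspace U" "c \<noteq> c'" "f \<in> forms 3 d"
    and "\<And>f. f \<in> forms 3 d \<Longrightarrow> pencil 3 c * f \<in> U" "\<And>f. f \<in> forms 3 d \<Longrightarrow> pencil 3 c' * f \<in> U"
  shows "mpoly_var 1 * f + scal (c + c') (mpoly_var 2 * f) \<in> U"
    and "mpoly_var 0 * f - scal (c * c') (mpoly_var 2 * f) \<in> U"
proof -
  have L: "pencil 3 c * f = mpoly_var 0 * f + scal c (mpoly_var 1 * f) + scal (c^2) (mpoly_var 2 * f)" for c :: 'k
    by (simp add: pencil_def numeral_3_eq_3 numeral_2_eq_2 distrib_right scal_mult_left)
  have ne: "c - c' \<noteq> 0" using U by simp
  \<comment> \<open>Divided difference: \<open>c^2 - c'^2 = (c - c') (c + c')\<close>. Eliminating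
    the variable 1 afterwards leaves \<open>c^2 - c (c + c') = - c c'\<close> at the variable
    2.\<close>
  have "scal (c - c') (mpoly_var 1 * f + scal (c + c') (mpoly_var 2 * f)) = pencil 3 c * f - pencil 3 c' * f"
    unfolding L by (simp add: mp.scale_right_distrib mp.scale_left_diff_distrib power2_eq_square
      algebra_simps mp.scale_left_distrib)
  also have "\<dots> \<in> U" using assms by (intro mp.subspace_diff) auto
  finally have "scal (1 / (c - c')) (scal (c - c') (mpoly_var 1 * f + scal (c + c') (mpoly_var 2 * f))) \<in> U"
    using U(1) by (rule mp.subspace_scale[rotated])
  then show *: "mpoly_var 1 * f + scal (c + c') (mpoly_var 2 * f) \<in> U"
    using ne by simp
  have "mpoly_var 0 * f - scal (c * c') (mpoly_var 2 * f)
      = pencil 3 c * f - scal c (mpoly_var 1 * f + scal (c + c') (mpoly_var 2 * f))"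
    unfolding L by (simp add: mp.scale_right_distrib power2_eq_square algebra_simps mp.scale_left_distrib)
  also have "\<dots> \<in> U" using assms * by (intro mp.subspace_diff mp.subspace_scale) auto
  finally show "mpoly_var 0 * f - scal (c * c') (mpoly_var 2 * f) \<in> U" .
qed

text \<open>In two variables two distinct members span all linear forms, and in one variable a
  single member is the variable itself.\<close>

lemma small_mod_two_pencil:
  fixes U :: "'k::field mpoly set"
  assumes "mp.subspace U" "c \<noteq> c'" "r \<in> {1,2}"
    and 1: "\<And>f. f \<in> forms r d \<Longrightarrow> pencil r c * f \<in> U" and 2: "\<And>f. f \<in> forms r d \<Longrightarrow> pencil r c' * f \<in> U"
  shows "forms r (Suc d) \<subseteq> U"
proof (rule forms_Suc_subset[OF assms(1)])
  fix j and f :: "'k mpoly" assume j: "j < r" and f: "f \<in> forms r d"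
  show "mpoly_var j * f \<in> U"
  proof (cases "r = 1")
    case True
    then show ?thesis using 1[OF f] j by (simp add: pencil_def)
  next
    case False
    then have r: "r = 2" using assms by simp
    have L: "pencil r c * f = mpoly_var 0 * f + scal c (mpoly_var 1 * f)" for c :: 'k
      by (simp add: r pencil_def numeral_2_eq_2 distrib_right scal_mult_left)
    have ne: "c - c' \<noteq> 0" using assms by simp
    have "scal (c - c') (mpoly_var 1 * f) = pencil r c * f - pencil r c' * f"
      unfolding L by (simp add: mp.scale_left_diff_distrib)
    also have "\<dots> \<in> U" using assms f by (intro mp.subspace_diff) auto
    finally have "scal (1 / (c - c')) (scal (c - c') (mpoly_var 1 * f)) \<in> U"
      using assms(1) by (rule mp.subspace_scale[rotated])
    then have *: "mpoly_var 1 * f \<in> U" using ne by simp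
    have "mpoly_var 0 * f = pencil r c * f - scal c (mpoly_var 1 * f)"
      unfolding L by simp
    also have "\<dots> \<in> U" using assms f * by (intro mp.subspace_diff mp.subspace_scale) auto
    finally have "mpoly_var 0 * f \<in> U" .
    with * show ?thesis using j r by (cases "j = 0") (auto simp: less_2_cases_iff)
  qed
qed

text \<open>Modulo two members the variables 1 and 0 are \<open>- (c + c')\<close> and
  \<open>c c'\<close> times the variable 2. Replacing one factor at a time turns a monomial into its
  value at the common zero times a power of the variable 2.\<close>

lemma mon_mod_two_pencil:
  fixes U :: "'k::field mpoly set"
  assumes U: "mp.subspace U" "c \<noteq> c'"
    and 1: "\<And>f. f \<in> forms 3 d \<Longrightarrow> pencil 3 c * f \<in> U" and 2: "\<And>f. f \<in> forms 3 d \<Longrightarrow> pencil 3 c' * f \<in> U"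
  shows "a + b + e = Suc d \<Longrightarrow>
    Poly_Mapping.single (mon e b a) 1
      - scal ((c * c') ^ a * (- (c + c')) ^ b) (Poly_Mapping.single (mon (Suc d) 0 0) 1) \<in> U"
proof (induction a arbitrary: e)
  case 0
  then show ?case
  proof (induction b arbitrary: e)
    case 0
    then show ?case using U by (simp add: mp.subspace_0)
  next
    case (Suc b)
    define f where "f = Poly_Mapping.single (mon e b 0) (1::'k)"
    have f: "f \<in> forms 3 d"
      using Suc.prems by (auto simp: f_def forms_eq mon_in_monoms intro!: single_in_polys)
    define X where "X = Poly_Mapping.single (mon (Suc d) 0 0) (1::'k)"
    define s where "s = - (c + c')"
    have "mpoly_var 1 * f + scal (c + c') (mpoly_var 2 * f) \<in> U"
      using mod_two_pencil(1)[OF U f 1 2] .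
    moreover have "mpoly_var 1 * f = Poly_Mapping.single (mon e (Suc b) 0) 1"
      "mpoly_var 2 * f = Poly_Mapping.single (mon (Suc e) b 0) 1"
      by (simp_all add: mpoly_var_def f_def mult_single single_eq_mon mon_plus)
    moreover have "Poly_Mapping.single (mon (Suc e) b 0) (1::'k) - scal (s ^ b) X \<in> U"
      using Suc.IH[of "Suc e"] Suc.prems by (simp add: X_def s_def)
    ultimately have *: "Poly_Mapping.single (mon e (Suc b) 0) 1 + scal (c + c') (Poly_Mapping.single (mon (Suc e) b 0) 1) \<in> U"
        "Poly_Mapping.single (mon (Suc e) b 0) (1::'k) - scal (s ^ b) X \<in> U"
      by simp_all
    have "(Poly_Mapping.single (mon e (Suc b) 0) 1 + scal (c + c') (Poly_Mapping.single (mon (Suc e) b 0) 1))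
      + scal s (Poly_Mapping.single (mon (Suc e) b 0) (1::'k) - scal (s ^ b) X) \<in> U"
      using mp.subspace_add[OF U(1) *(1) mp.subspace_scale[OF U(1) *(2)]] .
    moreover have "c + c' = - s" by (simp add: s_def)
    ultimately show ?case
      unfolding X_def[symmetric] s_def[symmetric]
      by (simp add: mp.scale_right_diff_distrib)
  qed
next
  case (Suc a)
  define f where "f = Poly_Mapping.single (mon e b a) (1::'k)"
  have f: "f \<in> forms 3 d"
    using Suc.prems by (auto simp: f_def forms_eq mon_in_monoms intro!: single_in_polys)
  define X where "X = Poly_Mapping.single (mon (Suc d) 0 0) (1::'k)"
  define t where "t = (- (c + c')) ^ b"
  define s where "s = c * c'"
  have "mpoly_var 0 * f - scal s (mpoly_var 2 * f) \<in> U"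
    using mod_two_pencil(2)[OF U f 1 2] by (simp add: s_def)
  moreover have "mpoly_var 0 * f = Poly_Mapping.single (mon e b (Suc a)) 1"
    "mpoly_var 2 * f = Poly_Mapping.single (mon (Suc e) b a) 1"
    by (simp_all add: mpoly_var_def f_def mult_single single_eq_mon mon_plus)
  moreover have "Poly_Mapping.single (mon (Suc e) b a) (1::'k) - scal (s ^ a * t) X \<in> U"
    using Suc.IH[of "Suc e"] Suc.prems by (simp add: X_def s_def t_def)
  ultimately have *: "Poly_Mapping.single (mon e b (Suc a)) 1 - scal s (Poly_Mapping.single (mon (Suc e) b a) 1) \<in> U"
      "Poly_Mapping.single (mon (Suc e) b a) (1::'k) - scal (s ^ a * t) X \<in> U"
    by simp_all
  have "(Poly_Mapping.single (mon e b (Suc a)) 1 - scal s (Poly_Mapping.single (mon (Suc e) b a) 1))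
    + scal s (Poly_Mapping.single (mon (Suc e) b a) (1::'k) - scal (s ^ a * t) X) \<in> U"
    using mp.subspace_add[OF U(1) *(1) mp.subspace_scale[OF U(1) *(2)]] .
  then show ?case
    unfolding X_def[symmetric] s_def[symmetric] t_def[symmetric]
    by (simp add: mp.scale_right_diff_distrib mult.assoc)
qed

section \<open>Restriction to general linear forms\<close>

lemma dim_zero_space [simp]: "mp.dim {0} = 0"
  using mp.dim_le_card[of "{0}" "{}"] by simp

lemma degree_lin_factor: "Polynomial.degree ([:a, -1:] ^ n :: 'k::field poly) = n"
  by (simp add: degree_power_eq)

lemma coeff_lin_factor: "Polynomial.coeff ([:a, -1:] ^ n :: 'k::field poly) n = (- 1) ^ n"
  using lead_coeff_power[of "[:a, -1::'k:]" n] by (simp add: degree_lin_factor)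

text \<open>
  The sum is the value of \<open>f\<close> at the common zero of two members of the pencil. As a polynomial in the
  second parameter, its coefficient in the top degree is a non-zero polynomial in the first one.
\<close>

lemma generic_value:
  fixes f :: "'k::field mpoly"
  assumes f: "f \<in> forms 3 d" "f \<noteq> 0"
  shows "\<forall>\<^sub>F c in cofinite. \<forall>\<^sub>F c' in cofinite.
    (\<Sum>m\<in>supp f. coef f m * ((c * c') ^ coef m 0 * (- (c + c')) ^ coef m 1)) \<noteq> 0"
proof -
  define D where "D = Max ((\<lambda>m. coef m 0 + coef m 1) ` supp f)"
  have ne: "supp f \<noteq> {}" using f by auto
  have "D \<in> (\<lambda>m. coef m 0 + coef m 1) ` supp f"
    unfolding D_def using ne by (intro Max_in) auto
  then obtain m1 where m1: "m1 \<in> supp f" "coef m1 0 + coef m1 1 = D" by auto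
  have D: "coef m 0 + coef m 1 \<le> D" if "m \<in> supp f" for m
    unfolding D_def using that by (intro Max_ge) auto
  define S where "S = {m \<in> supp f. coef m 0 + coef m 1 = D}"
  \<comment> \<open>\<open>Q\<close> is the coefficient of \<open>c'^D\<close> as a polynomial in
    \<open>c\<close>: the leading coefficient of \<open>(c c')^p (- (c + c'))^q\<close> in
    \<open>c'\<close> is \<open>c^p (-1)^q\<close>.\<close>
  define Q where "Q = (\<Sum>m\<in>S. Polynomial.monom (coef f m * (- 1) ^ coef m 1) (coef m 0))"
  define P where "P c = (\<Sum>m\<in>supp f. Polynomial.smult (coef f m)
      (Polynomial.monom (c ^ coef m 0) (coef m 0) * [:- c, - 1:] ^ coef m 1))" for c
  have finS: "finite S" by (simp add: S_def)
  have sub: "supp f \<subseteq> monoms 3 d" using f by (simp add: forms_eq polys_def)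
  \<comment> \<open>By homogeneity the exponent of the variable 0 determines a monomial of
    \<open>S\<close>, so the terms of \<open>Q\<close> have distinct degrees and cannot
    cancel.\<close>
  have eq: "m = m1" if "m \<in> S" "coef m 0 = coef m1 0" for m
  proof -
    have m: "m \<in> monoms 3 d" "m1 \<in> monoms 3 d" using that m1 sub by (auto simp: S_def)
    obtain a b c where 1: "m = mon a b c" "a + b + c = d" using m(1) by (rule monoms_mon) simp
    obtain a' b' c' where 2: "m1 = mon a' b' c'" "a' + b' + c' = d" using m(2) by (rule monoms_mon) simp
    show ?thesis using that m1 1 2 by (simp add: S_def coef_mon)
  qed
  have "Polynomial.coeff Q (coef m1 0) = (\<Sum>m\<in>S. if m = m1 then coef f m * (- 1) ^ coef m 1 else 0)"
    unfolding Q_def coeff_sum using eq by (intro sum.cong) auto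
  also have "\<dots> = coef f m1 * (- 1) ^ coef m1 1"
    using m1 finS by (simp add: S_def)
  finally have "Q \<noteq> 0" using m1 by (auto simp: in_keys_iff)
  then have fQ: "finite {c. poly Q c = 0}" by (rule poly_roots_finite)
  have coeffP: "Polynomial.coeff (P c) D = poly Q c" for c
  proof -
    have "Polynomial.coeff (P c) D = (\<Sum>m\<in>supp f. coef f m *
       (c ^ coef m 0 * Polynomial.coeff ([:- c, - 1:] ^ coef m 1) (D - coef m 0)))"
      unfolding P_def coeff_sum
    proof (intro sum.cong refl)
      fix m assume "m \<in> supp f"
      then have "coef m 0 \<le> D" using D[of m] by simp
      then show "Polynomial.coeff (Polynomial.smult (coef f m)
          (Polynomial.monom (c ^ coef m 0) (coef m 0) * [:- c, - 1:] ^ coef m 1)) D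
        = coef f m * (c ^ coef m 0 * Polynomial.coeff ([:- c, - 1:] ^ coef m 1) (D - coef m 0))"
        by (simp add: coeff_monom_mult)
    qed
    also have "\<dots> = (\<Sum>m\<in>supp f. if coef m 0 + coef m 1 = D then coef f m * (c ^ coef m 0 * (- 1) ^ coef m 1) else 0)"
    proof (intro sum.cong refl)
      fix m assume m: "m \<in> supp f"
      show "coef f m * (c ^ coef m 0 * Polynomial.coeff ([:- c, - 1:] ^ coef m 1) (D - coef m 0)) =
        (if coef m 0 + coef m 1 = D then coef f m * (c ^ coef m 0 * (- 1) ^ coef m 1) else 0)"
      proof (cases "coef m 0 + coef m 1 = D")
        case True
        then have "D - coef m 0 = coef m 1" by simp
        then show ?thesis unfolding \<open>D - coef m 0 = coef m 1\<close> coeff_lin_factor using True by simp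
      next
        case False
        then have "coef m 1 < D - coef m 0" using D[OF m] by simp
        then have "Polynomial.coeff ([:- c, - 1:] ^ coef m 1) (D - coef m 0) = 0"
          by (intro coeff_eq_0) (simp only: degree_lin_factor)
        then show ?thesis using False by simp
      qed
    qed
    also have "\<dots> = (\<Sum>m\<in>S. coef f m * (c ^ coef m 0 * (- 1) ^ coef m 1))"
      unfolding S_def by (rule sum.inter_filter[symmetric]) simp
    also have "\<dots> = poly Q c"
      unfolding Q_def poly_sum by (intro sum.cong) (simp_all add: poly_monom ac_simps)
    finally show ?thesis .
  qed
  have polyP: "poly (P c) c' = (\<Sum>m\<in>supp f. coef f m * ((c * c') ^ coef m 0 * (- (c + c')) ^ coef m 1))" for c c'
    unfolding P_def poly_sum
    by (intro sum.cong) (simp_all add: poly_monom poly_power power_mult_distrib)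
  have "\<forall>\<^sub>F c in cofinite. poly Q c \<noteq> 0"
    unfolding eventually_cofinite using fQ by simp
  then show ?thesis
  proof eventually_elim
    case (elim c)
    then have "P c \<noteq> 0" using coeffP[of c] by auto
    then have "finite {c'. poly (P c) c' = 0}" by (rule poly_roots_finite)
    then show ?case unfolding eventually_cofinite polyP[symmetric] by simp
  qed
qed

text \<open>For \<open>r = 3\<close> every form is, modulo the two members, its value at their
  common zero times a power of the variable 2. A non-zero form in \<open>V\<close> with non-zero
  value brings this power into the sum. The quantifiers are nested because the exceptional
  \<open>c'\<close> depend on \<open>c\<close>.\<close>

lemma generic_full:
  fixes V :: "'k::field_char_0 mpoly set"
  assumes r: "r \<in> {1,2,3}" and V: "form_space r (Suc d) V" and V0: "r = 3 \<Longrightarrow> V \<noteq> {0}"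
  shows "\<forall>\<^sub>F c in cofinite. \<forall>\<^sub>F c' in cofinite.
    form_sum_space r d (form_sum_space r d V (pencil r c)) (pencil r c') = forms r (Suc d)"
proof -
  let ?U = "\<lambda>c c'. form_sum_space r d (form_sum_space r d V (pencil r c)) (pencil r c')"
  have S1: "form_space r (Suc d) (form_sum_space r d V (pencil r c))" for c
    by (rule form_space_form_sum_space[OF V pencil_form])
  have S2: "form_space r (Suc d) (?U c c')" for c c'
    by (rule form_space_form_sum_space[OF S1 pencil_form])
  have U: "mp.subspace (?U c c')" "?U c c' \<subseteq> forms r (Suc d)" for c c'
    using S2[of c c'] by (simp_all add: form_space_def)
  have l1: "pencil r c * f \<in> ?U c c'" if "f \<in> forms r d" for c c' f
    using form_sum_space_upper(2)[OF V that, of "pencil r c"] form_sum_space_upper(1)[OF S1[of c], of "pencil r c'"] by blast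
  have l2: "pencil r c' * f \<in> ?U c c'" if "f \<in> forms r d" for c c' f
    using form_sum_space_upper(2)[OF S1 that] .
  have neq: "\<forall>\<^sub>F c' in cofinite. c \<noteq> c'" for c :: 'k
    by (simp add: eventually_cofinite)
  show ?thesis
  proof (cases "r = 3")
    case False
    have *: "?U c c' = forms r (Suc d)" if "c \<noteq> c'" for c c'
      using small_mod_two_pencil[OF U(1) that _ l1 l2] U(2) r False by blast
    have "\<forall>\<^sub>F c' in cofinite. ?U c c' = forms r (Suc d)" for c
      using neq[of c] by eventually_elim (rule *)
    then show ?thesis by simp
  next
    case True
    have "0 \<in> V" using V mp.subspace_0 by (auto simp: form_space_def)
    then obtain f where f: "f \<in> V" "f \<noteq> 0" using V0[OF True] by blast
    then have ff: "f \<in> forms 3 (Suc d)" using V True by (auto simp: form_space_def)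
    from generic_value[OF ff f(2)] show ?thesis
    proof eventually_elim
      case (elim c)
      with neq[of c] show ?case
      proof eventually_elim
        case (elim c')
        define X where "X = Poly_Mapping.single (mon (Suc d) 0 0) (1::'k)"
        define v where "v m = (c * c') ^ coef m 0 * (- (c + c')) ^ coef m 1" for m :: "nat \<Rightarrow>\<^sub>0 nat"
        have mono: "Poly_Mapping.single m 1 - scal (v m) X \<in> ?U c c'" if m: "m \<in> monoms 3 (Suc d)" for m
        proof -
          obtain e b a where 1: "m = mon e b a" "e + b + a = Suc d" using m by (rule monoms_mon) simp
          show ?thesis
            using mon_mod_two_pencil[OF U(1)[unfolded True] elim(1) l1[unfolded True] l2[unfolded True], where d = d and a = a and b = b and e = e] 1
            by (simp add: X_def v_def coef_mon True ac_simps)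
        qed
        have sub: "supp f \<subseteq> monoms 3 (Suc d)" using ff by (simp add: forms_eq polys_def)
        have "(\<Sum>m\<in>supp f. scal (coef f m) (Poly_Mapping.single m 1 - scal (v m) X)) \<in> ?U c c'"
          using mono sub by (intro mp.subspace_sum[OF U(1)] mp.subspace_scale[OF U(1)]) auto
        also have "(\<Sum>m\<in>supp f. scal (coef f m) (Poly_Mapping.single m 1 - scal (v m) X))
          = f - scal (\<Sum>m\<in>supp f. coef f m * v m) X"
          using polys_decomp[of f] by (simp add: mp.scale_right_diff_distrib sum_subtractf mp.scale_sum_left)
        finally have 1: "f - scal (\<Sum>m\<in>supp f. coef f m * v m) X \<in> ?U c c'" .
        have "V \<subseteq> ?U c c'" using form_sum_space_upper(1)[OF V] form_sum_space_upper(1)[OF S1] by blast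
        then have "f - (f - scal (\<Sum>m\<in>supp f. coef f m * v m) X) \<in> ?U c c'"
          using f(1) by (intro mp.subspace_diff[OF U(1) _ 1]) blast
        then have "scal (\<Sum>m\<in>supp f. coef f m * v m) X \<in> ?U c c'" by simp
        then have "scal (1 / (\<Sum>m\<in>supp f. coef f m * v m)) (scal (\<Sum>m\<in>supp f. coef f m * v m) X) \<in> ?U c c'"
          by (rule mp.subspace_scale[OF U(1)])
        then have X: "X \<in> ?U c c'" using elim(2) by (simp add: v_def)
        have "Poly_Mapping.single m (1::'k) \<in> ?U c c'" if m: "m \<in> monoms 3 (Suc d)" for m
          using mp.subspace_add[OF U(1) mono[OF m] mp.subspace_scale[OF U(1) X, of "v m"]] by simp
        then have "mp.span ((\<lambda>m. Poly_Mapping.single m (1::'k)) ` monoms 3 (Suc d)) \<subseteq> ?U c c'"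
          using U(1) by (intro mp.span_minimal) auto
        then have "forms r (Suc d) \<subseteq> ?U c c'" using True by (simp add: span_mono_polys finite_monoms forms_eq)
        then show ?case using U(2) by blast
      qed
    qed
  qed
qed

text \<open>For \<open>d = 0\<close> there are no multiples of \<open>l\<close> to add.\<close>

definition cut :: "nat \<Rightarrow> nat \<Rightarrow> 'k::field mpoly set \<Rightarrow> 'k mpoly \<Rightarrow> 'k mpoly set" where
  "cut r d V l = (case d of 0 \<Rightarrow> V | Suc e \<Rightarrow> form_sum_space r e V l)"

lemma form_space_cut: "form_space r d V \<Longrightarrow> l \<in> forms r 1 \<Longrightarrow> form_space r d (cut r d V l)"
  by (auto simp: cut_def form_space_form_sum_space split: nat.split)

lemma form_sum_space_swap: "form_sum_space r d (form_sum_space r d V l) l' = form_sum_space r d (form_sum_space r d V l') l"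
proof -
  have "form_sum_space r d (form_sum_space r d V l) l' \<subseteq> form_sum_space r d (form_sum_space r d V l') l" for l l'
  proof
    fix x assume "x \<in> form_sum_space r d (form_sum_space r d V l) l'"
    then obtain v f g where "v \<in> V" "f \<in> forms r d" "g \<in> forms r d" "x = (v + l' * g) + l * f"
      by (auto simp: form_sum_space_def mp.ssum_def ac_simps)
    then show "x \<in> form_sum_space r d (form_sum_space r d V l') l"
      unfolding form_sum_space_def by (auto intro!: mp.ssumI)
  qed
  then show ?thesis by blast
qed

text \<open>Characteristic zero enters here: the field is infinite, so a parameter with finitely
  many exceptions exists, and finitely many such requirements can be met together.\<close>

lemma infinite_cofinite: "(cofinite :: 'k::field_char_0 filter) \<noteq> bot"
  by (simp add: cofinite_bot infinite_UNIV_char_0)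

text \<open>
  A bound for general restrictions of \<open>V\<close> passes to \<open>(V : l)\<close>, because \<open>(V : l) + l' R\<close> is contained in
  \<open>(V + l' R : l)\<close>, which has the same codimension as \<open>V + l' R\<close> when \<open>V + l R + l' R\<close> is everything.
\<close>

lemma codim_generic_cut:
  fixes V :: "'k::field_char_0 mpoly set"
  assumes r: "r \<in> {1,2,3}"
  shows "form_space r d V \<Longrightarrow> \<forall>\<^sub>F c in cofinite. \<alpha> \<le> codim r d (cut r d V (pencil r c)) \<Longrightarrow> lex_count \<alpha> d \<le> codim r d V"
proof (induction d arbitrary: V)
  case 0
  then have "\<exists>c::'k. \<alpha> \<le> codim r 0 (cut r 0 V (pencil r c))"
    using infinite_cofinite[where 'k = 'k] by (metis (mono_tags, lifting) eventually_happens')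
  moreover have "lex_count \<alpha> 0 \<le> \<alpha>" using lex_count_Suc_le by (induction \<alpha>) (auto simp: lex_count_Suc)
  ultimately show ?case by (auto simp: cut_def)
next
  case (Suc e)
  note V = Suc.prems(1)
  have r0: "0 < r" using r by auto
  show ?case
  proof (cases "r = 3 \<and> V = {0}")
    \<comment> \<open>For \<open>V = 0\<close> two linear forms do not generate everything, but the
      codimension is already the largest value of \<open>lex_count\<close>.\<close>
    case True
    have "mp.dim (forms r (Suc e) :: 'k mpoly set) = lex_count (Suc e + 1) (Suc e)"
      using r True by (simp add: dim_forms card_monoms monom_count_def)
    then show ?thesis using True lex_count_le_full[of \<alpha> "Suc e"] by (simp add: codim_def)
  next
    case False
    have gen: "\<forall>\<^sub>F c in cofinite. \<forall>\<^sub>F c' in cofinite.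
        form_sum_space r e (form_sum_space r e V (pencil r c)) (pencil r c') = forms r (Suc e)"
      using generic_full[OF r V] False by blast
    have bound: "\<forall>\<^sub>F c in cofinite. \<alpha> \<le> codim r (Suc e) (form_sum_space r e V (pencil r c))"
      using Suc.prems(2) by (simp add: cut_def)
    obtain c where c: "\<forall>\<^sub>F c' in cofinite. form_sum_space r e (form_sum_space r e V (pencil r c)) (pencil r c') = forms r (Suc e)"
      "\<alpha> \<le> codim r (Suc e) (form_sum_space r e V (pencil r c))"
      using eventually_happens'[OF infinite_cofinite eventually_conj[OF gen bound]] by blast
    \<comment> \<open>The induction is applied to \<open>W = (V : l)\<close>. In the split of the
      codimension of \<open>V\<close>, the part \<open>V + l R\<close> contributes
      \<open>\<alpha>\<close> and \<open>W\<close> contributes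
      \<open>lex_count \<alpha> e\<close>.\<close>
    define W where "W = form_colon r e V (pencil r c)"
    have W: "form_space r e W" unfolding W_def by (rule form_space_form_colon[OF V])
    have "\<forall>\<^sub>F c' in cofinite. \<alpha> \<le> codim r e (cut r e W (pencil r c'))"
      using c(1) bound
    proof eventually_elim
      case (elim c')
      define V' where "V' = form_sum_space r e V (pencil r c')"
      have V': "form_space r (Suc e) V'" unfolding V'_def by (rule form_space_form_sum_space[OF V pencil_form])
      have "form_sum_space r e V' (pencil r c) = forms r (Suc e)"
        using elim form_sum_space_swap unfolding V'_def by metis
      then have "codim r (Suc e) V' = codim r e (form_colon r e V' (pencil r c))"
        using codim_split[OF V' pencil_form pencil_nonzero[OF r0], of c] by simp
      moreover have "cut r e W (pencil r c') \<subseteq> form_colon r e V' (pencil r c)"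
      proof -
        have 1: "W \<subseteq> form_colon r e V' (pencil r c)"
          using form_sum_space_upper(1)[OF V, of "pencil r c'"] by (auto simp: W_def form_colon_def V'_def)
        show ?thesis
        proof (cases e)
          case 0
          then show ?thesis using 1 by (simp add: cut_def)
        next
          case (Suc e')
          have "pencil r c' * f \<in> form_colon r e V' (pencil r c)" if f: "f \<in> forms r e'" for f
          proof -
            have "pencil r c' * (pencil r c * f) \<in> V'"
              unfolding V'_def using mult_form1[OF pencil_form f] Suc by (intro form_sum_space_upper(2)[OF V]) simp
            then show ?thesis using mult_form1[OF pencil_form f] Suc by (simp add: form_colon_def ac_simps)
          qed
          then show ?thesis
            using 1 form_space_form_colon[OF V', of "pencil r c"] by (simp add: cut_def Suc form_sum_space_least form_space_def)
        qed
      qed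
      then have "codim r e (form_colon r e V' (pencil r c)) \<le> codim r e (cut r e W (pencil r c'))"
        by (intro codim_antimono form_space_cut W pencil_form form_space_form_colon V')
      ultimately show ?case using elim(2) by (simp add: V'_def)
    qed
    then have "lex_count \<alpha> e \<le> codim r e W" using Suc.IH[OF W] by blast
    then have "lex_count \<alpha> e + \<alpha> \<le> codim r (Suc e) V"
      using codim_split[OF V pencil_form pencil_nonzero[OF r0], of c] c(2) by (simp add: W_def)
    then show ?thesis using lex_count_Suc_le[of \<alpha> e] by simp
  qed
qed

text \<open>Contrapositive of the preceding bound: if almost all members left a codimension above
  \<open>a\<close>, that of \<open>V\<close> would be too large. So infinitely many \<open>c\<close>
  are good, and one of them also satisfies the cofinite fullness condition, which supplies
  \<open>l'\<close>.\<close>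

lemma green:
  fixes V :: "'k::field_char_0 mpoly set"
  assumes r: "r \<in> {1,2,3}" and V: "form_space r (Suc d) V" and n: "codim r (Suc d) V < lex_count (Suc a) (Suc d)"
  obtains l l' where "l \<in> forms r 1" "l \<noteq> 0" "l' \<in> forms r 1" "l' \<noteq> 0"
    "codim r (Suc d) (form_sum_space r d V l) \<le> a" "form_sum_space r d (form_sum_space r d V l) l' = forms r (Suc d)"
proof -
  have r0: "0 < r" using r by auto
  have "V \<noteq> {0}" if "r = 3"
  proof
    assume "V = {0}"
    then have "codim r (Suc d) V = lex_count (Suc d + 1) (Suc d)"
      using r that by (simp add: codim_def dim_forms card_monoms monom_count_def)
    then show False using n lex_count_le_full[of "Suc a" "Suc d"] by simp
  qed
  then have gen: "\<forall>\<^sub>F c in cofinite. \<forall>\<^sub>F c' in cofinite.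
        form_sum_space r d (form_sum_space r d V (pencil r c)) (pencil r c') = forms r (Suc d)"
    using generic_full[OF r V] by blast
  have "\<not> (\<forall>\<^sub>F c in cofinite. Suc a \<le> codim r (Suc d) (form_sum_space r d V (pencil r c)))"
  proof
    assume "\<forall>\<^sub>F c in cofinite. Suc a \<le> codim r (Suc d) (form_sum_space r d V (pencil r c))"
    then have "lex_count (Suc a) (Suc d) \<le> codim r (Suc d) V"
      by (intro codim_generic_cut[OF r V]) (simp add: cut_def)
    then show False using n by simp
  qed
  then have fr: "\<exists>\<^sub>F c in cofinite. \<not> Suc a \<le> codim r (Suc d) (form_sum_space r d V (pencil r c))"
    by (simp add: not_eventually)
  obtain c where c: "\<forall>\<^sub>F c' in cofinite. form_sum_space r d (form_sum_space r d V (pencil r c)) (pencil r c') = forms r (Suc d)"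
    "\<not> Suc a \<le> codim r (Suc d) (form_sum_space r d V (pencil r c))"
    using frequently_ex[OF frequently_eventually_conj[OF fr gen]] by blast
  obtain c' where "form_sum_space r d (form_sum_space r d V (pencil r c)) (pencil r c') = forms r (Suc d)"
    using eventually_happens'[OF infinite_cofinite c(1)] by blast
  then show ?thesis using that[of "pencil r c" "pencil r c'"] c(2) pencil_form pencil_nonzero[OF r0] by auto
qed

section \<open>The bounds of Macaulay and Gotzmann\<close>

definition up :: "nat \<Rightarrow> 'k::field mpoly set \<Rightarrow> 'k mpoly set" where
  "up r V = mp.span {mpoly_var j * f | j f. j < r \<and> f \<in> V}"

text \<open>The space \<open>(V : R_1)\<close> in degree \<open>d\<close>, for \<open>V\<close> in
  degree \<open>d + 1\<close>. For \<open>V = I_(d+1)\<close> its classes modulo \<open>I_d\<close>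
  are the socle in degree \<open>d\<close>.\<close>

definition colon :: "nat \<Rightarrow> nat \<Rightarrow> 'k::field mpoly set \<Rightarrow> 'k mpoly set" where
  "colon r d V = {f \<in> forms r d. \<forall>j<r. mpoly_var j * f \<in> V}"

lemma upI: "j < r \<Longrightarrow> f \<in> V \<Longrightarrow> mpoly_var j * f \<in> up r V"
  unfolding up_def by (intro mp.span_base) auto

lemma up_least:
  "mp.subspace W \<Longrightarrow> (\<And>j f. j < r \<Longrightarrow> f \<in> V \<Longrightarrow> mpoly_var j * f \<in> W) \<Longrightarrow> up r V \<subseteq> W"
  unfolding up_def by (rule mp.span_minimal) auto

lemma form_space_up: "form_space r d V \<Longrightarrow> form_space r (Suc d) (up r V)"
proof -
  assume V: "form_space r d V"
  have "mpoly_var j * f \<in> forms r (Suc d)" if "j < r" "f \<in> V" for j f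
    using V that mult_form1[OF var_form] unfolding form_space_def by blast
  then have "up r V \<subseteq> forms r (Suc d)"
    by (rule up_least[OF subspace_forms])
  then show ?thesis by (simp add: form_space_def up_def)
qed

lemma linear_form_up:
  assumes "l \<in> forms r 1" "f \<in> V"
  shows "l * f \<in> up r V"
proof -
  have "mp.subspace {p. p * f \<in> up r V}"
    unfolding up_def by (rule mp.subspaceI)
      (auto simp: distrib_right scal_mult_left mp.span_zero intro: mp.span_add mp.span_scale)
  then have "l \<in> {p. p * f \<in> up r V}"
    using upI[OF _ assms(2)] linear_form_in[OF _ _ assms(1)] by blast
  then show ?thesis by simp
qed

lemma form_space_colon:
  assumes "form_space r (Suc d) V"
  shows "form_space r d (colon r d V)"
proof -
  have V: "mp.subspace V" using assms by (simp add: form_space_def)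
  show ?thesis
    unfolding form_space_def colon_def
    using mp.subspace_0[OF V] mp.subspace_add[OF V] mp.subspace_scale[OF V]
      mp.subspace_0[OF subspace_forms] mp.subspace_add[OF subspace_forms] mp.subspace_scale[OF subspace_forms]
    by (auto intro!: mp.subspaceI simp: distrib_left scal_mult_right)
qed

lemma linear_form_colon:
  assumes V: "form_space r (Suc d) V" and "l \<in> forms r 1" "f \<in> colon r d V"
  shows "l * f \<in> V"
proof -
  have "up r (colon r d V) \<subseteq> V"
    using V by (intro up_least) (auto simp: form_space_def colon_def)
  then show ?thesis using linear_form_up[OF assms(2,3)] by blast
qed

text \<open>
  In the binomial expansion of the codimension, \<open>a\<close> is the number of entries whose upper index is one
  more than the lower index.
\<close>

lemma macaulay_gotzmann:
  fixes V :: "'k::field_char_0 mpoly set"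
  assumes r: "r \<in> {1,2,3}" and V: "form_space r (Suc d) V" and n: "codim r (Suc d) V < lex_count (Suc a) (Suc d)"
  shows macaulay: "codim r (Suc (Suc d)) (up r V) \<le> codim r (Suc d) V + a"
    and macaulay_colon: "codim r (Suc d) V \<le> codim r d (colon r d V) + a"
    and gotzmann_colon: "codim r (Suc (Suc d)) (up r V) = codim r (Suc d) V + a \<Longrightarrow>
      codim r (Suc d) V = codim r d (colon r d V) + a"
proof -
  obtain l l' where l: "l \<in> forms r 1" "l \<noteq> 0" and l': "l' \<in> forms r 1" "l' \<noteq> 0"
    and a: "codim r (Suc d) (form_sum_space r d V l) \<le> a"
    and full: "form_sum_space r d (form_sum_space r d V l) l' = forms r (Suc d)"
    using green[OF r V n] by metis
  let ?L = "form_sum_space r d V l"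
  have L: "form_space r (Suc d) ?L" by (rule form_space_form_sum_space[OF V l(1)])
  define R where "R = up r V"
  have R: "form_space r (Suc (Suc d)) R" unfolding R_def by (rule form_space_up[OF V])
  define U where "U = form_sum_space r (Suc d) R l"
  have U: "form_space r (Suc (Suc d)) U" unfolding U_def by (rule form_space_form_sum_space[OF R l(1)])
  have RU: "R \<subseteq> U" unfolding U_def by (rule form_sum_space_upper[OF R])
  have lU: "l * f \<in> U" if "f \<in> forms r (Suc d)" for f
    unfolding U_def using that by (rule form_sum_space_upper[OF R])
  define U' where "U' = form_sum_space r (Suc d) U l'"
  have U': "form_space r (Suc (Suc d)) U'" unfolding U'_def by (rule form_space_form_sum_space[OF U l'(1)])
  \<comment> \<open>Multiplying \<open>R_(d+1) = V + l R_d + l' R_d\<close> by the variables shows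
    that \<open>R_1 V\<close>, together with the multiples of \<open>l\<close> and
    \<open>l'\<close>, is everything in degree \<open>d + 2\<close>.\<close>
  have "forms r (Suc (Suc d)) \<subseteq> U'"
  proof (rule forms_Suc_subset)
    show "mp.subspace U'" using U' by (simp add: form_space_def)
    fix j and g :: "'k mpoly" assume j: "j < r" and "g \<in> forms r (Suc d)"
    then have "g \<in> form_sum_space r d ?L l'" using full by simp
    then obtain v f f' where g: "v \<in> V" "f \<in> forms r d" "f' \<in> forms r d" "g = v + l * f + l' * f'"
      by (auto simp: form_sum_space_def mp.ssum_def)
    have ff: "mpoly_var j * f \<in> forms r (Suc d)" "mpoly_var j * f' \<in> forms r (Suc d)"
      using g j by (simp_all add: var_mult_form_iff)
    have "mpoly_var j * v \<in> U" using g j RU upI unfolding R_def by blast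
    then have 1: "mpoly_var j * v + l * (mpoly_var j * f) \<in> U"
      using lU[OF ff(1)] U by (simp add: form_space_def mp.subspace_add)
    have "mpoly_var j * v + l * (mpoly_var j * f) + l' * (mpoly_var j * f') \<in> U'"
    proof (rule mp.subspace_add)
      show "mp.subspace U'" using U' by (simp add: form_space_def)
      show "mpoly_var j * v + l * (mpoly_var j * f) \<in> U'"
        using 1 form_sum_space_upper(1)[OF U, of l'] by (auto simp: U'_def)
      show "l' * (mpoly_var j * f') \<in> U'"
        using form_sum_space_upper(2)[OF U ff(2), of l'] by (simp add: U'_def)
    qed
    then show "mpoly_var j * g \<in> U'" by (simp add: g algebra_simps)
  qed
  then have "U' = forms r (Suc (Suc d))" using U' by (auto simp: form_space_def)
  then have cdU: "codim r (Suc (Suc d)) U = codim r (Suc d) (form_colon r (Suc d) U l')"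
    using codim_split[OF U l'] by (simp add: U'_def)
  \<comment> \<open>\<open>U\<close> and \<open>(U : l')\<close> have equal codimension by fullness.
    The latter contains \<open>V + l R_d\<close>, because \<open>l' V\<close> lies in
    \<open>R_1 V\<close> and \<open>l' l f\<close> is a multiple of \<open>l\<close>; this bounds
    the codimension of \<open>U\<close> by \<open>a\<close>.\<close>
  have "?L \<subseteq> form_colon r (Suc d) U l'"
  proof (rule form_sum_space_least)
    show "mp.subspace (form_colon r (Suc d) U l')" using form_space_form_colon[OF U] by (simp add: form_space_def)
    show "V \<subseteq> form_colon r (Suc d) U l'"
      using RU linear_form_up[OF l'(1)] V by (auto simp: form_colon_def R_def form_space_def)
    fix f :: "'k mpoly" assume f: "f \<in> forms r d"
    have "l * (l' * f) \<in> U" by (intro lU mult_form1 l' f)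
    then show "l * f \<in> form_colon r (Suc d) U l'"
      using mult_form1[OF l(1) f] by (simp add: form_colon_def ac_simps)
  qed
  then have U_le: "codim r (Suc (Suc d)) U \<le> codim r (Suc d) ?L"
    unfolding cdU by (intro codim_antimono L form_space_form_colon U)
  have Vq: "V \<subseteq> form_colon r (Suc d) R l"
    using linear_form_up[OF l(1)] V by (auto simp: form_colon_def R_def form_space_def)
  have Q: "form_space r (Suc d) (form_colon r (Suc d) R l)" by (rule form_space_form_colon[OF R])
  have q_le: "codim r (Suc d) (form_colon r (Suc d) R l) \<le> codim r (Suc d) V"
    by (intro codim_antimono V Q Vq)
  have R_eq: "codim r (Suc (Suc d)) R = codim r (Suc d) (form_colon r (Suc d) R l) + codim r (Suc (Suc d)) U"
    using codim_split[OF R l] by (simp add: U_def)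
  show "codim r (Suc (Suc d)) (up r V) \<le> codim r (Suc d) V + a"
    using R_eq q_le U_le a unfolding R_def by simp
  have C: "form_space r d (colon r d V)" "form_space r d (form_colon r d V l)"
    using V by (auto intro: form_space_colon form_space_form_colon)
  have Cq: "colon r d V \<subseteq> form_colon r d V l"
    using linear_form_colon[OF V l(1)] by (auto simp: form_colon_def colon_def)
  have V_eq: "codim r (Suc d) V = codim r d (form_colon r d V l) + codim r (Suc d) ?L"
    by (rule codim_split[OF V l])
  show "codim r (Suc d) V \<le> codim r d (colon r d V) + a"
    using V_eq a codim_antimono[OF C Cq] by simp
  show "codim r (Suc d) V = codim r d (colon r d V) + a"
    if eq: "codim r (Suc (Suc d)) (up r V) = codim r (Suc d) V + a"
  proof -
    \<comment> \<open>The codimension of \<open>R = R_1 V\<close> is the sum of those of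
      \<open>(R : l)\<close> and \<open>U\<close>, bounded by the codimension of \<open>V\<close>
      and by \<open>a\<close>. Equality of the totals makes both bounds tight.\<close>
    have "codim r (Suc d) V \<le> codim r (Suc d) (form_colon r (Suc d) R l)" and La: "codim r (Suc d) ?L = a"
      using eq R_eq q_le U_le a unfolding R_def by linarith+
    from this(1) have VR: "V = form_colon r (Suc d) R l" by (rule codim_eqD[OF V Q Vq])
    have "form_colon r d V l \<subseteq> colon r d V"
    proof
      fix f assume f: "f \<in> form_colon r d V l"
      have "mpoly_var j * f \<in> V" if j: "j < r" for j
      proof -
        have "mpoly_var j * (l * f) \<in> R"
          unfolding R_def using f j by (intro upI) (auto simp: form_colon_def)
        moreover have "mpoly_var j * f \<in> forms r (Suc d)"
          using f j by (simp add: form_colon_def var_mult_form_iff)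
        ultimately show ?thesis by (subst VR) (simp add: form_colon_def ac_simps)
      qed
      then show "f \<in> colon r d V" using f by (auto simp: form_colon_def colon_def)
    qed
    then have "form_colon r d V l = colon r d V" using Cq by blast
    then show ?thesis using V_eq La by simp
  qed
qed

section \<open>Lexicographic ideals and the exchange\<close>

text \<open>A homogeneous ideal is represented by the sequence of its components; closure under the
  variables is all that remains of being an ideal.\<close>

definition graded_family :: "nat \<Rightarrow> (nat \<Rightarrow> 'k::field mpoly set) \<Rightarrow> bool" where
  "graded_family r V \<longleftrightarrow> (\<forall>d. form_space r d (V d)) \<and> (\<forall>d. \<forall>j<r. \<forall>f\<in>V d. mpoly_var j * f \<in> V (Suc d))"

definition algebra_family :: "nat \<Rightarrow> (nat \<Rightarrow> 'k::field mpoly set) \<Rightarrow> bool" where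
  "algebra_family r V \<longleftrightarrow> graded_family r V \<and> V 0 = {0} \<and> V 1 = {0} \<and>
     (\<exists>e\<ge>1. V e \<noteq> forms r e \<and> (\<forall>d>e. V d = forms r d))"

definition h_family :: "nat \<Rightarrow> (nat \<Rightarrow> 'k::field mpoly set) \<Rightarrow> nat \<Rightarrow> nat" where
  "h_family r V d = codim r d (V d)"

text \<open>The dimension of \<open>(V_(d+1) : R_1) / V_d\<close>, written with codimensions. For a
  graded family nothing is truncated, because \<open>V_d\<close> lies in the colon space.\<close>

definition socle_family :: "nat \<Rightarrow> (nat \<Rightarrow> 'k::field mpoly set) \<Rightarrow> nat \<Rightarrow> nat" where
  "socle_family r V d = codim r d (V d) - codim r d (colon r d (V (Suc d)))"

lemma codim_zero: "r \<in> {1,2,3} \<Longrightarrow> codim r d ({0} :: 'k::field mpoly set) = monom_count r d"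
  by (simp only: codim_def dim_zero_space dim_forms card_monoms diff_zero)

lemma codim_le_monom_count: "r \<in> {1,2,3} \<Longrightarrow> codim r d V \<le> monom_count r d"
  by (simp only: codim_def dim_forms card_monoms diff_le_self)

lemma form_space_zero: "form_space r d {0}"
  using mp.subspace_0[OF subspace_forms] by (simp add: form_space_def mp.subspace_single_0)

lemma monom_count_0 [simp]: "monom_count r 0 = 1"
  by (simp add: monom_count_def lex_count_def)

lemma monom_count_1: "r \<in> {1,2,3} \<Longrightarrow> monom_count r (Suc 0) = r"
  by (auto simp: monom_count_def lex_count_def numeral_2_eq_2)

lemma graded_family_up: "graded_family r V \<Longrightarrow> up r (V d) \<subseteq> V (Suc d)"
  by (intro up_least) (auto simp: graded_family_def form_space_def)

lemma graded_family_colon: "graded_family r V \<Longrightarrow> V d \<subseteq> colon r d (V (Suc d))"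
  by (auto simp: graded_family_def form_space_def colon_def)

text \<open>The numerical properties of an h-vector from which a lexicographic ideal with these
  codimensions can be built. \<open>h_growth\<close> is Macaulay's bound in terms of the pair
  \<open>(a, b)\<close>.\<close>

locale h_function =
  fixes r :: nat and h :: "nat \<Rightarrow> nat"
  assumes r: "r \<in> {1,2,3}"
    and h_le: "h d \<le> monom_count r d"
    and h_0: "h 0 = 1" and h_1: "h 1 = r"
    and h_last: "\<exists>e\<ge>1. h e \<noteq> 0 \<and> (\<forall>d>e. h d = 0)"
    and h_growth: "1 \<le> d \<Longrightarrow> a \<le> d \<Longrightarrow> b \<le> d - a \<Longrightarrow> h d = lex_count a d + b \<Longrightarrow> h (Suc d) \<le> h d + a"

lemma algebra_family_h_function:
  fixes V :: "nat \<Rightarrow> 'k::field_char_0 mpoly set"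
  assumes r: "r \<in> {1,2,3}" and V: "algebra_family r V"
  shows "h_function r (h_family r V)"
proof
  have g: "graded_family r V" and sub: "\<And>d. form_space r d (V d)" using V by (auto simp: algebra_family_def graded_family_def)
  show "r \<in> {1,2,3}" by (rule r)
  show "h_family r V d \<le> monom_count r d" for d unfolding h_family_def by (rule codim_le_monom_count[OF r])
  show "h_family r V 0 = 1" using V r by (simp add: h_family_def algebra_family_def codim_zero)
  show "h_family r V 1 = r" using V r monom_count_1 by (simp add: h_family_def algebra_family_def codim_zero)
  show "\<exists>e\<ge>1. h_family r V e \<noteq> 0 \<and> (\<forall>d>e. h_family r V d = 0)"
    using V sub by (simp add: h_family_def algebra_family_def codim_0_iff)
  show "h_family r V (Suc d) \<le> h_family r V d + a"
    if "1 \<le> d" "a \<le> d" "b \<le> d - a" "h_family r V d = lex_count a d + b" for d a b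
  proof -
    obtain d' where d': "d = Suc d'" using \<open>1 \<le> d\<close> by (cases d) auto
    have "codim r d (V d) < lex_count (Suc a) d" using that by (simp add: lex_count_Suc h_family_def)
    then have "codim r (Suc d) (up r (V d)) \<le> codim r d (V d) + a"
      using macaulay[OF r, of d' "V d" a] sub[of d] d' by simp
    moreover have "codim r (Suc d) (V (Suc d)) \<le> codim r (Suc d) (up r (V d))"
      by (intro codim_antimono sub form_space_up graded_family_up g)
    ultimately show ?thesis by (simp add: h_family_def)
  qed
qed

section \<open>Lexicographic ideals with a prescribed Hilbert function\<close>

lemma lex_count_lex_le:
  assumes "a \<le> i" "b \<le> i - a" "a' \<le> i" "b' \<le> i - a'" "lex_count a i + b \<le> lex_count a' i + b'"
  shows "a < a' \<or> a = a' \<and> b \<le> b'"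
proof (cases a a' rule: linorder_cases)
  case greater
  then show ?thesis using lex_count_lex_less[OF greater assms(3,4)] assms(5) by linarith
qed (use assms in simp_all)

text \<open>Multiplication by the smallest variable raises the degree but keeps the pair of larger
  exponents, and ranks are ordered as pairs.\<close>

lemma lex_count_lex_le_Suc:
  assumes "a \<le> i" "b \<le> i - a" "a' \<le> i" "b' \<le> i - a'" "lex_count a i + b \<le> lex_count a' i + b'"
  shows "lex_count a (Suc i) + b \<le> lex_count a' (Suc i) + b'"
  using lex_count_lex_le[OF assms]
proof
  assume "a < a'"
  then have "lex_count a (Suc i) + b < lex_count a' (Suc i)" using assms by (intro lex_count_lex_less) auto
  then show ?thesis by simp
qed simp

context h_function
begin

text \<open>The codimension decides whether a component is zero or full, and \<open>h 0 = 1\<close>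
  and \<open>h 1 = r\<close> are the numbers of all monomials in these degrees. So the remaining
  conditions on an algebra can be read off from \<open>h\<close>.\<close>

lemma algebra_family_if_h:
  fixes V :: "nat \<Rightarrow> 'k::field mpoly set"
  assumes "graded_family r V" "\<And>d. codim r d (V d) = h d"
  shows "algebra_family r V" "h_family r V = h"
proof -
  have sub: "form_space r d (V d)" for d using assms(1) by (simp add: graded_family_def)
  have zero: "V d = {0}" if "h d = monom_count r d" for d
  proof -
    have "0 \<in> V d" using sub[of d] mp.subspace_0[of "V d"] by (simp add: form_space_def)
    then show ?thesis
      using codim_eqD[OF form_space_zero sub[of d]] that assms(2)[of d] codim_zero[OF r, of d, where 'k = 'k] by simp
  qed
  have "V 0 = {0}" by (rule zero) (simp add: h_0)
  moreover have "V 1 = {0}" by (rule zero) (use h_1 r monom_count_1[of r] in simp)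
  moreover have "V d = forms r d \<longleftrightarrow> h d = 0" for d
    using codim_0_iff[OF sub[of d]] assms(2)[of d] by simp
  ultimately show "algebra_family r V" using assms(1) h_last by (simp add: algebra_family_def)
  show "h_family r V = h" using assms(2) by (simp add: h_family_def fun_eq_iff)
qed

definition lex_monoms :: "nat \<Rightarrow> (nat \<Rightarrow>\<^sub>0 nat) set" where
  "lex_monoms d = {m \<in> monoms r d. h d \<le> lex_rank m}"

lemma finite_lex_monoms: "finite (lex_monoms d)"
  unfolding lex_monoms_def using finite_monoms by (rule finite_subset[rotated]) auto

lemma lex_monoms_subset: "lex_monoms d \<subseteq> monoms r d"
  by (auto simp: lex_monoms_def)

lemma card_lex_monoms: "card (lex_monoms d) + h d = monom_count r d"
proof -
  have "card {m \<in> monoms r d. lex_rank m < h d} = h d" by (rule card_lex_rank_less[OF r h_le])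
  moreover have "card (monoms r d) = card (lex_monoms d) + card {m \<in> monoms r d. lex_rank m < h d}"
    unfolding lex_monoms_def using finite_monoms by (subst card_Un_disjoint[symmetric]) (auto intro!: arg_cong[where f = card])
  ultimately show ?thesis using card_monoms[OF r] by simp
qed

lemma single_var_mon: "j < r \<Longrightarrow> Poly_Mapping.single j 1 \<in> {mon 0 0 1, mon 0 1 0, mon 1 0 0}"
  using r by (auto simp: mon_def numeral_2_eq_2 less_Suc_eq numeral_3_eq_3)

text \<open>No variable gives a multiple of smaller rank than the variable 0 does. By
  \<open>h_growth\<close>, \<open>h (Suc d)\<close> is at most the rank of the variable 0 times the
  monomial of rank \<open>h d\<close>, and this multiplication preserves the order.\<close>

lemma lex_monoms_var:
  assumes m: "m \<in> lex_monoms d" and j: "j < r"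
  shows "Poly_Mapping.single j 1 + m \<in> lex_monoms (Suc d)"
proof (cases d)
  case 0
  then have "lex_rank m < 1" using m lex_rank_image[OF r, of 0] by (auto simp: lex_monoms_def)
  then show ?thesis using m 0 h_0 by (simp add: lex_monoms_def)
next
  case (Suc d')
  have mm: "m \<in> monoms r d" "h d \<le> lex_rank m" using m by (auto simp: lex_monoms_def)
  obtain a' b' c' where abc: "m = mon a' b' c'" "a' + b' + c' = d"
    by (rule monoms_mon[OF mm(1)]) (use r in auto)
  then have rm: "lex_rank m = lex_count a' d + b'" by simp
  also have "\<dots> < lex_count (d + 1) d" using abc by (intro lex_count_lex_less) auto
  finally obtain a b where ab: "a \<le> d" "b \<le> d - a" "h d = lex_count a d + b"
    using lex_count_decomp[of "h d" "d + 1" d] mm(2) by (metis order_le_less_trans)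
  have "h (Suc d) \<le> h d + a" using h_growth[OF _ ab] Suc by simp
  also have "\<dots> = lex_count a (Suc d) + b" using ab by (simp add: lex_count_Suc_right)
  also have "\<dots> \<le> lex_count a' (Suc d) + b'" using ab abc mm(2) by (intro lex_count_lex_le_Suc) auto
  finally have le: "h (Suc d) \<le> lex_count a' (Suc d) + b'" .
  have mon: "Poly_Mapping.single j 1 + m \<in> monoms r (Suc d)"
    using monoms_plus[OF monoms_var[THEN iffD2, OF j] mm(1)] by simp
  have "lex_count a' (Suc d) + b' \<le> lex_rank (Poly_Mapping.single j 1 + m)"
    using single_var_mon[OF j] abc by (auto simp: mon_plus lex_count_Suc)
  then show ?thesis using mon le by (simp add: lex_monoms_def)
qed

lemma var_mult_polys_iff:
  "mpoly_var j * f \<in> (polys B :: 'k::field mpoly set) \<longleftrightarrow> (\<forall>m\<in>supp f. Poly_Mapping.single j 1 + m \<in> B)"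
  unfolding polys_def mpoly_var_def mem_Collect_eq supp_single_mult by blast

lemma var_mult_polys:
  assumes "j < r" "f \<in> polys A" "\<And>m. m \<in> A \<Longrightarrow> Poly_Mapping.single j 1 + m \<in> B"
  shows "mpoly_var j * f \<in> (polys B :: 'k::field mpoly set)"
  using assms unfolding polys_def mpoly_var_def by (auto simp: supp_single_mult)

lemma graded_family_lex: "graded_family r (\<lambda>d. polys (lex_monoms d) :: 'k::field mpoly set)"
proof -
  have "mpoly_var j * f \<in> (polys (lex_monoms (Suc d)) :: 'k mpoly set)" if "j < r" "f \<in> polys (lex_monoms d)" for d j f
    using that(1,2) lex_monoms_var[OF _ that(1)] by (rule var_mult_polys)
  moreover have "polys (lex_monoms d) \<subseteq> (forms r d :: 'k mpoly set)" for d
    using lex_monoms_subset[of d] by (auto simp: forms_eq polys_def)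
  ultimately show ?thesis by (simp add: graded_family_def form_space_def subspace_polys)
qed

lemma codim_lex: "codim r d (polys (lex_monoms d) :: 'k::field mpoly set) = h d"
  using card_lex_monoms[of d] r by (simp only: codim_def dim_forms dim_polys finite_lex_monoms card_monoms)

lemmas algebra_family_lex = algebra_family_if_h[OF graded_family_lex codim_lex]

end

section \<open>The exchange at a degree where the condition fails\<close>

text \<open>
  Here \<open>u\<close> is the last monomial of degree \<open>i\<close> in the lexicographic ideal and \<open>v\<close> is the next one. The
  monomial \<open>v\<close> is added and one linear condition on the coefficients at \<open>Q\<close> is imposed. If the
  smallest variable divides \<open>u\<close>, this just removes \<open>u\<close>. Otherwise it does not suffice to remove one of
  \<open>u\<close> and its predecessor \<open>w\<close>, since the socle then keeps its dimension; the condition involves both.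
  In degree \<open>i + t\<close> the exchange is repeated with all monomials multiplied by \<open>z_power t\<close>, as long as
  the ideal does not contain \<open>v + z_power t\<close> anyway.
\<close>

locale swap = h_function +
  fixes i a b c :: nat
  assumes i: "2 \<le> i" and ab: "a + b + c = i" and hi: "h i = lex_count a i + b"
    and h_prev: "lex_count a (i - 1) + b < h (i - 1)"
    and h_next: "h (Suc i) < h i + a"
begin

lemma h_pos: "0 < h i"
proof (rule ccontr)
  assume "\<not> 0 < h i"
  then have "lex_count a i = 0" "a \<noteq> 0" using hi h_next by auto
  then have "lex_count 1 i \<le> lex_count a i" by (intro lex_count_mono) simp
  then show False using \<open>lex_count a i = 0\<close> by (simp add: lex_count_def)
qed

lemma lex_count_prev: "lex_count a i = lex_count a (i - 1) + a"
  using lex_count_Suc_right[of a "i - 1"] ab i by simp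

text \<open>For \<open>r = 2\<close>, \<open>a \<ge> 1\<close> would force
  \<open>h i = i + 1\<close>, \<open>a = 1\<close>, \<open>b = 0\<close>, and then
  \<open>h_prev\<close> exceeds the \<open>i\<close> monomials of degree \<open>i - 1\<close>. For
  \<open>r = 1\<close>, \<open>h i = 1\<close> gives \<open>a = 0\<close>, \<open>b = 1\<close>, and
  \<open>h_prev\<close> asks for \<open>h (i - 1) > 1\<close>.\<close>

lemma r_cases: "r = 3 \<or> r = 2 \<and> a = 0"
proof -
  have "r = 2 \<Longrightarrow> a = 0"
  proof (rule ccontr)
    assume "r = 2" "a \<noteq> 0"
    then have "lex_count 1 i \<le> lex_count a i" by (intro lex_count_mono) simp
    then have "i + 1 \<le> h i" using hi by (simp add: lex_count_def)
    moreover have "h i \<le> i + 1" using h_le[of i] \<open>r = 2\<close> by (simp add: monom_count_def)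
    ultimately have "h i = i + 1" by simp
    moreover have "h (i - 1) \<le> i" using h_le[of "i - 1"] \<open>r = 2\<close> i by (simp add: monom_count_def)
    ultimately have "i + 1 < a + i" using h_prev hi lex_count_prev by linarith
    moreover have "a = 1"
    proof (rule ccontr)
      assume "a \<noteq> 1"
      then have "lex_count 2 i \<le> lex_count a i" using \<open>a \<noteq> 0\<close> by (intro lex_count_mono) simp
      then show False using hi \<open>h i = i + 1\<close> i by (simp add: lex_count_def numeral_2_eq_2)
    qed
    ultimately show False by simp
  qed
  moreover have "r \<noteq> 1"
  proof
    assume "r = 1"
    then have le: "h d \<le> 1" for d using h_le[of d] by (simp add: monom_count_def)
    then have "h i = 1" using h_pos le[of i] by linarith
    moreover have "a = 0"
    proof (rule ccontr)
      assume "a \<noteq> 0"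
      then have "lex_count 1 i \<le> lex_count a i" by (intro lex_count_mono) simp
      then have "i + 1 \<le> lex_count a i" by (simp add: lex_count_def)
      then show False using hi \<open>h i = 1\<close> i by linarith
    qed
    ultimately show False using h_prev le[of "i - 1"] hi by (simp add: lex_count_def)
  qed
  ultimately show ?thesis using r by auto
qed

text \<open>For \<open>c = 0\<close>, \<open>u\<close> is the largest monomial with its exponent of
  the variable 2, so the bound in \<open>h_prev\<close> is a full block sum. Comparing it with the
  number of all monomials of degree \<open>i - 1\<close> gives \<open>a + 1 < i\<close>. The
  resulting \<open>b \<ge> 2\<close> makes the predecessor \<open>w\<close> divisible by the
  smallest variable.\<close>

lemma c_0D:
  assumes "c = 0"
  shows "r = 3" "2 \<le> b" "lex_count a (i - 1) + b = lex_count (Suc a) (i - 1)"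
proof -
  have b: "b = i - a" "a \<le> i" using ab assms by auto
  show r3: "r = 3"
  proof (rule ccontr)
    assume "r \<noteq> 3"
    then have "r = 2" "a = 0" using r_cases by auto
    then show False using h_le[of "i - 1"] h_prev b i by (simp add: monom_count_def)
  qed
  have h: "h (i - 1) \<le> lex_count i (i - 1)" using h_le[of "i - 1"] i by (simp add: monom_count_def r3)
  have "a \<noteq> i" using h_prev h b by auto
  then have ai: "a < i" using b by simp
  then show eq: "lex_count a (i - 1) + b = lex_count (Suc a) (i - 1)" using b by (simp add: lex_count_Suc)
  have "Suc a \<noteq> i" using h_prev h eq by auto
  then show "2 \<le> b" using ai b by simp
qed

lemma b_0D: "b = 0 \<Longrightarrow> 1 \<le> a \<and> 1 \<le> c \<and> r = 3"
  using h_pos hi c_0D r_cases by (cases a; cases c) auto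

definition u where "u = mon a b c"
text \<open>The neighbours of \<open>u\<close> in descending order. For \<open>c = 0\<close> its
  predecessor is the smallest monomial with exponent \<open>a + 1\<close> of the variable 2. The
  successor \<open>v\<close> trades one variable 1 for a variable 0 or, if \<open>b = 0\<close>, is
  the largest monomial with exponent \<open>a - 1\<close> of the variable 2.\<close>

definition w where "w = mon (a + 1) 0 (b - 1)"
definition v where "v = (if b = 0 then mon (a - 1) (c + 1) 0 else mon a (b - 1) (c + 1))"
definition Q where "Q = (if c = 0 then {u, w} else {u})"
definition z_power where "z_power t = mon 0 0 t"
definition active where "active t \<longleftrightarrow> lex_rank (v + z_power t) < h (i + t)"

lemma v_b_0: "b = 0 \<Longrightarrow> v = mon (a - 1) (c + 1) 0"
  unfolding v_def by simp

lemma v_b_pos: "b \<noteq> 0 \<Longrightarrow> v = mon a (b - 1) (c + 1)"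
  unfolding v_def by simp

lemma v_monoms: "v \<in> monoms r i"
  using r_cases ab b_0D by (auto simp: v_def mon_in_monoms)

lemma lex_rank_v: "Suc (lex_rank v) = h i"
proof (cases "b = 0")
  case True
  then have "1 \<le> a" "a + c = i" using b_0D ab by auto
  then have "lex_count a i = lex_count (a - 1) i + c + 2" using lex_count_Suc[of "a - 1" i] by simp
  moreover have "a - 1 + (c + 1) + 0 = i" using \<open>1 \<le> a\<close> \<open>a + c = i\<close> by simp
  then have "lex_rank (mon (a - 1) (c + 1) 0) = lex_count (a - 1) i + (c + 1)"
    unfolding lex_rank_mon by (simp only:)
  then have "lex_rank v = lex_count (a - 1) i + (c + 1)" unfolding v_b_0[OF True] .
  ultimately show ?thesis using hi True by linarith
next
  case False
  then have "a + (b - 1) + (c + 1) = i" using ab by simp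
  then have "lex_rank (mon a (b - 1) (c + 1)) = lex_count a i + (b - 1)"
    unfolding lex_rank_mon by (simp only:)
  then have "lex_rank v = lex_count a i + (b - 1)" using False by (simp add: v_def)
  then show ?thesis using False hi by linarith
qed

lemma v_notin: "v \<notin> lex_monoms i"
  using lex_rank_v by (simp add: lex_monoms_def)

lemma mon_in_lex_monoms: "mon a' b' c' \<in> lex_monoms d \<longleftrightarrow> mon a' b' c' \<in> monoms r d \<and> h d \<le> lex_count a' d + b'"
  by (auto simp: lex_monoms_def mon_in_monoms)

lemma u_in: "u \<in> lex_monoms i"
  using r_cases ab hi by (auto simp: u_def mon_in_lex_monoms mon_in_monoms)

lemma w_in: "c = 0 \<Longrightarrow> w \<in> lex_monoms i"
proof -
  assume c: "c = 0"
  have "w \<in> monoms r i" using c_0D[OF c] ab c by (simp add: w_def mon_in_monoms)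
  moreover have "h i \<le> lex_count (a + 1) i" using hi ab by (simp add: lex_count_Suc)
  ultimately show ?thesis unfolding w_def mon_in_lex_monoms by simp
qed

lemma Q_in: "q \<in> Q \<Longrightarrow> q \<in> lex_monoms i"
  using u_in w_in by (auto simp: Q_def split: if_splits)

lemma finite_Q: "finite Q"
  by (simp add: Q_def)

lemma lex_monoms_z_power: "m \<in> lex_monoms d \<Longrightarrow> m + z_power t \<in> lex_monoms (d + t)"
proof (induction t)
  case (Suc t)
  have "Poly_Mapping.single 0 1 + (m + z_power t) \<in> lex_monoms (Suc (d + t))"
    using Suc r by (intro lex_monoms_var) auto
  moreover have "Poly_Mapping.single 0 1 + (m + z_power t) = m + z_power (Suc t)"
    by (rule poly_mapping_eqI) (simp add: z_power_def lookup_add coef_mon lookup_single)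
  ultimately show ?case by simp
qed (simp add: z_power_def mon_def)

lemma v_z_power_monoms: "v + z_power t \<in> monoms r (i + t)"
  using monoms_plus[OF v_monoms, of "z_power t" t] r by (auto simp: z_power_def mon_in_monoms)

lemma active_iff: "active t \<longleftrightarrow> v + z_power t \<notin> lex_monoms (i + t)"
  using v_z_power_monoms[of t] by (auto simp: active_def lex_monoms_def)

lemma z_power_0 [simp]: "m + z_power 0 = m"
  by (simp add: z_power_def mon_def)

lemma z_power_Suc: "m + z_power (Suc t) = Poly_Mapping.single 0 1 + (m + z_power t)"
  by (rule poly_mapping_eqI) (simp add: z_power_def lookup_add coef_mon lookup_single)

lemma active_Suc: "active (Suc t) \<Longrightarrow> active t"
  using lex_monoms_z_power[of "v + z_power t" "i + t" 1] z_power_Suc[of v t]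
  by (auto simp: active_iff z_power_def mon_plus add.assoc)

lemma active_0: "active 0"
  using v_notin by (simp add: active_iff)

text \<open>The exchange disturbs higher degrees only if \<open>u\<close> is free of the middle variable.\<close>

lemma active_Suc_D:
  assumes "active (Suc t)"
  shows "b = 0"
proof (rule ccontr)
  assume "b \<noteq> 0"
  have "active 1"
    using assms by (induction t) (auto dest: active_Suc)
  have v1: "v + z_power 1 = mon a (b - 1) (c + 2)" using \<open>b \<noteq> 0\<close> by (simp add: v_def z_power_def mon_plus)
  have "a + (b - 1) + (c + 2) = Suc i" using \<open>b \<noteq> 0\<close> ab by simp
  then have "lex_rank (mon a (b - 1) (c + 2)) = lex_count a (Suc i) + (b - 1)"
    unfolding lex_rank_mon by (simp only:)
  \<comment> \<open>Activity puts the rank of \<open>v + z_power 1\<close> below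
    \<open>h (Suc i)\<close>, whereas by \<open>h_next\<close> this rank is at least
    \<open>h (Suc i)\<close>.\<close>
  then have "lex_count a (Suc i) + (b - 1) < h (Suc i)" using \<open>active 1\<close> v1 by (simp add: active_def)
  then show False using h_next hi lex_count_Suc_right[of a i] ab \<open>b \<noteq> 0\<close> by simp
qed

text \<open>By \<open>h_prev\<close>, the monomials of the ideal in degree \<open>i - 1\<close> have
  pairs beyond \<open>(a, b)\<close>, and multiplication never lowers a pair. For \<open>w\<close>
  the pair is \<open>(a + 1, 0)\<close>, which \<open>c_0D\<close> identifies with the same bound.
  So the linear condition at \<open>Q\<close> ignores products from degree
  \<open>i - 1\<close>.\<close>

lemma minimal_generator:
  assumes "q \<in> Q" "m \<in> lex_monoms (i - 1)" "j < r"
  shows "Poly_Mapping.single j 1 + m \<noteq> q"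
proof
  assume eq: "Poly_Mapping.single j 1 + m = q"
  have mm: "m \<in> monoms r (i - 1)" using assms by (simp add: lex_monoms_def)
  obtain a' b' c' where m: "m = mon a' b' c'" "a' + b' + c' = i - 1"
    by (rule monoms_mon[OF mm]) (use r in auto)
  have "h (i - 1) \<le> lex_count a' (i - 1) + b'" using assms m by (simp add: mon_in_lex_monoms)
  then have lt: "lex_count a (i - 1) + b < lex_count a' (i - 1) + b'" using h_prev by simp
  have mono: "lex_count a' (i - 1) \<le> lex_count (Suc a') (i - 1)" by (rule lex_count_mono) simp
  consider "q = u" | "q = w" "c = 0" using assms by (auto simp: Q_def split: if_splits)
  then show False
  proof cases
    case 1
    then show ?thesis using single_var_mon[OF assms(3)] eq lt m mono by (auto simp: u_def mon_plus)
  next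
    case 2
    then show ?thesis using single_var_mon[OF assms(3)] eq lt m mono c_0D by (auto simp: w_def mon_plus)
  qed
qed

text \<open>By \<open>h_next\<close> the ideal contains, in degree \<open>i + 1\<close>, also the
  successor of the product of \<open>u\<close> with the variable 0. The product of \<open>v\<close>
  with the variable 1 is that product if \<open>b > 0\<close> and its successor if
  \<open>b = 0\<close>; the variable 2 gives a larger monomial.\<close>

lemma v_var:
  assumes "0 < j" "j < r"
  shows "Poly_Mapping.single j 1 + v \<in> lex_monoms (Suc i)"
proof -
  have mon: "Poly_Mapping.single j 1 + v \<in> monoms r (Suc i)"
    using monoms_plus[OF monoms_var[THEN iffD2, OF assms(2)] v_monoms] by simp
  have hs: "h (Suc i) < lex_count a (Suc i) + b" using h_next hi lex_count_Suc_right[of a i] ab by simp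
  have eq: "Poly_Mapping.single j 1 \<in> {mon 0 1 0, mon 1 0 0}"
    using single_var_mon[OF assms(2)] assms(1) by (auto simp: mon_def dest!: arg_cong[where f = "\<lambda>m. coef m 0"] simp: lookup_add lookup_single)
  have "h (Suc i) \<le> lex_rank (Poly_Mapping.single j 1 + v)"
  proof (cases "b = 0")
    case True
    then have a: "1 \<le> a" "a + c = i" using b_0D ab by auto
    then obtain a' where a': "a = Suc a'" by (cases a) auto
    have "lex_count a (Suc i) = lex_count a' (Suc i) + c + 3" using a a' by (simp add: lex_count_Suc)
    moreover have "v = mon a' (c + 1) 0" unfolding v_b_0[OF True] using a' by simp
    moreover have "1 + a' + (c + 1) = Suc i" "a' + (c + 2) = Suc i" using a a' by simp_all
    ultimately show ?thesis using eq True hs a' by (auto simp: mon_plus)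
  next
    case False
    then obtain b' where b': "b = Suc b'" by (cases b) auto
    have "lex_count (Suc a) (Suc i) = lex_count a (Suc i) + (i + 2 - a)" by (simp add: lex_count_Suc)
    moreover have "v = mon a b' (c + 1)" using v_b_pos b' by simp
    ultimately show ?thesis using eq b' hs ab by (auto simp: mon_plus)
  qed
  then show ?thesis using mon by (simp add: lex_monoms_def)
qed

definition form_sum :: "nat \<Rightarrow> 'k::field mpoly \<Rightarrow> 'k" where
  "form_sum t f = (\<Sum>q\<in>Q. coef f (q + z_power t))"

definition exchange :: "nat \<Rightarrow> 'k::field mpoly set" where
  "exchange d = (if i \<le> d \<and> active (d - i)
     then {f \<in> polys (insert (v + z_power (d - i)) (lex_monoms d)). form_sum (d - i) f = 0} else polys (lex_monoms d))"

lemma exchange_active: "active t \<Longrightarrow> exchange (i + t) = {f \<in> polys (insert (v + z_power t) (lex_monoms (i + t))). form_sum t f = (0::'k::field)}"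
  by (simp add: exchange_def)

lemma exchange_inactive: "\<not> active t \<Longrightarrow> exchange (i + t) = (polys (lex_monoms (i + t)) :: 'k::field mpoly set)"
  by (simp add: exchange_def)

lemma exchange_below: "d < i \<Longrightarrow> exchange d = polys (lex_monoms d)"
  by (simp add: exchange_def)

lemma subspace_form_sum: "mp.subspace {f. form_sum t f = 0}"
  unfolding form_sum_def
  by (rule mp.subspaceI) (auto simp: lookup_add sum.distrib simp flip: sum_distrib_left)

lemma form_space_exchange: "form_space r d (exchange d :: 'k::field mpoly set)"
proof (cases "i \<le> d \<and> active (d - i)")
  case True
  define N where "N = insert (v + z_power (d - i)) (lex_monoms d)"
  have N: "N \<subseteq> monoms r d" using lex_monoms_subset v_z_power_monoms[of "d - i"] True by (auto simp: N_def)
  have exchange: "exchange d = polys N \<inter> {f :: 'k mpoly. form_sum (d - i) f = 0}"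
    using True by (auto simp: exchange_def N_def)
  have "mp.subspace (exchange d :: 'k mpoly set)"
    unfolding exchange by (intro mp.subspace_inter subspace_polys subspace_form_sum)
  moreover have "exchange d \<subseteq> (forms r d :: 'k mpoly set)"
    unfolding exchange forms_eq polys_def using N by blast
  ultimately show ?thesis by (simp add: form_space_def)
next
  case False
  then have "exchange d = (polys (lex_monoms d) :: 'k mpoly set)" by (auto simp: exchange_def)
  then show ?thesis using graded_family_lex[where 'k = 'k] by (simp add: graded_family_def)
qed

lemma form_sum_single:
  assumes "q \<in> Q"
  shows "form_sum t (Poly_Mapping.single (q + z_power t) 1) = (1 :: 'k::field)"
proof -
  have "form_sum t (Poly_Mapping.single (q + z_power t) (1::'k)) = (\<Sum>q'\<in>Q. if q' = q then 1 else 0)"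
    unfolding form_sum_def by (intro sum.cong) (auto simp: lookup_single when_def)
  then show ?thesis using finite_Q assms by simp
qed

text \<open>Adjoining \<open>v + z_power t\<close> raises the dimension by one. The linear condition
  lowers it by one, as it is not satisfied by \<open>u + z_power t\<close>.\<close>

lemma codim_exchange: "codim r d (exchange d :: 'k::field mpoly set) = h d"
proof (cases "i \<le> d \<and> active (d - i)")
  case True
  define t where "t = d - i"
  have t: "d = i + t" "active t" using True by (auto simp: t_def)
  define N where "N = insert (v + z_power t) (lex_monoms d)"
  have N: "finite N" "card N = Suc (card (lex_monoms d))"
    using t active_iff finite_lex_monoms by (simp_all add: N_def)
  have Md: "exchange d = {f \<in> polys N. form_sum t f = (0::'k)}"
    using exchange_active[OF t(2)] t(1) by (simp add: N_def)
  define e where "e = Poly_Mapping.single (u + z_power t) (1::'k)"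
  have fe: "form_sum t e = 1" unfolding e_def by (rule form_sum_single) (simp add: Q_def)
  have eN: "e \<in> polys N"
    using lex_monoms_z_power[OF u_in, of t] t unfolding e_def N_def by (intro single_in_polys) simp
  have lin: "form_sum t (f - scal k e) = form_sum t f - k * form_sum t e" for f and k :: 'k
    by (simp add: form_sum_def lookup_minus sum_subtractf sum_distrib_left)
  have exchange: "mp.subspace (exchange d :: 'k mpoly set)" "mp.findim (exchange d :: 'k mpoly set)"
    using form_space_exchange[of d, where 'k = 'k] form_space_findim[OF form_space_exchange[of d, where 'k = 'k]] by (simp_all add: form_space_def)
  have "mp.span (insert e (exchange d)) = polys N"
  proof
    show "mp.span (insert e (exchange d)) \<subseteq> polys N"
      using eN by (intro mp.span_minimal subspace_polys) (auto simp: Md)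
    show "polys N \<subseteq> mp.span (insert e (exchange d))"
    proof
      fix f :: "'k mpoly" assume f: "f \<in> polys N"
      have "f - scal (form_sum t f) e \<in> polys N"
        using f eN subspace_polys[of N] by (intro mp.subspace_diff mp.subspace_scale)
      then have "f - scal (form_sum t f) e \<in> exchange d" using lin[of f "form_sum t f"] fe by (simp add: Md)
      then show "f \<in> mp.span (insert e (exchange d))"
        using mp.span_breakdown_eq mp.span_base by blast
    qed
  qed
  moreover have "e \<notin> exchange d" using fe by (simp add: Md)
  ultimately have "mp.dim (polys N :: 'k mpoly set) = Suc (mp.dim (exchange d :: 'k mpoly set))"
    using mp.dim_insert_findim[OF exchange(2,1)] by metis
  then have "mp.dim (exchange d :: 'k mpoly set) = mp.dim (polys (lex_monoms d) :: 'k mpoly set)"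
    using N finite_lex_monoms by (simp add: dim_polys)
  then show ?thesis using codim_lex[of d, where 'k = 'k] by (simp add: codim_def)
next
  case False
  then have "exchange d = (polys (lex_monoms d) :: 'k mpoly set)" by (auto simp: exchange_def)
  then show ?thesis by (simp add: codim_lex)
qed

lemma coef_var_mult: "coef (mpoly_var j * f) (Poly_Mapping.single j 1 + m) = coef f m"
  for f :: "'k::field mpoly"
  unfolding mpoly_var_def by (rule coef_single_mult)

lemma coef_var_mult_0:
  assumes "\<And>m. m \<in> supp f \<Longrightarrow> Poly_Mapping.single j 1 + m \<noteq> n"
  shows "coef (mpoly_var j * f) n = (0::'k::field)"
proof -
  have "n \<notin> supp (mpoly_var j * f)"
    unfolding mpoly_var_def supp_single_mult using assms by blast
  then show ?thesis by (simp add: in_keys_iff)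
qed

text \<open>Activity in degree \<open>i + t + 1\<close> forces \<open>b = 0\<close> and
  \<open>Q = {u}\<close>, so only the variable 2 could lead to \<open>u + z_power (Suc t)\<close>.
  The cofactor would be free of the variable 1, hence smaller than \<open>v + z_power t\<close>,
  which is itself outside the ideal.\<close>

lemma no_new_generator:
  assumes act: "active (Suc t)" and "q \<in> Q" "0 < j" "j < r" "m \<in> insert (v + z_power t) (lex_monoms (i + t))"
  shows "Poly_Mapping.single j 1 + m \<noteq> q + z_power (Suc t)"
proof
  assume eq: "Poly_Mapping.single j 1 + m = q + z_power (Suc t)"
  have b: "b = 0" by (rule active_Suc_D[OF act])
  then have ac: "1 \<le> a" "1 \<le> c" using b_0D by auto
  have mm: "m \<in> monoms r (i + t)" using assms v_z_power_monoms lex_monoms_subset by blast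
  obtain a' b' c' where m: "m = mon a' b' c'" "a' + b' + c' = i + t"
    by (rule monoms_mon[OF mm]) (use r in auto)
  have q: "q + z_power (Suc t) = mon a 0 (c + Suc t)"
  proof -
    have "Q = {u}" unfolding Q_def using ac by simp
    moreover have "mon a b c = mon a 0 c" using b by simp
    ultimately have "q = mon a 0 c" using assms(2) u_def by simp
    then show ?thesis by (simp add: z_power_def mon_plus)
  qed
  have "Poly_Mapping.single j 1 \<in> {mon 0 1 0, mon 1 0 0}"
    using single_var_mon[OF assms(4)] assms(3) by (auto simp: mon_def dest!: arg_cong[where f = "\<lambda>m. coef m 0"] simp: lookup_add lookup_single)
  then have m_eq: "m = mon (a - 1) 0 (c + Suc t)"
    using eq m unfolding q by (auto simp: mon_plus)
  have vt: "v + z_power t = mon (a - 1) (c + 1) t" unfolding v_b_0[OF b] by (simp add: z_power_def mon_plus)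
  then have "m \<noteq> v + z_power t" using m_eq by simp
  then have "h (i + t) \<le> lex_rank m" using assms(5) by (simp add: lex_monoms_def)
  moreover have "lex_rank m \<le> lex_rank (v + z_power t)"
  proof -
    have "a - 1 + (c + 1) + t = i + t" "a - 1 + 0 + (c + Suc t) = i + t" using ab ac b by simp_all
    then have "lex_rank m = lex_count (a - 1) (i + t)" "lex_rank (v + z_power t) = lex_count (a - 1) (i + t) + (c + 1)"
      unfolding m_eq vt lex_rank_mon by (simp_all only: add_0_right)
    then show ?thesis by simp
  qed
  ultimately show False using active_Suc[OF act] by (simp add: active_def)
qed

text \<open>The conditions are compatible: multiplication by the variable 0 turns
  \<open>form_sum t\<close> into \<open>form_sum (Suc t)\<close>, and all other products have zero
  coefficients at the shifted \<open>Q\<close> while the exchange is active. The variable 0 sends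
  \<open>v + z_power t\<close> to \<open>v + z_power (Suc t)\<close>; the others send it into the
  lexicographic ideal.\<close>

lemma graded_family_exchange: "graded_family r (exchange :: nat \<Rightarrow> 'k::field mpoly set)"
proof -
  have "mpoly_var j * f \<in> exchange (Suc d)" if j: "j < r" and f: "f \<in> exchange d" for j d and f :: "'k mpoly"
  proof -
    have lex: "mpoly_var j * f \<in> polys (lex_monoms (Suc d))" if "f \<in> polys (lex_monoms d)"
      using graded_family_lex[where 'k = 'k] j that by (simp add: graded_family_def)
    consider "Suc d < i" | "Suc d = i" | t where "d = i + t"
      by (metis le_add_diff_inverse not_less_eq_eq not_less nat_less_le)
    then show ?thesis
    proof cases
      case 1
      then show ?thesis using f lex by (simp add: exchange_below)
    next
      case 2
      then have d: "d = i - 1" "d < i" by auto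
      then have fS: "f \<in> polys (lex_monoms d)" using f by (simp add: exchange_below)
      have "coef (mpoly_var j * f) (q + z_power 0) = 0" if "q \<in> Q" for q
        using minimal_generator[OF that _ j] fS d by (intro coef_var_mult_0) (auto simp: polys_def)
      then have "form_sum 0 (mpoly_var j * f) = 0" by (simp add: form_sum_def)
      moreover have "mpoly_var j * f \<in> polys (insert (v + z_power 0) (lex_monoms i))"
        using lex[OF fS] 2 by (auto simp: polys_def)
      ultimately show ?thesis using exchange_active[OF active_0, where 'k = 'k] 2 by simp
    next
      case 3
      have fN: "f \<in> polys (insert (v + z_power t) (lex_monoms d))"
        using f 3 exchange_active[of t, where 'k = 'k] exchange_inactive[of t, where 'k = 'k] by (cases "active t") (auto simp: polys_def)
      have step: "Poly_Mapping.single j 1 + m \<in> insert (v + z_power (Suc t)) (lex_monoms (Suc d))"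
        if "m \<in> insert (v + z_power t) (lex_monoms d)" for m
      proof (cases "m \<in> lex_monoms d")
        case True
        then show ?thesis using lex_monoms_var j by blast
      next
        case False
        then have m: "m = v + z_power t" using that by simp
        show ?thesis
        proof (cases "j = 0")
          case True
          then show ?thesis using m z_power_Suc by simp
        next
          case False
          then have "(Poly_Mapping.single j 1 + v) + z_power t \<in> lex_monoms (Suc i + t)"
            using j by (intro lex_monoms_z_power v_var) auto
          then show ?thesis using m 3 by (simp add: add.assoc)
        qed
      qed
      have xf: "mpoly_var j * f \<in> polys (insert (v + z_power (Suc t)) (lex_monoms (i + Suc t)))"
        using var_mult_polys[OF j fN step] 3 by simp
      show ?thesis
      proof (cases "active (Suc t)")
        case False
        then have "insert (v + z_power (Suc t)) (lex_monoms (i + Suc t)) = lex_monoms (i + Suc t)"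
          using active_iff by blast
        then show ?thesis using xf exchange_inactive[OF False, where 'k = 'k] 3 by simp
      next
        case True
        have "form_sum (Suc t) (mpoly_var j * f) = 0"
        proof (cases "j = 0")
          case True
          have "form_sum (Suc t) (mpoly_var j * f) = form_sum t f"
            unfolding form_sum_def True z_power_Suc by (simp only: coef_var_mult)
          also have "\<dots> = 0" using f 3 exchange_active[OF active_Suc[OF \<open>active (Suc t)\<close>], where 'k = 'k] by simp
          finally show ?thesis .
        next
          case False
          have "coef (mpoly_var j * f) (q + z_power (Suc t)) = 0" if "q \<in> Q" for q
            using no_new_generator[OF True that _ j] False fN 3 by (intro coef_var_mult_0) (auto simp: polys_def)
          then show ?thesis by (simp add: form_sum_def)
        qed
        then show ?thesis using xf exchange_active[OF True, where 'k = 'k] 3 by simp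
      qed
    qed
  qed
  then show ?thesis by (simp add: graded_family_def form_space_exchange)
qed

lemmas algebra_family_exchange = algebra_family_if_h[OF graded_family_exchange codim_exchange]

lemma lex_rank_var_less:
  assumes "p \<in> monoms r d" "0 < j" "j < r"
  shows "lex_rank (Poly_Mapping.single 0 1 + p) < lex_rank (Poly_Mapping.single j 1 + p)"
proof -
  obtain a' b' c' where p: "p = mon a' b' c'" "a' + b' + c' = d"
    by (rule monoms_mon[OF assms(1)]) (use r in auto)
  have "Poly_Mapping.single j 1 \<in> {mon 0 1 0, mon 1 0 0}"
    using single_var_mon[OF assms(3)] assms(2) by (auto simp: mon_def dest!: arg_cong[where f = "\<lambda>m. coef m 0"] simp: lookup_add lookup_single)
  moreover have "Poly_Mapping.single 0 1 = mon 0 0 1" by (simp add: mon_def)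
  ultimately show ?thesis unfolding p by (auto simp: mon_plus lex_count_Suc)
qed

lemma var_in_lex_monoms:
  assumes p: "p \<in> monoms r d" "Poly_Mapping.single 0 1 + p \<in> lex_monoms (Suc d)" and j: "j < r"
  shows "Poly_Mapping.single j 1 + p \<in> lex_monoms (Suc d)"
proof (cases "j = 0")
  case False
  then have "lex_rank (Poly_Mapping.single 0 1 + p) < lex_rank (Poly_Mapping.single j 1 + p)"
    using lex_rank_var_less p j by blast
  moreover have "Poly_Mapping.single j 1 + p \<in> monoms r (Suc d)"
    using monoms_plus[OF monoms_var[THEN iffD2, OF j] p(1)] by simp
  ultimately show ?thesis using p(2) by (simp add: lex_monoms_def)
qed (use p in simp)

lemma exchange_i: "exchange i = {f \<in> polys (insert v (lex_monoms i)). form_sum 0 f = (0::'k::field)}"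
  using exchange_active[OF active_0, where 'k = 'k] by simp

text \<open>As \<open>w\<close> is free of the variable 1, the condition on
  \<open>mpoly_var 1 * f\<close> reads the coefficient at \<open>u\<close> alone. For
  \<open>b > 0\<close> this \<open>p\<close> is also \<open>v\<close> divided by the variable
  0.\<close>

lemma colon_exchange_coef_u:
  assumes f: "f \<in> colon r (i - 1) (exchange i :: 'k::field mpoly set)"
    and p: "p \<in> monoms r (i - 1)" "Poly_Mapping.single 1 1 + p = u"
  shows "coef f p = 0"
proof -
  have "form_sum 0 (mpoly_var 1 * f) = 0"
    using f r_cases by (auto simp: colon_def exchange_i)
  moreover have "form_sum 0 (mpoly_var 1 * f) = coef (mpoly_var 1 * f) u"
  proof (cases "c = 0")
    case True
    have "u \<noteq> w" by (simp add: u_def w_def)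
    moreover have "coef (mpoly_var 1 * f) w = 0"
    proof (rule coef_var_mult_0)
      fix m :: "nat \<Rightarrow>\<^sub>0 nat"
      have "coef (Poly_Mapping.single 1 1 + m) 1 \<noteq> coef w 1" by (simp add: lookup_add w_def coef_mon)
      then show "Poly_Mapping.single 1 1 + m \<noteq> w" by metis
    qed
    moreover have "Q = {u, w}" unfolding Q_def using True by simp
    ultimately show ?thesis by (simp add: form_sum_def)
  next
    case False
    then have "Q = {u}" unfolding Q_def by simp
    then show ?thesis by (simp add: form_sum_def)
  qed
  moreover have "coef (mpoly_var 1 * f) u = coef f p"
    unfolding p(2)[symmetric] by (rule coef_var_mult)
  ultimately show ?thesis by simp
qed

text \<open>The new monomial \<open>v\<close> creates no colon elements. If \<open>v\<close> is
  \<open>m\<close> times the variable 0, then \<open>b > 0\<close> and \<open>m\<close> is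
  \<open>u\<close> divided by the variable 1, where the coefficient vanishes. If \<open>v\<close> is
  \<open>m\<close> times a larger variable, the multiple of \<open>m\<close> by the variable 0 would
  be smaller than \<open>v\<close> and outside the space.\<close>

lemma colon_exchange_supp:
  assumes f: "f \<in> colon r (i - 1) (exchange i :: 'k::field mpoly set)" and m: "m \<in> supp f" and j: "j < r"
  shows "Poly_Mapping.single j 1 + m \<in> lex_monoms i"
proof (rule ccontr)
  assume not: "Poly_Mapping.single j 1 + m \<notin> lex_monoms i"
  have mm: "m \<in> monoms r (i - 1)" using f m by (auto simp: colon_def forms_eq polys_def)
  have ins: "Poly_Mapping.single j 1 + m \<in> insert v (lex_monoms i)" if "j < r" for j
  proof -
    have "mpoly_var j * f \<in> polys (insert v (lex_monoms i))" using f that by (simp add: colon_def exchange_i)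
    then show ?thesis using m by (simp only: var_mult_polys_iff)
  qed
  have jv: "Poly_Mapping.single j 1 + m = v" using ins[OF j] not by simp
  show False
  proof (cases "j = 0")
    case True
    obtain a' b' c' where abc: "m = mon a' b' c'" "a' + b' + c' = i - 1"
      by (rule monoms_mon[OF mm]) (use r in auto)
    have v_eq: "v = mon a' b' (Suc c')" using jv abc True by (simp add: single_eq_mon mon_plus)
    have b: "b \<noteq> 0"
    proof
      assume "b = 0"
      then show False using v_eq v_b_0 by simp
    qed
    have "a' = a" "b' = b - 1" "c' = c" using v_eq v_b_pos[OF b] by simp_all
    then have "Poly_Mapping.single 1 1 + m = u"
      using abc(1) b by (simp add: single_eq_mon mon_plus u_def)
    then have "coef f m = 0" using colon_exchange_coef_u[OF f mm] by simp
    then show False using m by (simp add: in_keys_iff)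
  next
    case False
    then have "lex_rank (Poly_Mapping.single 0 1 + m) < lex_rank v"
      using lex_rank_var_less[OF mm _ j] jv by simp
    moreover have "lex_rank v \<le> lex_rank (Poly_Mapping.single 0 1 + m)"
      using ins[of 0] r lex_rank_v by (auto simp: lex_monoms_def)
    ultimately show False by simp
  qed
qed

text \<open>The lost element is a monomial \<open>p\<close> with multiple \<open>u\<close> by the
  variable 0, or \<open>w\<close> if \<open>u\<close> is free of that variable. All variables send
  \<open>p\<close> into the lexicographic ideal, but the multiple in \<open>Q\<close> violates the
  linear condition.\<close>

lemma colon_psubset:
  "colon r (i - 1) (exchange i :: 'k::field mpoly set) \<subset> colon r (i - 1) (polys (lex_monoms i))"
proof
  show "colon r (i - 1) (exchange i :: 'k mpoly set) \<subseteq> colon r (i - 1) (polys (lex_monoms i))"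
  proof
    fix f :: "'k mpoly" assume f: "f \<in> colon r (i - 1) (exchange i)"
    then show "f \<in> colon r (i - 1) (polys (lex_monoms i))"
      using colon_exchange_supp[OF f] by (simp only: colon_def mem_Collect_eq var_mult_polys_iff) blast
  qed
  obtain p where p: "p \<in> monoms r (i - 1)" "Poly_Mapping.single 0 1 + p \<in> Q"
  proof (cases "c = 0")
    case True
    have "mon (a + 1) 0 (b - 2) \<in> monoms r (i - 1)"
      using c_0D[OF True] ab True by (simp add: mon_in_monoms)
    moreover have "Poly_Mapping.single 0 1 + mon (a + 1) 0 (b - 2) = w"
      using c_0D[OF True] by (simp add: w_def single_eq_mon mon_plus)
    moreover have "w \<in> Q" unfolding Q_def using True by simp
    ultimately show ?thesis using that by metis
  next
    case False
    have "mon a b (c - 1) \<in> monoms r (i - 1)"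
      using r_cases ab False by (auto simp: mon_in_monoms)
    moreover have "Poly_Mapping.single 0 1 + mon a b (c - 1) = u"
      using False by (simp add: u_def single_eq_mon mon_plus)
    moreover have "u \<in> Q" by (simp add: Q_def)
    ultimately show ?thesis using that by metis
  qed
  have zS: "Poly_Mapping.single 0 1 + p \<in> lex_monoms (Suc (i - 1))" using Q_in[OF p(2)] i by simp
  define f where "f = Poly_Mapping.single p (1::'k)"
  have xf: "mpoly_var j * f = Poly_Mapping.single (Poly_Mapping.single j 1 + p) 1" for j
    by (simp add: f_def mpoly_var_def mult_single)
  have "f \<in> colon r (i - 1) (polys (lex_monoms i))"
    unfolding colon_def
  proof (intro CollectI conjI allI impI)
    show "f \<in> forms r (i - 1)" using p by (simp add: f_def forms_eq single_in_polys)
    show "mpoly_var j * f \<in> polys (lex_monoms i)" if "j < r" for j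
      unfolding xf using var_in_lex_monoms[OF p(1) zS that] i by (intro single_in_polys) simp
  qed
  moreover have "f \<notin> colon r (i - 1) (exchange i)"
  proof
    assume "f \<in> colon r (i - 1) (exchange i)"
    then have "form_sum 0 (mpoly_var 0 * f) = 0" using r by (auto simp: colon_def exchange_i)
    then show False using form_sum_single[OF p(2), of 0, where 'k = 'k] unfolding xf by simp
  qed
  ultimately show "colon r (i - 1) (exchange i :: 'k mpoly set) \<noteq> colon r (i - 1) (polys (lex_monoms i))" by blast
qed

lemma socle_family_less:
  "socle_family r (exchange :: nat \<Rightarrow> 'k::field mpoly set) (i - 1) < socle_family r (\<lambda>d. polys (lex_monoms d) :: 'k mpoly set) (i - 1)"
proof -
  let ?L = "\<lambda>d. polys (lex_monoms d) :: 'k mpoly set"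
  have i1: "Suc (i - 1) = i" using i by simp
  have sL: "form_space r (i - 1) (colon r (i - 1) (?L i))"
    using form_space_colon[of r "i - 1" "?L i"] graded_family_lex[where 'k = 'k] i1 by (simp add: graded_family_def)
  have sM: "form_space r (i - 1) (colon r (i - 1) (exchange i :: 'k mpoly set))"
    using form_space_colon[of r "i - 1" "exchange i :: 'k mpoly set"] form_space_exchange[of i, where 'k = 'k] i1 by simp
  have "codim r (i - 1) (colon r (i - 1) (?L i)) < codim r (i - 1) (colon r (i - 1) (exchange i :: 'k mpoly set))"
  proof (rule ccontr)
    assume "\<not> ?thesis"
    then have "codim r (i - 1) (colon r (i - 1) (exchange i :: 'k mpoly set)) \<le> codim r (i - 1) (colon r (i - 1) (?L i))"
      by simp
    then have "colon r (i - 1) (exchange i) = colon r (i - 1) (?L i)"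
      by (intro codim_eqD[OF sM sL]) (use colon_psubset[where 'k = 'k] in auto)
    then show False using colon_psubset[where 'k = 'k] by simp
  qed
  \<comment> \<open>The socle dimensions are truncated differences from \<open>h (i - 1)\<close>;
    this bound carries the strict inequality through the subtraction.\<close>
  moreover have "codim r (i - 1) (colon r (i - 1) (exchange i :: 'k mpoly set)) \<le> h (i - 1)"
    using codim_antimono[OF form_space_exchange sM] graded_family_colon[OF graded_family_exchange, of "i - 1", where 'a = 'k] i1 codim_exchange[of "i - 1", where 'k = 'k] by simp
  ultimately show ?thesis unfolding socle_family_def i1 codim_exchange codim_lex by linarith
qed

end

section \<open>Graded ideals and their quotients\<close>

abbreviation poly_carrier :: "nat \<Rightarrow> 'k::comm_ring_1 mpoly set" where
  "poly_carrier r \<equiv> carrier (mpoly_ring r)"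

lemma poly_carrier_iff: "p \<in> poly_carrier r \<longleftrightarrow> (\<forall>m\<in>supp p. supp m \<subseteq> {..<r})"
  by (simp add: mpoly_ring_def)

lemma mpoly_ring_simps [simp]:
  "x \<otimes>\<^bsub>mpoly_ring r\<^esub> y = x * y" "\<one>\<^bsub>mpoly_ring r\<^esub> = 1"
  "\<zero>\<^bsub>mpoly_ring r\<^esub> = 0" "x \<oplus>\<^bsub>mpoly_ring r\<^esub> y = x + y"
  by (simp_all add: mpoly_ring_def)

lemma poly_carrier_closed:
  "0 \<in> poly_carrier r" "1 \<in> poly_carrier r"
  "p \<in> poly_carrier r \<Longrightarrow> q \<in> poly_carrier r \<Longrightarrow> p + q \<in> poly_carrier r"
  "p \<in> poly_carrier r \<Longrightarrow> - p \<in> poly_carrier r"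
  "p \<in> poly_carrier r \<Longrightarrow> q \<in> poly_carrier r \<Longrightarrow> p * q \<in> poly_carrier r"
  for p q :: "'k::comm_ring_1 mpoly"
proof -
  show "0 \<in> poly_carrier r" "1 \<in> poly_carrier r" by (simp_all add: poly_carrier_iff)
  show "p + q \<in> poly_carrier r" if "p \<in> poly_carrier r" "q \<in> poly_carrier r"
    using that keys_add[of p q] unfolding poly_carrier_iff by blast
  show "- p \<in> poly_carrier r" if "p \<in> poly_carrier r"
    using that by (simp add: poly_carrier_iff in_keys_iff)
  show "p * q \<in> poly_carrier r" if "p \<in> poly_carrier r" "q \<in> poly_carrier r"
    unfolding poly_carrier_iff
  proof
    fix m assume "m \<in> supp (p * q)"
    then obtain a b where "a \<in> supp p" "b \<in> supp q" "m = a + b" using keys_mult[of p q] by blast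
    then show "supp m \<subseteq> {..<r}" using that by (simp add: poly_carrier_iff supp_plus_nat)
  qed
qed

lemma poly_carrier_const: "mpoly_const c \<in> poly_carrier r"
  by (simp add: poly_carrier_iff mpoly_const_def)

lemma forms_poly_carrier: "forms r d \<subseteq> poly_carrier r"
  by (auto simp: forms_def)

lemma var_poly_carrier: "j < r \<Longrightarrow> mpoly_var j \<in> poly_carrier r"
  using var_form forms_poly_carrier by blast

lemma cring_mpoly_ring: "cring (mpoly_ring r :: 'k::comm_ring_1 mpoly ring)"
proof (rule cringI)
  show "abelian_group (mpoly_ring r :: 'k mpoly ring)"
  proof (rule abelian_groupI)
    show "\<exists>y\<in>poly_carrier r. y \<oplus>\<^bsub>mpoly_ring r\<^esub> x = \<zero>\<^bsub>mpoly_ring r\<^esub>" if "x \<in> poly_carrier r" for x :: "'k mpoly"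
      using that poly_carrier_closed(4)[of x r] by (intro bexI[of _ "- x"]) auto
  qed (auto simp: poly_carrier_closed add.assoc add.commute)
  show "Group.comm_monoid (mpoly_ring r :: 'k mpoly ring)"
    by (rule Group.comm_monoidI) (auto simp: poly_carrier_closed ac_simps)
qed (auto simp: distrib_right)

lemma ring_mpoly_ring: "ring (mpoly_ring r :: 'k::comm_ring_1 mpoly ring)"
  using cring_mpoly_ring by (rule cring.axioms(1))

lemma ideal_mpoly_ringI:
  fixes I :: "'k::comm_ring_1 mpoly set"
  assumes "I \<subseteq> poly_carrier r" "0 \<in> I" "\<And>x y. x \<in> I \<Longrightarrow> y \<in> I \<Longrightarrow> x + y \<in> I"
    and mult: "\<And>a x. a \<in> poly_carrier r \<Longrightarrow> x \<in> I \<Longrightarrow> a * x \<in> I"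
  shows "ideal I (mpoly_ring r)"
proof (rule idealI[OF ring_mpoly_ring])
  interpret R: ring "mpoly_ring r :: 'k mpoly ring" by (rule ring_mpoly_ring)
  show "subgroup I (add_monoid (mpoly_ring r))"
  proof (rule R.add.subgroupI)
    fix x assume x: "x \<in> I"
    have "(- 1) * x \<in> I" using x by (intro mult poly_carrier_closed)
    then have "- x \<in> I" by simp
    moreover have "\<ominus>\<^bsub>mpoly_ring r\<^esub> x = - x"
      using x assms(1) poly_carrier_closed(4)[of x r] by (intro R.minus_equality) auto
    ultimately show "\<ominus>\<^bsub>mpoly_ring r\<^esub> x \<in> I" by simp
  next
    show "I \<noteq> {}" using assms(2) by blast
  qed (use assms in auto)
  show "x \<otimes>\<^bsub>mpoly_ring r\<^esub> a \<in> I" "a \<otimes>\<^bsub>mpoly_ring r\<^esub> x \<in> I"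
    if "a \<in> I" "x \<in> poly_carrier r" for a x
    using mult[OF that(2,1)] by (simp_all add: mult.commute)
qed

lemma ideal_mpoly_ringD:
  fixes I :: "'k::comm_ring_1 mpoly set"
  assumes "ideal I (mpoly_ring r)"
  shows "I \<subseteq> poly_carrier r" "0 \<in> I" "x \<in> I \<Longrightarrow> y \<in> I \<Longrightarrow> x + y \<in> I"
    "a \<in> poly_carrier r \<Longrightarrow> x \<in> I \<Longrightarrow> a * x \<in> I"
proof -
  interpret ideal I "mpoly_ring r" by fact
  show "I \<subseteq> poly_carrier r" using a_subset by simp
  show "0 \<in> I" using additive_subgroup.zero_closed[OF is_additive_subgroup] by simp
  show "x \<in> I \<Longrightarrow> y \<in> I \<Longrightarrow> x + y \<in> I" using additive_subgroup.a_closed[OF is_additive_subgroup, of x y] by simp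
  show "a \<in> poly_carrier r \<Longrightarrow> x \<in> I \<Longrightarrow> a * x \<in> I" using I_l_closed[of x a] by simp
qed

section \<open>Homogeneous components and the ideal of a graded family\<close>

definition hom_component :: "nat \<Rightarrow> 'k::field mpoly \<Rightarrow> 'k mpoly" where
  "hom_component d p = (\<Sum>m\<in>{m \<in> supp p. monom_degree m = d}. Poly_Mapping.single m (coef p m))"

lemma coef_hom_component: "coef (hom_component d p) m = (if monom_degree m = d then coef p m else 0)"
proof -
  have "coef (hom_component d p) m = (\<Sum>n\<in>{n \<in> supp p. monom_degree n = d}. if n = m then coef p m else 0)"
    unfolding hom_component_def lookup_sum by (intro sum.cong) (auto simp: lookup_single when_def)
  then show ?thesis by (auto simp: in_keys_iff)
qed

lemma hom_component_add: "hom_component d (p + q) = hom_component d p + hom_component d q"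
  by (rule poly_mapping_eqI) (simp add: coef_hom_component lookup_add)

lemma hom_component_0 [simp]: "hom_component d 0 = 0"
  by (rule poly_mapping_eqI) (simp add: coef_hom_component)

lemma hom_component_scal: "hom_component d (scal c p) = scal c (hom_component d p)"
  by (rule poly_mapping_eqI) (simp add: coef_hom_component)

lemma hom_component_sum: "hom_component d (sum f A) = (\<Sum>x\<in>A. hom_component d (f x))"
  by (induction A rule: infinite_finite_induct) (auto simp: hom_component_add)

lemma hom_component_form: "f \<in> forms r e \<Longrightarrow> hom_component d f = (if d = e then f else 0)"
  by (rule poly_mapping_eqI) (auto simp: coef_hom_component forms_def in_keys_iff)

lemma hom_component_in_forms: "p \<in> poly_carrier r \<Longrightarrow> hom_component d p \<in> forms r d"
  by (auto simp: forms_def poly_carrier_iff in_keys_iff coef_hom_component split: if_splits)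

lemma hom_component_decomp: "p = (\<Sum>d\<in>monom_degree ` supp p. hom_component d p)"
proof (rule poly_mapping_eqI)
  fix m
  have "coef (\<Sum>d\<in>monom_degree ` supp p. hom_component d p) m
      = (\<Sum>d\<in>monom_degree ` supp p. if d = monom_degree m then coef p m else 0)"
    unfolding lookup_sum by (intro sum.cong) (auto simp: coef_hom_component)
  then show "coef p m = coef (\<Sum>d\<in>monom_degree ` supp p. hom_component d p) m"
    by (auto simp: in_keys_iff)
qed

lemma hom_component_single_mult:
  "hom_component d (Poly_Mapping.single m 1 * p)
    = (if monom_degree m \<le> d then Poly_Mapping.single m 1 * hom_component (d - monom_degree m) p else 0)"
proof (rule poly_mapping_eqI)
  fix n
  show "coef (hom_component d (Poly_Mapping.single m 1 * p)) n =
    coef (if monom_degree m \<le> d then Poly_Mapping.single m 1 * hom_component (d - monom_degree m) p else 0) n"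
  proof (cases "\<exists>l. n = m + l")
    case True
    then show ?thesis by (auto simp: coef_hom_component coef_single_mult monom_degree_plus)
  next
    case False
    then show ?thesis using coef_single_mult_0[of n m] by (auto simp: coef_hom_component)
  qed
qed

text \<open>The direct sum of the \<open>V d\<close>, described by components so that membership can
  be tested degree by degree.\<close>

definition assemble :: "nat \<Rightarrow> (nat \<Rightarrow> 'k::field mpoly set) \<Rightarrow> 'k mpoly set" where
  "assemble r V = {p \<in> poly_carrier r. \<forall>d. hom_component d p \<in> V d}"

lemma graded_family_mono_mult:
  assumes V: "graded_family r V"
  shows "m \<in> monoms r e \<Longrightarrow> f \<in> V d \<Longrightarrow> Poly_Mapping.single m (1::'k::field) * f \<in> V (e + d)"
proof (induction e arbitrary: m)
  case 0
  then have "m = 0" by (simp add: monoms_def monom_degree_0_iff)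
  then show ?case using 0 by simp
next
  case (Suc e)
  have "mp.subspace {g. g * f \<in> V (Suc e + d)}"
    using V by (intro mp.subspaceI)
      (auto simp: graded_family_def form_space_def distrib_right scal_mult_left mp.subspace_0 mp.subspace_add mp.subspace_scale)
  moreover have "mpoly_var j * g \<in> {g. g * f \<in> V (Suc e + d)}" if j: "j < r" and g: "g \<in> forms r e" for j g
  proof -
    have "g = (\<Sum>m\<in>supp g. scal (coef g m) (Poly_Mapping.single m 1))" by (rule polys_decomp)
    then have "g * f = (\<Sum>m\<in>supp g. scal (coef g m) (Poly_Mapping.single m 1 * f))"
      by (metis (no_types, lifting) scal_mult_left sum.cong sum_distrib_right)
    also have "\<dots> \<in> V (e + d)"
      using Suc.IH Suc.prems(2) g V
      by (intro mp.subspace_sum mp.subspace_scale) (auto simp: graded_family_def form_space_def forms_eq polys_def)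
    finally show ?thesis using V j by (simp add: graded_family_def mult.assoc)
  qed
  ultimately have "forms r (Suc e) \<subseteq> {g. g * f \<in> V (Suc e + d)}"
    by (rule forms_Suc_subset)
  then show ?case using Suc.prems(1) by (auto simp: forms_eq intro: single_in_polys)
qed

lemma ideal_assemble:
  fixes V :: "nat \<Rightarrow> 'k::field mpoly set"
  assumes V: "graded_family r V"
  shows "ideal (assemble r V) (mpoly_ring r)"
proof (rule ideal_mpoly_ringI)
  have sub: "mp.subspace (V d)" for d using V by (simp add: graded_family_def form_space_def)
  show "assemble r V \<subseteq> poly_carrier r" by (auto simp: assemble_def)
  show "0 \<in> assemble r V" using sub by (simp add: assemble_def poly_carrier_closed mp.subspace_0)
  show "x + y \<in> assemble r V" if "x \<in> assemble r V" "y \<in> assemble r V" for x y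
    using that sub by (simp add: assemble_def poly_carrier_closed hom_component_add mp.subspace_add)
  show "a * x \<in> assemble r V" if a: "a \<in> poly_carrier r" and x: "x \<in> assemble r V" for a x
  proof -
    have "hom_component d (a * x) \<in> V d" for d
    proof -
      have "a = (\<Sum>m\<in>supp a. scal (coef a m) (Poly_Mapping.single m 1))" by (rule polys_decomp)
      then have "a * x = (\<Sum>m\<in>supp a. scal (coef a m) (Poly_Mapping.single m 1 * x))"
        by (metis (no_types, lifting) scal_mult_left sum.cong sum_distrib_right)
      then have "hom_component d (a * x) = (\<Sum>m\<in>supp a. scal (coef a m) (hom_component d (Poly_Mapping.single m 1 * x)))"
        by (simp only: hom_component_sum hom_component_scal)
      also have "\<dots> \<in> V d"
      proof (intro mp.subspace_sum mp.subspace_scale sub)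
        fix m assume "m \<in> supp a"
        then have m: "m \<in> monoms r (monom_degree m)" using a by (simp add: poly_carrier_iff monoms_def)
        show "hom_component d (Poly_Mapping.single m 1 * x) \<in> V d"
        proof (cases "monom_degree m \<le> d")
          case True
          have "Poly_Mapping.single m 1 * hom_component (d - monom_degree m) x \<in> V (monom_degree m + (d - monom_degree m))"
            using x by (intro graded_family_mono_mult[OF V m]) (simp add: assemble_def)
          then show ?thesis using True by (simp add: hom_component_single_mult)
        next
          case False
          then show ?thesis using sub by (simp add: hom_component_single_mult mp.subspace_0)
        qed
      qed
      finally show ?thesis .
    qed
    then show ?thesis using a x by (simp add: assemble_def poly_carrier_closed)
  qed
qed

lemma assemble_forms:
  fixes V :: "nat \<Rightarrow> 'k::field mpoly set"
  assumes V: "graded_family r V"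
  shows "assemble r V \<inter> forms r d = V d"
proof -
  have sub: "mp.subspace (V d)" "V d \<subseteq> forms r d" for d using V by (auto simp: graded_family_def form_space_def)
  show ?thesis
  proof (intro equalityI subsetI)
    fix f assume f: "f \<in> assemble r V \<inter> forms r d"
    then have "hom_component d f \<in> V d" by (simp add: assemble_def)
    then show "f \<in> V d" using f hom_component_form[of f r d d] by simp
  next
    fix f assume "f \<in> V d"
    then have ff: "f \<in> forms r d" using sub by blast
    have "hom_component e f \<in> V e" for e
      using hom_component_form[OF ff, of e] \<open>f \<in> V d\<close> mp.subspace_0[OF sub(1)] by simp
    then show "f \<in> assemble r V \<inter> forms r d" using ff forms_poly_carrier by (auto simp: assemble_def)
  qed
qed

lemma subspace_ideal:
  fixes I :: "'k::field mpoly set"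
  assumes "ideal I (mpoly_ring r)"
  shows "mp.subspace I"
proof (rule mp.subspaceI)
  show "scal c x \<in> I" if "x \<in> I" for c x
    unfolding scal_def using ideal_mpoly_ringD(4)[OF assms poly_carrier_const that] .
qed (rule ideal_mpoly_ringD[OF assms]; assumption)+

lemma homogeneous_ideal_assemble:
  fixes V :: "nat \<Rightarrow> 'k::field mpoly set"
  assumes V: "graded_family r V"
  shows "homogeneous_ideal r (assemble r V)"
proof -
  interpret R: ring "mpoly_ring r :: 'k mpoly ring" by (rule ring_mpoly_ring)
  let ?F = "\<Union>d. V d"
  have F: "?F \<subseteq> (\<Union>d. forms r d)" using V by (auto simp: graded_family_def form_space_def)
  then have FC: "?F \<subseteq> poly_carrier r" using forms_poly_carrier by blast
  have "Idl\<^bsub>mpoly_ring r\<^esub> ?F = assemble r V"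
  proof
    show "Idl\<^bsub>mpoly_ring r\<^esub> ?F \<subseteq> assemble r V"
      using assemble_forms[OF V] by (intro R.genideal_minimal ideal_assemble[OF V]) blast
    have I: "ideal (Idl\<^bsub>mpoly_ring r\<^esub> ?F) (mpoly_ring r)" by (rule R.genideal_ideal[OF FC])
    show "assemble r V \<subseteq> Idl\<^bsub>mpoly_ring r\<^esub> ?F"
    proof
      fix p assume p: "p \<in> assemble r V"
      have "(\<Sum>d\<in>monom_degree ` supp p. hom_component d p) \<in> Idl\<^bsub>mpoly_ring r\<^esub> ?F"
        using p R.genideal_self[OF FC] by (intro mp.subspace_sum[OF subspace_ideal[OF I]]) (auto simp: assemble_def)
      then show "p \<in> Idl\<^bsub>mpoly_ring r\<^esub> ?F" using hom_component_decomp[of p] by simp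
    qed
  qed
  then show ?thesis unfolding homogeneous_ideal_def using F by (intro exI[of _ ?F]) auto
qed

lemma graded_family_ideal:
  fixes I :: "'k::field mpoly set"
  assumes "ideal I (mpoly_ring r)"
  shows "graded_family r (\<lambda>d. I \<inter> forms r d)"
  using ideal_mpoly_ringD(4)[OF assms var_poly_carrier] mult_form1[OF var_form]
  by (auto simp: graded_family_def form_space_def subspace_forms subspace_ideal[OF assms] mp.subspace_inter)

text \<open>The assembled components form an ideal that contains the homogeneous generators, hence
  all of \<open>I\<close>; so \<open>I\<close> contains the components of its elements.\<close>

lemma homogeneous_ideal_is_ideal:
  fixes I :: "'k::field mpoly set"
  assumes "homogeneous_ideal r I"
  shows "ideal I (mpoly_ring r)" "I = assemble r (\<lambda>d. I \<inter> forms r d)"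
proof -
  interpret R: ring "mpoly_ring r :: 'k mpoly ring" by (rule ring_mpoly_ring)
  obtain F where F: "F \<subseteq> (\<Union>d. forms r d)" "I = Idl\<^bsub>mpoly_ring r\<^esub> F"
    using assms by (auto simp: homogeneous_ideal_def)
  then have FC: "F \<subseteq> poly_carrier r" using forms_poly_carrier by blast
  show I: "ideal I (mpoly_ring r)" unfolding F by (rule R.genideal_ideal[OF FC])
  show "I = assemble r (\<lambda>d. I \<inter> forms r d)"
  proof
    show "I \<subseteq> assemble r (\<lambda>d. I \<inter> forms r d)"
      unfolding F(2)
    proof (rule R.genideal_minimal[OF ideal_assemble])
      show "graded_family r (\<lambda>d. Idl\<^bsub>mpoly_ring r\<^esub> F \<inter> forms r d)" using graded_family_ideal[OF I] F(2) by simp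
      show "F \<subseteq> assemble r (\<lambda>d. Idl\<^bsub>mpoly_ring r\<^esub> F \<inter> forms r d)"
      proof
        fix f assume f: "f \<in> F"
        then obtain d where "f \<in> forms r d" using F by blast
        then have "f \<in> I \<inter> forms r d" using f F R.genideal_self[OF FC] by blast
        then show "f \<in> assemble r (\<lambda>d. Idl\<^bsub>mpoly_ring r\<^esub> F \<inter> forms r d)"
          using assemble_forms[OF graded_family_ideal[OF I], of d] F(2) by blast
      qed
    qed
    show "assemble r (\<lambda>d. I \<inter> forms r d) \<subseteq> I"
    proof
      fix p assume p: "p \<in> assemble r (\<lambda>d. I \<inter> forms r d)"
      have "(\<Sum>d\<in>monom_degree ` supp p. hom_component d p) \<in> I"
        using p by (intro mp.subspace_sum[OF subspace_ideal[OF I]]) (auto simp: assemble_def)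
      then show "p \<in> I" using hom_component_decomp[of p] by simp
    qed
  qed
qed

lemma subfield_const: "subfield (range mpoly_const) (mpoly_ring r :: 'k::field mpoly ring)"
proof -
  interpret R: cring "mpoly_ring r :: 'k mpoly ring" by (rule cring_mpoly_ring)
  have neg: "\<ominus>\<^bsub>mpoly_ring r\<^esub> mpoly_const c = mpoly_const (- c)" for c :: 'k
    using poly_carrier_const[of c r] poly_carrier_const[of "-c" r]
    by (intro R.minus_equality) (auto simp: mpoly_const_add[symmetric])
  have sr: "subring (range mpoly_const) (mpoly_ring r :: 'k mpoly ring)"
  proof (rule R.subringI)
    show "\<one>\<^bsub>mpoly_ring r\<^esub> \<in> range (mpoly_const :: 'k \<Rightarrow> _)"
      using mpoly_const_1 by (metis mpoly_ring_simps(2) rangeI)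
  qed (auto simp: poly_carrier_const neg mpoly_const_add[symmetric] mpoly_const_mult[symmetric])
  have inj: "mpoly_const c = 0 \<longleftrightarrow> c = 0" for c :: 'k
    by (simp add: mpoly_const_def) (metis lookup_single_eq lookup_zero single_zero)
  show ?thesis
  proof (rule R.subfieldI)
    show "subcring (range mpoly_const) (mpoly_ring r :: 'k mpoly ring)"
      by (rule R.subcringI'[OF sr])
    show "Units (mpoly_ring r\<lparr>carrier := range mpoly_const\<rparr>) = range (mpoly_const :: 'k \<Rightarrow> _) - {\<zero>\<^bsub>mpoly_ring r\<^esub>}"
    proof
      show "Units (mpoly_ring r\<lparr>carrier := range mpoly_const\<rparr>) \<subseteq> range (mpoly_const :: 'k \<Rightarrow> _) - {\<zero>\<^bsub>mpoly_ring r\<^esub>}"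
        by (auto simp: Units_def)
      show "range (mpoly_const :: 'k \<Rightarrow> _) - {\<zero>\<^bsub>mpoly_ring r\<^esub>} \<subseteq> Units (mpoly_ring r\<lparr>carrier := range mpoly_const\<rparr>)"
      proof
        fix x assume "x \<in> range (mpoly_const :: 'k \<Rightarrow> _) - {\<zero>\<^bsub>mpoly_ring r\<^esub>}"
        then obtain c :: 'k where c: "x = mpoly_const c" "c \<noteq> 0" using inj by auto
        have "mpoly_const (1 / c) * mpoly_const c = 1" "mpoly_const c * mpoly_const (1 / c) = 1"
          using c by (simp_all add: mpoly_const_mult[symmetric])
        then show "x \<in> Units (mpoly_ring r\<lparr>carrier := range mpoly_const\<rparr>)"
          unfolding Units_def c(1) by auto
      qed
    qed
  qed
qed

section \<open>The quotient algebra, its dimensions and its socle\<close>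

locale poly_quot =
  fixes r :: nat and I :: "'k::field mpoly set"
  assumes I: "ideal I (mpoly_ring r)" and one: "1 \<notin> I"
begin

abbreviation cl :: "'k mpoly \<Rightarrow> 'k mpoly set" where "cl \<equiv> residue_class r I"
abbreviation A :: "'k mpoly set ring" where "A \<equiv> quot_alg r I"

lemmas I_sub = subspace_ideal[OF I]
lemmas I_D = ideal_mpoly_ringD[OF I]

sublocale H: ring_hom_cring "mpoly_ring r" A cl
proof -
  have "cl = a_r_coset (mpoly_ring r) I" by (simp add: residue_class_def fun_eq_iff)
  then show "ring_hom_cring (mpoly_ring r) A cl"
    using ideal.rcos_ring_hom_cring[OF I cring_mpoly_ring] by (simp add: quot_alg_def)
qed

lemma hom_ring: "ring_hom_ring (mpoly_ring r) A cl"
proof -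
  have "cl = a_r_coset (mpoly_ring r) I" by (simp add: residue_class_def fun_eq_iff)
  then show ?thesis using ideal.rcos_ring_hom_ring[OF I] by (simp add: quot_alg_def)
qed

lemma cl_def: "cl p = (\<lambda>i. i + p) ` I"
  by (auto simp: residue_class_def a_r_coset_def')

lemma cl_eq_iff: "cl p = cl q \<longleftrightarrow> p - q \<in> I"
proof
  assume "cl p = cl q"
  moreover have "p \<in> cl p" unfolding cl_def using I_D(2) by (intro image_eqI[of _ _ 0]) auto
  ultimately show "p - q \<in> I" unfolding cl_def by auto
next
  have sub: "cl p \<subseteq> cl q" if "p - q \<in> I" for p q
  proof
    fix x assume "x \<in> cl p"
    then obtain i where "i \<in> I" "x = i + p" by (auto simp: cl_def)
    then have "x = (i + (p - q)) + q" "i + (p - q) \<in> I" using that I_D(3) by auto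
    then show "x \<in> cl q" unfolding cl_def by blast
  qed
  assume pq: "p - q \<in> I"
  then have "q - p \<in> I" using mp.subspace_neg[OF I_sub pq] by simp
  then show "cl p = cl q" using sub pq by blast
qed

lemma zero_A: "\<zero>\<^bsub>A\<^esub> = cl 0"
  using H.hom_zero by simp

lemma cl_zero_iff: "cl p = \<zero>\<^bsub>A\<^esub> \<longleftrightarrow> p \<in> I"
  unfolding zero_A cl_eq_iff by simp

lemma carrier_A: "carrier A = cl ` poly_carrier r"
  by (auto simp: quot_alg_def FactRing_def A_RCOSETS_def' residue_class_def)

lemma cl_mult: "p \<in> poly_carrier r \<Longrightarrow> q \<in> poly_carrier r \<Longrightarrow> cl p \<otimes>\<^bsub>A\<^esub> cl q = cl (p * q)"
  using H.hom_mult[of p q] by simp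

lemma cl_add: "p \<in> poly_carrier r \<Longrightarrow> q \<in> poly_carrier r \<Longrightarrow> cl p \<oplus>\<^bsub>A\<^esub> cl q = cl (p + q)"
  using H.hom_add[of p q] by simp

lemma scal_poly_carrier: "p \<in> poly_carrier r \<Longrightarrow> scal c p \<in> poly_carrier r" for p :: "'k mpoly"
  unfolding scal_def using poly_carrier_const poly_carrier_closed(5) by blast

lemma subfield_base: "subfield (base_field r I) A"
proof -
  have "\<one>\<^bsub>A\<^esub> \<noteq> \<zero>\<^bsub>A\<^esub>" using one cl_zero_iff[of 1] H.hom_one by simp
  then have "subfield (cl ` range mpoly_const) A"
    by (rule ring_hom_ring.img_is_subfield(2)[OF hom_ring subfield_const])
  then show ?thesis by (simp add: base_field_def image_image)
qed

text \<open>\<open>dimension\<close> is built up one line at a time; on representatives this step is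
  the span with one more vector.\<close>

lemma line_extension_cl:
  assumes "mp.subspace W" "W \<subseteq> poly_carrier r" "x \<in> poly_carrier r"
  shows "H.S.line_extension (base_field r I) (cl x) (cl ` W) = cl ` mp.span (insert x W)"
proof -
  have *: "cl (mpoly_const c) \<otimes>\<^bsub>A\<^esub> cl x \<oplus>\<^bsub>A\<^esub> cl w = cl (scal c x + w)" if "w \<in> W" for c w
    using assms that scal_poly_carrier[of x c] poly_carrier_const[of c r] by (auto simp: cl_mult cl_add scal_def subset_iff)
  show ?thesis
  proof (intro equalityI subsetI)
    fix u assume "u \<in> H.S.line_extension (base_field r I) (cl x) (cl ` W)"
    then obtain c w where "w \<in> W" "u = cl (mpoly_const c) \<otimes>\<^bsub>A\<^esub> cl x \<oplus>\<^bsub>A\<^esub> cl w"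
      by (auto simp: H.S.line_extension_mem_iff base_field_def)
    then have "u = cl (scal c x + w)" "w \<in> W" using * by auto
    moreover have "scal c x + w \<in> mp.span (insert x W)" if "w \<in> W" for w
      using that by (intro mp.span_add mp.span_scale mp.span_base) auto
    ultimately show "u \<in> cl ` mp.span (insert x W)" by blast
  next
    fix u assume "u \<in> cl ` mp.span (insert x W)"
    then obtain y where y: "y \<in> mp.span (insert x W)" "u = cl y" by blast
    obtain w c where w: "w \<in> W" "y = scal c x + w" using mp.mem_span_insert[OF assms(1) y(1)] .
    then show "u \<in> H.S.line_extension (base_field r I) (cl x) (cl ` W)"
      unfolding H.S.line_extension_mem_iff y(2) w(2) *[OF w(1), symmetric] by (auto simp: base_field_def)
  qed
qed

text \<open>Vectors are added to \<open>I \<inter> forms r d\<close> one by one. A new form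
  \<open>x\<close> outside the current space has a new class: a difference of two forms of degree
  \<open>d\<close> that lies in \<open>I\<close> already lies in
  \<open>I \<inter> forms r d\<close>.\<close>

lemma dimension_cl_span:
  assumes "finite B" "B \<subseteq> forms r d"
  shows "H.S.dimension (mp.dim (mp.span ((I \<inter> forms r d) \<union> B)) - mp.dim (I \<inter> forms r d))
    (base_field r I) (cl ` mp.span ((I \<inter> forms r d) \<union> B))"
  using assms
proof (induction B)
  case empty
  have sub: "mp.subspace (I \<inter> forms r d)" by (intro mp.subspace_inter I_sub subspace_forms)
  then have sp: "mp.span (I \<inter> forms r d) = I \<inter> forms r d" by (simp add: mp.span_eq_iff)
  have "cl ` (I \<inter> forms r d) = {\<zero>\<^bsub>A\<^esub>}"
    using mp.subspace_0[OF sub] cl_zero_iff by auto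
  then show ?case unfolding Un_empty_right sp by simp
next
  case (insert x B)
  define V where "V = I \<inter> forms r d"
  define W where "W = mp.span (V \<union> B)"
  have IH: "H.S.dimension (mp.dim W - mp.dim V) (base_field r I) (cl ` W)"
    using insert by (simp add: V_def W_def)
  have W: "mp.subspace W" "W \<subseteq> forms r d"
    using insert.prems mp.span_minimal[OF _ subspace_forms, of "V \<union> B" r d] by (simp_all add: W_def V_def)
  have VW: "V \<subseteq> W" by (auto simp: W_def intro: mp.span_base)
  have fW: "mp.findim W" using mp.findim_subset[OF findim_forms W(2)] .
  have eq: "mp.span (V \<union> insert x B) = mp.span (insert x W)"
    using mp.span_insert_span[of x "V \<union> B"] by (simp add: W_def)
  have x: "x \<in> forms r d" using insert.prems by simp
  show ?case
  proof (cases "x \<in> W")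
    case True
    then have "mp.span (insert x W) = W" using W by (simp add: insert_absorb mp.span_eq_iff)
    then show ?thesis using eq IH by (simp add: V_def)
  next
    case False
    have "cl x \<notin> cl ` W"
    proof
      assume "cl x \<in> cl ` W"
      then obtain w where w: "w \<in> W" "x - w \<in> I" by (auto simp: cl_eq_iff)
      then have "x - w \<in> V" using x W mp.subspace_diff[OF subspace_forms, of x r d w] by (auto simp: V_def)
      then have "(x - w) + w \<in> W" using VW w W by (intro mp.subspace_add) auto
      then show False using False by simp
    qed
    moreover have "cl x \<in> carrier A" using x forms_poly_carrier by (auto simp: carrier_A)
    ultimately have "H.S.dimension (Suc (mp.dim W - mp.dim V)) (base_field r I)
        (H.S.line_extension (base_field r I) (cl x) (cl ` W))"
      using IH by (intro H.S.dimension.intros(2))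
    moreover have "H.S.line_extension (base_field r I) (cl x) (cl ` W) = cl ` mp.span (insert x W)"
      using W x forms_poly_carrier by (intro line_extension_cl) blast+
    moreover have "mp.dim (mp.span (insert x W)) = Suc (mp.dim W)"
      using mp.dim_insert_findim[OF fW W(1) False] .
    moreover have "mp.dim V \<le> mp.dim W" using mp.dim_mono_findim[OF fW VW] .
    ultimately show ?thesis unfolding V_def[symmetric] eq by (simp add: Suc_diff_le)
  qed
qed

lemma alg_dim_cl:
  assumes W: "form_space r d W" "I \<inter> forms r d \<subseteq> W"
  shows "alg_dim r I (cl ` W) = mp.dim W - mp.dim (I \<inter> forms r d)"
proof -
  obtain B where B: "B \<subseteq> W" "W \<subseteq> mp.span B" "finite B"
    using mp.findim_basis[OF form_space_findim[OF W(1)]] by metis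
  have sW: "mp.subspace W" "W \<subseteq> forms r d" using W by (auto simp: form_space_def)
  have "mp.span ((I \<inter> forms r d) \<union> B) = W"
  proof
    show "mp.span ((I \<inter> forms r d) \<union> B) \<subseteq> W" using W B sW by (intro mp.span_minimal) auto
    show "W \<subseteq> mp.span ((I \<inter> forms r d) \<union> B)" using B(2) mp.span_mono[of B "(I \<inter> forms r d) \<union> B"] by blast
  qed
  then have "H.S.dimension (mp.dim W - mp.dim (I \<inter> forms r d)) (base_field r I) (cl ` W)"
    using dimension_cl_span[of B d] B sW by force
  then show ?thesis
    unfolding alg_dim_def using H.S.dimension_is_inj[OF subfield_base] by (intro the_equality) auto
qed

lemma graded_part_zero_iff:
  "graded_part r I d = {\<zero>\<^bsub>A\<^esub>} \<longleftrightarrow> I \<inter> forms r d = forms r d"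
proof -
  have "0 \<in> (forms r d :: 'k mpoly set)" using mp.subspace_0[OF subspace_forms] .
  then have "graded_part r I d = {\<zero>\<^bsub>A\<^esub>} \<longleftrightarrow> (\<forall>f\<in>forms r d. cl f = \<zero>\<^bsub>A\<^esub>)"
    by (auto simp: graded_part_def)
  then show ?thesis by (auto simp: cl_zero_iff)
qed

lemma h_vector_eq: "h_vector r I = h_family r (\<lambda>d. I \<inter> forms r d)"
  unfolding h_vector_def[abs_def] h_family_def[abs_def] graded_part_def codim_def
  by (intro ext alg_dim_cl form_space_forms) simp

text \<open>The annihilator of a class is an ideal, so a class killed by the variables is killed by
  the whole irrelevant ideal.\<close>

lemma socle_graded_part:
  "socle r I \<inter> graded_part r I d = cl ` colon r d (I \<inter> forms r (Suc d))"
proof -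
  have socle_iff: "cl f \<in> socle r I \<longleftrightarrow> (\<forall>j<r. mpoly_var j * f \<in> I)" if f: "f \<in> poly_carrier r" for f
  proof -
    let ?X = "(\<lambda>j. cl (mpoly_var j)) ` {..<r}"
    have X: "?X \<subseteq> carrier A" using var_poly_carrier by (auto simp: carrier_A)
    have clf: "cl f \<in> carrier A" using f by (auto simp: carrier_A)
    have gen: "cl f \<otimes>\<^bsub>A\<^esub> cl (mpoly_var j) = \<zero>\<^bsub>A\<^esub> \<longleftrightarrow> mpoly_var j * f \<in> I" if "j < r" for j
      using cl_mult[OF f var_poly_carrier[OF that]] by (simp add: cl_zero_iff mult.commute)
    show ?thesis
    proof
      assume "cl f \<in> socle r I"
      then have "cl f \<otimes>\<^bsub>A\<^esub> b = \<zero>\<^bsub>A\<^esub>" if "b \<in> ?X" for b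
        using H.S.genideal_self[OF X] that by (auto simp: socle_def irrelevant_ideal_def)
      then show "\<forall>j<r. mpoly_var j * f \<in> I" using gen by blast
    next
      assume *: "\<forall>j<r. mpoly_var j * f \<in> I"
      let ?J = "{b \<in> carrier A. cl f \<otimes>\<^bsub>A\<^esub> b = \<zero>\<^bsub>A\<^esub>}"
      have "ideal ?J A"
      proof (rule idealI)
        show "subgroup ?J (add_monoid A)"
          by (rule H.S.add.subgroupI) (use clf in \<open>auto simp: H.S.r_distr H.S.r_minus simp flip: a_inv_def\<close>)
        show "x \<otimes>\<^bsub>A\<^esub> a \<in> ?J" "a \<otimes>\<^bsub>A\<^esub> x \<in> ?J" if "a \<in> ?J" "x \<in> carrier A" for a x
        proof -
          have "cl f \<otimes>\<^bsub>A\<^esub> (a \<otimes>\<^bsub>A\<^esub> x) = \<zero>\<^bsub>A\<^esub>"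
            using that clf by (simp add: H.S.m_assoc[symmetric])
          then show "x \<otimes>\<^bsub>A\<^esub> a \<in> ?J" "a \<otimes>\<^bsub>A\<^esub> x \<in> ?J"
            using that by (simp_all add: H.S.m_comm)
        qed
      qed (rule H.S.ring_axioms)
      moreover have "?X \<subseteq> ?J" using * X gen by auto
      ultimately have "irrelevant_ideal r I \<subseteq> ?J"
        unfolding irrelevant_ideal_def by (rule H.S.genideal_minimal)
      then show "cl f \<in> socle r I" using clf by (auto simp: socle_def)
    qed
  qed
  show ?thesis
  proof (intro equalityI subsetI)
    fix a assume a: "a \<in> socle r I \<inter> graded_part r I d"
    then obtain f where f: "f \<in> forms r d" "a = cl f" by (auto simp: graded_part_def)
    then have "\<forall>j<r. mpoly_var j * f \<in> I" using a socle_iff[of f] forms_poly_carrier by blast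
    then have "f \<in> colon r d (I \<inter> forms r (Suc d))"
      using f mult_form1[OF var_form] by (auto simp: colon_def)
    then show "a \<in> cl ` colon r d (I \<inter> forms r (Suc d))" using f by blast
  next
    fix a assume "a \<in> cl ` colon r d (I \<inter> forms r (Suc d))"
    then obtain f where f: "f \<in> forms r d" "a = cl f" "\<forall>j<r. mpoly_var j * f \<in> I"
      by (auto simp: colon_def)
    then have "a \<in> socle r I" using socle_iff[of f] forms_poly_carrier by blast
    then show "a \<in> socle r I \<inter> graded_part r I d" using f by (auto simp: graded_part_def)
  qed
qed

lemma socle_vector_eq: "socle_vector r I = socle_family r (\<lambda>d. I \<inter> forms r d)"
proof
  fix d
  let ?V = "\<lambda>d. I \<inter> forms r d"
  have g: "graded_family r ?V" by (rule graded_family_ideal[OF I])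
  have V: "form_space r d (?V d)" for d using g by (simp add: graded_family_def)
  have C: "form_space r d (colon r d (?V (Suc d)))" by (rule form_space_colon[OF V])
  have "socle_vector r I d = mp.dim (colon r d (?V (Suc d))) - mp.dim (?V d)"
    unfolding socle_vector_def socle_graded_part
    by (rule alg_dim_cl[OF C]) (rule graded_family_colon[OF g])
  then show "socle_vector r I d = socle_family r ?V d"
    using dim_codim[OF V[of d]] dim_codim[OF C] by (simp add: socle_family_def)
qed

end

lemma graded_artinian_algebraD:
  fixes I :: "'k::field mpoly set"
  assumes "graded_artinian_algebra r I"
  shows "algebra_family r (\<lambda>d. I \<inter> forms r d)" "h_vector r I = h_family r (\<lambda>d. I \<inter> forms r d)"
    "socle_vector r I = socle_family r (\<lambda>d. I \<inter> forms r d)"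
proof -
  have I: "ideal I (mpoly_ring r)"
    using assms homogeneous_ideal_is_ideal by (auto simp: graded_artinian_algebra_def)
  obtain e where e: "e \<ge> 1" "graded_part r I e \<noteq> {\<zero>\<^bsub>quot_alg r I\<^esub>}"
    "\<forall>i>e. graded_part r I i = {\<zero>\<^bsub>quot_alg r I\<^esub>}"
    using assms by (auto simp: graded_artinian_algebra_def)
  \<comment> \<open>Otherwise the quotient is the zero ring and all graded parts vanish, against the
    choice of \<open>e\<close>.\<close>
  have one: "1 \<notin> I"
  proof
    assume "1 \<in> I"
    then have full: "p \<in> I" if "p \<in> poly_carrier r" for p using ideal_mpoly_ringD(4)[OF I that, of 1] by simp
    have coset: "residue_class r I p = I" if p: "p \<in> poly_carrier r" for p
    proof (intro equalityI subsetI)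
      fix x assume "x \<in> residue_class r I p"
      then show "x \<in> I"
        using ideal_mpoly_ringD(3)[OF I _ full[OF p]] by (auto simp: residue_class_def a_r_coset_def')
    next
      fix x assume "x \<in> I"
      then have "x - p \<in> I" using mp.subspace_diff[OF subspace_ideal[OF I]] full[OF p] by blast
      moreover have "x = (x - p) + p" by simp
      ultimately show "x \<in> residue_class r I p"
        by (auto simp: residue_class_def a_r_coset_def' intro!: bexI[of _ "x - p"])
    qed
    have "graded_part r I e = {I}"
    proof -
      have "(0 :: 'k mpoly) \<in> forms r e" by (rule mp.subspace_0[OF subspace_forms])
      moreover have "residue_class r I f = I" if "f \<in> forms r e" for f
        using coset forms_poly_carrier that by blast
      ultimately show ?thesis by (auto simp: graded_part_def)
    qed
    then show False using e(2) by (simp add: quot_alg_def FactRing_def)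
  qed
  interpret poly_quot r I by (rule poly_quot.intro) (fact I one)+
  show "h_vector r I = h_family r (\<lambda>d. I \<inter> forms r d)" by (rule h_vector_eq)
  show "socle_vector r I = socle_family r (\<lambda>d. I \<inter> forms r d)" by (rule socle_vector_eq)
  have "f = 0" if f: "f \<in> I" "f \<in> forms r 0" for f
  proof (rule ccontr)
    assume "f \<noteq> 0"
    have fc: "f = mpoly_const (coef f 0)"
      using f(2) by (intro poly_mapping_eqI)
        (auto simp: forms_eq polys_iff monoms_def monom_degree_0_iff mpoly_const_def lookup_single when_def)
    then have "coef f 0 \<noteq> 0" using \<open>f \<noteq> 0\<close> by (metis mpoly_const_0)
    then have "mpoly_const (1 / coef f 0) * f = 1"
      by (subst fc) (simp add: mpoly_const_mult[symmetric])
    then show False using ideal_mpoly_ringD(4)[OF I poly_carrier_const f(1), of "1 / coef f 0"] one by simp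
  qed
  then have V0: "I \<inter> forms r 0 = {0}" using I_D(2) mp.subspace_0[OF subspace_forms] by blast
  have V1: "I \<inter> forms r 1 = {0}"
  proof -
    have "(0 :: 'k mpoly) \<in> forms r 1" by (rule mp.subspace_0[OF subspace_forms])
    then show ?thesis using assms I_D(2) unfolding graded_artinian_algebra_def by blast
  qed
  show "algebra_family r (\<lambda>d. I \<inter> forms r d)"
    unfolding algebra_family_def
  proof (intro conjI exI[of _ e])
    show "I \<inter> forms r e \<noteq> forms r e" using e(2) unfolding graded_part_zero_iff .
    show "\<forall>d>e. I \<inter> forms r d = forms r d" using e(3) unfolding graded_part_zero_iff .
  qed (fact graded_family_ideal[OF I] V0 V1 e(1))+
qed

text \<open>Truncation above degree \<open>e\<close> represents every class in the
  finite-dimensional space \<open>T\<close>. A descending chain of ideals pulls back to subspaces of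
  \<open>T\<close> and is constant from the least dimension on.\<close>

lemma artinian_ring_quot_alg:
  fixes I :: "'k::field mpoly set"
  assumes I: "ideal I (mpoly_ring r)" and one: "1 \<notin> I"
    and top: "\<And>d p. d > e \<Longrightarrow> p \<in> forms r d \<Longrightarrow> p \<in> I"
  shows "artinian_ring (quot_alg r I)"
proof -
  interpret poly_quot r I by (rule poly_quot.intro) (fact I one)+
  define T where "T = (polys (\<Union>d\<in>{..e}. monoms r d) :: 'k mpoly set)"
  have fT: "mp.findim T" unfolding T_def by (intro findim_polys) (simp add: finite_monoms)
  define trunc where "trunc p = (\<Sum>d\<in>{d \<in> monom_degree ` supp p. d \<le> e}. hom_component d p)" for p :: "'k mpoly"
  have trunc: "trunc p \<in> T" "p - trunc p \<in> I" if p: "p \<in> poly_carrier r" for p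
  proof -
    have "hom_component d p \<in> T" if "d \<le> e" for d
      using hom_component_in_forms[OF p, of d] that by (auto simp: T_def forms_eq polys_def)
    then show "trunc p \<in> T"
      unfolding trunc_def T_def by (intro mp.subspace_sum[OF subspace_polys]) auto
    have "(\<Sum>d\<in>monom_degree ` supp p. hom_component d p) = trunc p + (\<Sum>d\<in>{d \<in> monom_degree ` supp p. \<not> d \<le> e}. hom_component d p)"
      unfolding trunc_def by (subst sum.union_disjoint[symmetric]) (auto intro!: sum.cong)
    then have "p - trunc p = (\<Sum>d\<in>{d \<in> monom_degree ` supp p. \<not> d \<le> e}. hom_component d p)"
      using hom_component_decomp[of p] by (metis add_diff_cancel_left')
    also have "\<dots> \<in> I"
    proof (rule mp.subspace_sum[OF I_sub])
      fix d assume "d \<in> {d \<in> monom_degree ` supp p. \<not> d \<le> e}"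
      then show "hom_component d p \<in> I" by (intro top[OF _ hom_component_in_forms[OF p]]) auto
    qed
    finally show "p - trunc p \<in> I" .
  qed
  have TC: "T \<subseteq> poly_carrier r"
  proof
    fix p assume "p \<in> T"
    then have "\<exists>d. m \<in> monoms r d" if "m \<in> supp p" for m
      using that unfolding T_def polys_def by blast
    then show "p \<in> poly_carrier r" by (auto simp: poly_carrier_iff monoms_def)
  qed
  show ?thesis
    unfolding artinian_ring_def
  proof (intro conjI allI impI)
    show "ring A" by (rule H.S.ring_axioms)
    fix J :: "nat \<Rightarrow> 'k mpoly set set"
    assume J: "(\<forall>n. ideal (J n) A) \<and> (\<forall>n. J (Suc n) \<subseteq> J n)"
    define D where "D n = {p \<in> T. cl p \<in> J n}" for n
    have D_sub: "mp.subspace (D n)" for n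
    proof -
      have v: "ideal {p \<in> poly_carrier r. cl p \<in> J n} (mpoly_ring r)"
        using ring_hom_ring.ideal_vimage[OF hom_ring] J by blast
      have "D n = T \<inter> {p \<in> poly_carrier r. cl p \<in> J n}" using TC by (auto simp: D_def)
      then show ?thesis unfolding T_def
        by (simp only: mp.subspace_inter[OF subspace_polys subspace_ideal[OF v]])
    qed
    have D_fin: "mp.findim (D n)" for n
      using mp.findim_subset[OF fT] by (auto simp: D_def)
    have J_eq: "J n = cl ` D n" for n
    proof (intro equalityI subsetI)
      fix x assume x: "x \<in> J n"
      then have "x \<in> carrier A" using J ideal.Icarr by metis
      then obtain p where p: "p \<in> poly_carrier r" "x = cl p" by (auto simp: carrier_A)
      then have "cl p = cl (trunc p)" using trunc by (simp add: cl_eq_iff)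
      then show "x \<in> cl ` D n" using p x trunc by (auto simp: D_def)
    qed (auto simp: D_def)
    have anti: "J n \<subseteq> J m" if "m \<le> n" for m n
      using that J by (induction n rule: dec_induct) auto
    obtain N where N: "\<And>n. mp.dim (D N) \<le> mp.dim (D n)"
      using ex_has_least_nat[of "\<lambda>_. True" 0 "\<lambda>n. mp.dim (D n)"] by auto
    have "J n = J N" if "N \<le> n" for n
    proof -
      have "D n \<subseteq> D N" using anti[OF that] by (auto simp: D_def)
      then have "D n = D N" using N[of n] by (intro mp.subspace_eqI_dim D_sub D_fin)
      then show ?thesis by (simp add: J_eq)
    qed
    then show "\<exists>N. \<forall>n\<ge>N. J n = J N" by blast
  qed
qed

lemma graded_artinian_algebra_assemble:
  fixes V :: "nat \<Rightarrow> 'k::field mpoly set"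
  assumes V: "algebra_family r V"
  shows "graded_artinian_algebra r (assemble r V)"
proof -
  let ?I = "assemble r V"
  have g: "graded_family r V" and V0: "V 0 = {0}" and V1: "V 1 = {0}" using V by (auto simp: algebra_family_def)
  obtain e where e: "e \<ge> 1" "V e \<noteq> forms r e" "\<forall>d>e. V d = forms r d" using V by (auto simp: algebra_family_def)
  have I: "ideal ?I (mpoly_ring r)" by (rule ideal_assemble[OF g])
  have one: "1 \<notin> ?I"
  proof
    assume "1 \<in> ?I"
    moreover have "(1 :: 'k mpoly) \<in> forms r 0"
      by (simp add: forms_def poly_carrier_closed monom_degree_0_iff)
    ultimately have "1 \<in> V 0" using assemble_forms[OF g, of 0] by blast
    then show False using V0 by simp
  qed
  interpret poly_quot r ?I by (rule poly_quot.intro) (fact I one)+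
  have "artinian_ring A"
    using e(3) assemble_forms[OF g] by (intro artinian_ring_quot_alg[OF I one, of e]) blast
  then show ?thesis
    unfolding graded_artinian_algebra_def
    using homogeneous_ideal_assemble[OF g] V1 e assemble_forms[OF g]
    by (auto simp: graded_part_zero_iff simp del: One_nat_def)
qed

section \<open>Binomial expansions\<close>

lemma binomial_expansion_le:
  assumes "binomial_expansion n i j c" "j \<le> t" "t \<le> i"
  shows "t \<le> c t"
  using assms(2,3)
proof (induction t rule: dec_induct)
  case base
  then show ?case using assms by (simp add: binomial_expansion_def)
next
  case (step t)
  have "c t < c (Suc t)"
    using assms(1) step by (auto simp: binomial_expansion_def strict_mono_on_def)
  then show ?case using step by simp
qed

text \<open>By induction the lower terms sum to less than \<open>c (Suc i) choose i\<close>, and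
  Pascal's rule adds the top term.\<close>

lemma binomial_expansion_less_Suc:
  "binomial_expansion n i j c \<Longrightarrow> n < (c i + 1) choose i"
proof (induction i arbitrary: n)
  case 0
  then show ?case by (auto simp: binomial_expansion_def)
next
  case (Suc i)
  have ci: "Suc i \<le> c (Suc i)"
    using binomial_expansion_le[OF Suc.prems, of "Suc i"] Suc.prems by (simp add: binomial_expansion_def)
  show ?case
  proof (cases "j = Suc i")
    case True
    then have "n = c (Suc i) choose Suc i" using Suc.prems by (simp add: binomial_expansion_def)
    moreover have "0 < c (Suc i) choose i" using ci by (intro zero_less_binomial) simp
    ultimately show ?thesis unfolding Suc_eq_plus1[symmetric] binomial_Suc_Suc by linarith
  next
    case False
    then have ji: "j \<le> i" using Suc.prems by (simp add: binomial_expansion_def)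
    define n' where "n' = (\<Sum>t=j..i. c t choose t)"
    have "binomial_expansion n' i j c"
      using Suc.prems ji by (auto simp: binomial_expansion_def n'_def strict_mono_on_def)
    then have "n' < (c i + 1) choose i" by (rule Suc.IH)
    also have "c i < c (Suc i)"
      using Suc.prems ji by (auto simp: binomial_expansion_def strict_mono_on_def)
    then have "(c i + 1) choose i \<le> c (Suc i) choose i" by (intro binomial_right_mono) simp
    finally have "n' < c (Suc i) choose i" .
    moreover have "n = n' + (c (Suc i) choose Suc i)"
      using Suc.prems ji by (simp add: binomial_expansion_def n'_def)
    ultimately show ?thesis by simp
  qed
qed

text \<open>The top entry is the largest one whose binomial does not exceed \<open>n\<close>. As
  every term is positive, the remainder tells whether the expansion stops there.\<close>

lemma binomial_expansion_unique:
  assumes "binomial_expansion n i j c" "binomial_expansion n i j' c'"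
  shows "j = j' \<and> (\<forall>t\<in>{j..i}. c t = c' t)"
  using assms
proof (induction i arbitrary: n)
  case 0
  then show ?case by (auto simp: binomial_expansion_def)
next
  case (Suc i)
  have le: "c (Suc i) choose Suc i \<le> n" if "binomial_expansion n (Suc i) j c" for j c
    using that by (auto simp: binomial_expansion_def)
  have top: "c (Suc i) \<le> c' (Suc i)"
    if "binomial_expansion n (Suc i) j c" "binomial_expansion n (Suc i) j' c'" for j c j' c'
  proof (rule ccontr)
    assume "\<not> ?thesis"
    then have "(c' (Suc i) + 1) choose Suc i \<le> c (Suc i) choose Suc i"
      by (intro binomial_right_mono) simp
    then show False using le[OF that(1)] binomial_expansion_less_Suc[OF that(2)] by simp
  qed
  have eq: "c (Suc i) = c' (Suc i)" using top Suc.prems by (meson le_antisym)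
  have rest: "j = Suc i \<and> n = c (Suc i) choose Suc i \<or>
      j \<le> i \<and> binomial_expansion (n - (c (Suc i) choose Suc i)) i j c \<and> c (Suc i) choose Suc i < n"
    if e: "binomial_expansion n (Suc i) j c" for j c
  proof (cases "j = Suc i")
    case True
    then show ?thesis using e by (simp add: binomial_expansion_def)
  next
    case False
    then have ji: "j \<le> i" using e by (simp add: binomial_expansion_def)
    have n: "n = (\<Sum>t=j..i. c t choose t) + (c (Suc i) choose Suc i)"
      using e ji by (simp add: binomial_expansion_def)
    have be: "binomial_expansion (\<Sum>t=j..i. c t choose t) i j c"
      using e ji by (auto simp: binomial_expansion_def strict_mono_on_def)
    have "c i choose i \<le> (\<Sum>t=j..i. c t choose t)"
      using ji by (intro member_le_sum) auto
    moreover have "0 < c i choose i"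
      using binomial_expansion_le[OF be ji order_refl] by (rule zero_less_binomial)
    ultimately have "c (Suc i) choose Suc i < n" using n by linarith
    then show ?thesis using n be ji by simp
  qed
  from rest[OF Suc.prems(1)] rest[OF Suc.prems(2)]
  consider "j = Suc i" "j' = Suc i" | "j \<le> i" "j' \<le> i"
    "binomial_expansion (n - (c (Suc i) choose Suc i)) i j c"
    "binomial_expansion (n - (c (Suc i) choose Suc i)) i j' c'"
    using eq by auto
  then show ?case
  proof cases
    case 1
    then show ?thesis using eq by simp
  next
    case 2
    then have "j = j' \<and> (\<forall>t\<in>{j..i}. c t = c' t)" by (intro Suc.IH)
    then show ?thesis using eq by (auto simp: le_Suc_eq)
  qed
qed

lemma binomial_shift_eq:
  assumes "binomial_expansion n i j c" "n \<noteq> 0"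
  shows "binomial_shift s n i = (\<Sum>t=j..i. int_choose (int (c t) + s) (int t + s))"
proof -
  have "(THE v. \<exists>j c. binomial_expansion n i j c \<and> v = (\<Sum>t=j..i. int_choose (int (c t) + s) (int t + s)))
      = (\<Sum>t=j..i. int_choose (int (c t) + s) (int t + s))"
  proof (rule the_equality)
    show "\<exists>j' c'. binomial_expansion n i j' c' \<and> (\<Sum>t=j..i. int_choose (int (c t) + s) (int t + s)) =
        (\<Sum>t=j'..i. int_choose (int (c' t) + s) (int t + s))"
      using assms by blast
    fix v assume "\<exists>j c. binomial_expansion n i j c \<and> v = (\<Sum>t=j..i. int_choose (int (c t) + s) (int t + s))"
    then obtain j' c' where *: "binomial_expansion n i j' c'"
        "v = (\<Sum>t=j'..i. int_choose (int (c' t) + s) (int t + s))" by blast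
    show "v = (\<Sum>t=j..i. int_choose (int (c t) + s) (int t + s))"
      unfolding *(2) using binomial_expansion_unique[OF assms(1) *(1)] by (intro sum.cong) auto
  qed
  then show ?thesis using assms by (simp add: binomial_shift_def)
qed

text \<open>With \<open>k = 0, 1, 2\<close> the summands are the values of an entry
  \<open>t + 1\<close> over \<open>t\<close> after a shift by -1, 0, 1.\<close>

lemma sum_top_interval:
  "a \<le> i \<Longrightarrow> (\<Sum>t=i - a + 1..i. t + k) = (\<Sum>t<a. i + k - t)" for k :: nat
proof (induction a)
  case (Suc a)
  then have "{i - Suc a + 1..i} = insert (i - a) {i - a + 1..i}" by auto
  then show ?case using Suc by simp
qed simp

text \<open>The binomial expansion of \<open>lex_count a i + b\<close> has \<open>a\<close> entries \<open>t + 1\<close> over \<open>t\<close> and then \<open>b\<close> entries \<open>t\<close> over \<open>t\<close>.\<close>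

lemma binomial_shift_lex_count:
  assumes n: "0 < lex_count a i + b" and ab: "a \<le> i" "b \<le> i - a" and i: "1 \<le> i"
  shows "binomial_shift (-1) (lex_count a i + b) i = lex_count a (i - 1) + b"
    and "binomial_shift 1 (lex_count a i + b) i = lex_count a (i + 1) + b"
proof -
  define j where "j = i - a - b + 1"
  define c where "c t = (if i - a < t then t + 1 else t)" for t
  have ab0: "0 < a + b" using n by (cases "a = 0") auto
  then have j: "1 \<le> j" "j \<le> i" "j \<le> i - a + 1" "i - a + 1 - j = b" using ab by (auto simp: j_def)
  have split: "(\<Sum>t=j..i. f t) = (\<Sum>t=j..i - a. f t) + (\<Sum>t=i - a + 1..i. f t)" for f :: "nat \<Rightarrow> nat"
    using j ab by (subst sum.union_disjoint[symmetric]) (auto intro!: sum.cong)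
  have low: "(\<Sum>t=j..i - a. (1::nat)) = b" using j by simp
  have be: "binomial_expansion (lex_count a i + b) i j c"
    unfolding binomial_expansion_def
  proof (intro conjI)
    show "strict_mono_on {j..i} c" by (auto simp: strict_mono_on_def c_def)
    have "(\<Sum>t=j..i. c t choose t) = (\<Sum>t=j..i - a. 1) + (\<Sum>t=i - a + 1..i. t + 1)"
      unfolding split by (intro arg_cong2[where f = "(+)"] sum.cong) (auto simp: c_def)
    then show "lex_count a i + b = (\<Sum>t=j..i. c t choose t)"
      using sum_top_interval[OF ab(1), of 1] low by (simp add: lex_count_def)
  qed (use j in \<open>auto simp: c_def\<close>)
  have ne: "lex_count a i + b \<noteq> 0" using n by simp
  have "(\<Sum>t=j..i. int_choose (int (c t) + - 1) (int t + - 1)) = (\<Sum>t=j..i - a. 1) + (\<Sum>t=i - a + 1..i. t + 0)"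
    unfolding split
  proof (intro arg_cong2[where f = "(+)"] sum.cong refl)
    fix t assume t: "t \<in> {i - a + 1..i}"
    then obtain t' where "t = Suc t'" by (cases t) auto
    moreover have "nat (1 + int t') = Suc t'" by simp
    ultimately show "int_choose (int (c t) + - 1) (int t + - 1) = t + 0"
      using t by (simp add: c_def int_choose_def)
  next
    \<comment> \<open>An entry \<open>t\<close> over \<open>t\<close> becomes \<open>t - 1\<close>
      over \<open>t - 1\<close> and keeps the value 1, also at \<open>t = 1\<close>, where the lower
      entry reaches 0.\<close>
    fix t assume t: "t \<in> {j..i - a}"
    then obtain t' where "t = Suc t'" using j by (cases t) auto
    then show "int_choose (int (c t) + - 1) (int t + - 1) = 1"
      using t by (simp add: c_def int_choose_def)
  qed
  then show "binomial_shift (-1) (lex_count a i + b) i = lex_count a (i - 1) + b"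
    unfolding binomial_shift_eq[OF be ne] using sum_top_interval[OF ab(1), of 0] low i by (simp add: lex_count_def)
  have "(\<Sum>t=j..i. int_choose (int (c t) + 1) (int t + 1)) = (\<Sum>t=j..i - a. 1) + (\<Sum>t=i - a + 1..i. t + 2)"
    unfolding split
    by (intro arg_cong2[where f = "(+)"] sum.cong refl) (auto simp: c_def int_choose_def nat_add_distrib)
  then show "binomial_shift 1 (lex_count a i + b) i = lex_count a (i + 1) + b"
    unfolding binomial_shift_eq[OF be ne] using sum_top_interval[OF ab(1), of 2] low by (simp add: lex_count_def)
qed

lemma choose_lex_count: "(m + 2) choose m = lex_count (m + 1) m"
proof (induction m)
  case (Suc m)
  have "lex_count (Suc m + 1) (Suc m) = (\<Sum>t<Suc (Suc m). Suc m + 1 - t)" by (simp add: lex_count_def)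
  also have "\<dots> = (m + 2) + lex_count (m + 1) m"
    by (subst sum.lessThan_Suc_shift) (simp add: lex_count_def)
  also have "\<dots> = (Suc (m + 1) choose Suc m) + (m + 2 choose m)"
    using Suc binomial_Suc_n[of "Suc m"] by simp
  also have "\<dots> = (Suc m + 2) choose Suc m" by simp
  finally show ?case by simp
qed (simp add: lex_count_def)

text \<open>The number of all monomials of degree \<open>i\<close> in three variables has the single
  entry \<open>i + 2\<close> over \<open>i\<close>, a shape outside the pairs with
  \<open>a \<le> i\<close>. It occurs when the component of the ideal is zero.\<close>

lemma binomial_shift_full:
  assumes i: "1 \<le> i"
  shows "binomial_shift (-1) (lex_count (i + 1) i) i = lex_count i (i - 1)"
proof -
  have be: "binomial_expansion (lex_count (i + 1) i) i i (\<lambda>t. i + 2)"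
    using i choose_lex_count[of i] by (simp add: binomial_expansion_def strict_mono_on_def)
  have "0 < (i + 2) choose i" by (rule zero_less_binomial) simp
  then have "lex_count (i + 1) i \<noteq> 0" unfolding choose_lex_count by (rule gr_implies_not0)
  then have "binomial_shift (-1) (lex_count (i + 1) i) i = int_choose (int (i + 2) - 1) (int i - 1)"
    using binomial_shift_eq[OF be, of "-1"] by simp
  also have "\<dots> = (i - 1 + 2) choose (i - 1)"
  proof -
    have "nat (int (i + 2) - 1) = i - 1 + 2" "nat (int i - 1) = i - 1" using i by simp_all
    then show ?thesis using i unfolding int_choose_def by simp
  qed
  also have "\<dots> = lex_count i (i - 1)" using choose_lex_count[of "i - 1"] i by simp
  finally show ?thesis .
qed

section \<open>Uniqueness of the socle-vector\<close>

lemma monoms_1: "monoms r 1 = (\<lambda>j. Poly_Mapping.single j 1) ` {..<r}"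
proof (intro equalityI subsetI)
  fix m assume m: "m \<in> monoms r 1"
  then have "supp m \<noteq> {}" by (auto simp: monoms_def monom_degree_def)
  then obtain j where j: "j \<in> supp m" by blast
  have "coef m k = (if k = j then 1 else 0)" for k
  proof -
    have s: "(\<Sum>k\<in>supp m. coef m k) = 1" using m by (simp add: monoms_def monom_degree_def)
    have "1 \<le> coef m j" using j by (simp add: in_keys_iff)
    moreover have "(\<Sum>k\<in>supp m. coef m k) = coef m j + (\<Sum>k\<in>supp m - {j}. coef m k)"
      using j by (simp add: sum.remove)
    ultimately have "coef m j = 1" "(\<Sum>k\<in>supp m - {j}. coef m k) = 0" using s by auto
    then show ?thesis by (auto simp: in_keys_iff)
  qed
  then have "m = Poly_Mapping.single j 1" by (intro poly_mapping_eqI) (simp add: lookup_single when_def)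
  then show "m \<in> (\<lambda>j. Poly_Mapping.single j 1) ` {..<r}" using j m by (auto simp: monoms_def)
qed (use monoms_var in auto)

text \<open>Stated for every \<open>r\<close>, so that \<open>h 1\<close> recovers the number of
  variables, which the definition of a socle-vector for \<open>h\<close> leaves open.\<close>

lemma dim_forms_1: "mp.dim (forms r 1 :: 'k::field mpoly set) = r"
proof -
  have "inj_on (\<lambda>j. Poly_Mapping.single j (1::nat)) {..<r}"
    by (rule inj_onI) (metis lookup_single_eq lookup_single_not_eq zero_neq_one)
  then have "card (monoms r 1) = r" unfolding monoms_1 using card_image by fastforce
  then show ?thesis by (simp only: dim_forms)
qed

lemma algebra_family_r:
  fixes V :: "nat \<Rightarrow> 'k::field mpoly set"
  assumes "algebra_family r V"
  shows "h_family r V 1 = r" "1 \<le> r"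
proof -
  have "V 1 = {0}" using assms by (simp add: algebra_family_def)
  then show "h_family r V 1 = r"
    unfolding h_family_def codim_def by (simp only: dim_zero_space dim_forms_1 diff_zero)
  obtain e where e: "e \<ge> 1" "V e \<noteq> forms r e" "V e \<subseteq> forms r e" "0 \<in> V e"
    using assms mp.subspace_0 by (auto simp: algebra_family_def graded_family_def form_space_def)
  show "1 \<le> r"
  proof (rule ccontr)
    assume "\<not> 1 \<le> r"
    then have "r = 0" by simp
    moreover have "monom_degree 0 = 0" by (simp add: monom_degree_0_iff)
    ultimately have "monoms r e = {}" using e(1) by (auto simp: monoms_def)
    then have "forms r e \<subseteq> {0 :: 'k mpoly}" by (auto simp: forms_eq polys_def)
    then show False using e by blast
  qed
qed

lemma is_socle_vector_for_iff:
  assumes "h 1 = r"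
  shows "is_socle_vector_for TYPE('k::field) h s \<longleftrightarrow>
    (\<exists>V :: nat \<Rightarrow> 'k mpoly set. algebra_family r V \<and> h_family r V = h \<and> socle_family r V = s)"
proof
  assume "is_socle_vector_for TYPE('k) h s"
  then obtain r' and I :: "'k mpoly set" where I: "graded_artinian_algebra r' I"
    "h_vector r' I = h" "socle_vector r' I = s"
    by (auto simp: is_socle_vector_for_def)
  note D = graded_artinian_algebraD[OF I(1)]
  have "r' = r" using algebra_family_r(1)[OF D(1)] D(2) I(2) assms by simp
  then show "\<exists>V :: nat \<Rightarrow> 'k mpoly set. algebra_family r V \<and> h_family r V = h \<and> socle_family r V = s"
    using D I by metis
next
  assume "\<exists>V :: nat \<Rightarrow> 'k mpoly set. algebra_family r V \<and> h_family r V = h \<and> socle_family r V = s"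
  then obtain V :: "nat \<Rightarrow> 'k mpoly set" where V: "algebra_family r V" "h_family r V = h" "socle_family r V = s" by blast
  have g: "graded_artinian_algebra r (assemble r V)" by (rule graded_artinian_algebra_assemble[OF V(1)])
  have "(\<lambda>d. assemble r V \<inter> forms r d) = V"
    using assemble_forms V(1) by (auto simp: algebra_family_def fun_eq_iff)
  then show "is_socle_vector_for TYPE('k) h s"
    unfolding is_socle_vector_for_def
    using g graded_artinian_algebraD[OF g] V by (intro exI[of _ r] exI[of _ "assemble r V"]) simp
qed

lemma codim_fullD:
  fixes V :: "'k::field mpoly set"
  assumes "r \<in> {1,2,3}" "form_space r d V" "codim r d V = monom_count r d"
  shows "V = {0}"
proof -
  have "0 \<in> V" using assms(2) mp.subspace_0[of V] by (simp add: form_space_def)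
  then show ?thesis
    using codim_eqD[OF form_space_zero assms(2)] assms(3) codim_zero[OF assms(1), of d, where 'k = 'k] by simp
qed

lemma colon_zero:
  assumes "1 \<le> r"
  shows "colon r d {0} = ({0} :: 'k::field mpoly set)"
proof -
  have "(mpoly_var 0 :: 'k mpoly) \<noteq> 0"
    by (metis lookup_single_eq lookup_zero mpoly_var_def zero_neq_one)
  then have "f = 0" if "f \<in> colon r d {0}" for f :: "'k mpoly"
    using that assms by (auto simp: colon_def)
  then have "colon r d {0} \<subseteq> ({0} :: 'k mpoly set)" by blast
  moreover have "(0 :: 'k mpoly) \<in> colon r d {0}"
    using mp.subspace_0[OF subspace_forms] by (simp add: colon_def)
  ultimately show ?thesis by blast
qed

text \<open>Already \<open>lex_count 2 i = 2 i + 1\<close> exceeds the \<open>i + 1\<close>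
  monomials in two variables.\<close>

lemma full_imp_3:
  assumes "r \<in> {1,2,3}" "1 \<le> i" "n \<le> monom_count r i" "\<not> n < lex_count (i + 1) i"
  shows "r = 3" "n = lex_count (i + 1) i"
proof -
  have "lex_count 2 i \<le> lex_count (i + 1) i" using assms by (intro lex_count_mono) simp
  then have "i + 1 < lex_count (i + 1) i" using assms by (simp add: lex_count_def numeral_2_eq_2)
  then show "r = 3" using assms by (auto simp: monom_count_def split: if_splits)
  then show "n = lex_count (i + 1) i" using assms by (simp add: monom_count_def)
qed

text \<open>Zero and full components are treated separately; otherwise the pair
  \<open>(a, b)\<close> translates Green's and Macaulay's bounds into shifts. For the equality,
  \<open>R_1 V_i\<close> lies in \<open>V_(i+1)\<close>, so its codimension is squeezed between that
  of \<open>V_(i+1)\<close> and Macaulay's bound.\<close>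

lemma colon_ge_shift:
  fixes V :: "nat \<Rightarrow> 'k::field_char_0 mpoly set"
  assumes r: "r \<in> {1,2,3}" and V: "graded_family r V" and i: "1 \<le> i"
  shows "binomial_shift (-1) (codim r i (V i)) i \<le> codim r (i - 1) (colon r (i - 1) (V i))"
    and "binomial_shift 1 (codim r i (V i)) i = codim r (i + 1) (V (i + 1)) \<Longrightarrow>
      binomial_shift (-1) (codim r i (V i)) i = codim r (i - 1) (colon r (i - 1) (V i))"
proof -
  let ?n = "codim r i (V i)" and ?C = "codim r (i - 1) (colon r (i - 1) (V i))"
  have sub: "form_space r d (V d)" for d using V by (simp add: graded_family_def)
  obtain d where d: "i = Suc d" using i by (cases i) auto
  have "binomial_shift (-1) ?n i \<le> ?C \<and>
     (binomial_shift 1 ?n i = codim r (i + 1) (V (i + 1)) \<longrightarrow> binomial_shift (-1) ?n i = ?C)"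
  proof (cases "?n < lex_count (i + 1) i")
    case False
    then have 3: "r = 3" "?n = lex_count (i + 1) i"
      using full_imp_3[OF r i codim_le_monom_count[OF r]] by auto
    then have "V i = {0}" using r by (intro codim_fullD[OF r sub]) (simp add: monom_count_def)
    moreover have "colon r (i - 1) {0} = ({0} :: 'k mpoly set)" using 3 by (intro colon_zero) simp
    ultimately have "?C = monom_count r (i - 1)" using codim_zero[OF r, of "i - 1", where 'k = 'k] by simp
    then have "?C = lex_count i (i - 1)" using 3 i by (simp add: monom_count_def)
    then show ?thesis using binomial_shift_full[OF i] 3 by simp
  next
    case True
    then obtain a b where ab: "a \<le> i" "b \<le> i - a" "?n = lex_count a i + b" by (rule lex_count_decomp)
    show ?thesis
    proof (cases "?n = 0")
      case True
      then have "V i = forms r i" using codim_0_iff[OF sub] by simp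
      then have "colon r (i - 1) (V i) = forms r (i - 1)"
        using mult_form1[OF var_form] d by (auto simp: colon_def)
      then show ?thesis using True by (simp add: binomial_shift_def)
    next
      case False
      then have shifts: "binomial_shift (-1) ?n i = lex_count a (i - 1) + b" "binomial_shift 1 ?n i = lex_count a (i + 1) + b"
        using binomial_shift_lex_count[of a i b] ab i by auto
      have eqs: "?n = lex_count a (i - 1) + b + a" "lex_count a (i + 1) + b = ?n + a"
        using ab lex_count_Suc_right[of a "i - 1"] lex_count_Suc_right[of a i] d by auto
      have lt: "codim r (Suc d) (V (Suc d)) < lex_count (Suc a) (Suc d)" using ab d by (simp add: lex_count_Suc)
      note mg = macaulay_gotzmann[OF r sub lt]
      have "codim r (i + 1) (V (i + 1)) \<le> codim r (i + 1) (up r (V i))"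
        using form_space_up[OF sub[of i]] graded_family_up[OF V, of i] by (intro codim_antimono sub) auto
      then show ?thesis using mg shifts eqs d by auto
    qed
  qed
  then show "binomial_shift (-1) ?n i \<le> ?C"
    and "binomial_shift 1 ?n i = codim r (i + 1) (V (i + 1)) \<Longrightarrow> binomial_shift (-1) ?n i = ?C"
    by blast+
qed

theorem corollary4p2:
  fixes h :: "nat \<Rightarrow> nat" and r :: nat
  assumes "is_h_vector TYPE('k::field_char_0) h"
    and "h 1 = r" and "r \<le> 3"
  shows "(\<exists>!s. is_socle_vector_for TYPE('k) h s) \<longleftrightarrow>
         (\<forall>i\<ge>2. binomial_shift (-1) (h i) i \<noteq> h (i - 1) \<longrightarrow>
                binomial_shift 1 (h i) i = h (i + 1))"
proof -
  note iff = is_socle_vector_for_iff[of h r, OF assms(2), where 'k = 'k]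
  have "\<exists>s. is_socle_vector_for TYPE('k) h s"
    using assms(1) by (auto simp: is_h_vector_def is_socle_vector_for_def)
  then obtain V0 :: "nat \<Rightarrow> 'k mpoly set" where V0: "algebra_family r V0" "h_family r V0 = h"
    unfolding iff by blast
  have r: "r \<in> {1,2,3}" using algebra_family_r(2)[OF V0(1)] assms(3) by auto
  interpret h_function r h using algebra_family_h_function[OF r V0(1)] V0(2) by simp
  have codim_h: "codim r d (V d) = h d" if "h_family r V = h" for V :: "nat \<Rightarrow> 'k mpoly set" and d
    using that by (auto simp: h_family_def)
  have colon_le: "codim r (i - 1) (colon r (i - 1) (V i)) \<le> h (i - 1)"
    if "graded_family r V" "h_family r V = h" "1 \<le> i" for V :: "nat \<Rightarrow> 'k mpoly set" and i
  proof -
    have "V (i - 1) \<subseteq> colon r (i - 1) (V i)" using graded_family_colon[OF that(1), of "i - 1"] that(3) by simp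
    moreover have "form_space r (i - 1) (colon r (i - 1) (V i))"
      using form_space_colon[of r "i - 1" "V i"] that by (simp add: graded_family_def)
    ultimately show ?thesis
      using codim_antimono[of r "i - 1" "V (i - 1)"] that(1) codim_h[OF that(2), of "i - 1"] by (simp add: graded_family_def)
  qed
  show ?thesis
  proof
    assume uniq: "\<exists>!s. is_socle_vector_for TYPE('k) h s"
    show "\<forall>i\<ge>2. binomial_shift (-1) (h i) i \<noteq> h (i - 1) \<longrightarrow> binomial_shift 1 (h i) i = h (i + 1)"
    proof (intro allI impI, rule ccontr)
      fix i :: nat
      assume i: "2 \<le> i" and prev: "binomial_shift (-1) (h i) i \<noteq> h (i - 1)"
        and nxt: "binomial_shift 1 (h i) i \<noteq> h (i + 1)"
      have i1: "1 \<le> i" using i by simp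
      have g0: "graded_family r V0" using V0 by (simp add: algebra_family_def)
      have "binomial_shift (-1) (h i) i \<le> h (i - 1)"
        using colon_ge_shift(1)[OF r g0 i1] colon_le[OF g0 V0(2) i1] codim_h[OF V0(2)] by simp
      then have prev_less: "binomial_shift (-1) (h i) i < h (i - 1)" using prev by simp
      \<comment> \<open>For a zero component the shift by -1 counts all monomials of degree
        \<open>i - 1\<close> and cannot be below \<open>h (i - 1)\<close>.\<close>
      have "h i < lex_count (i + 1) i"
      proof (rule ccontr)
        assume "\<not> h i < lex_count (i + 1) i"
        then have "r = 3" "h i = lex_count (i + 1) i" using full_imp_3[OF r i1 h_le] by auto
        then show False using prev_less binomial_shift_full[OF i1] h_le[of "i - 1"] i by (simp add: monom_count_def)
      qed
      then obtain a b where ab: "a \<le> i" "b \<le> i - a" "h i = lex_count a i + b" by (rule lex_count_decomp)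
      have le: "h (Suc i) \<le> h i + a" by (rule h_growth[OF i1 ab])
      have "h i \<noteq> 0"
      proof
        assume h0: "h i = 0"
        then have "binomial_shift 1 (h i) i = 0" by (simp add: binomial_shift_def)
        moreover have "h (i + 1) = 0" using h_growth[of i 0 0] i1 h0 by simp
        ultimately show False using nxt by simp
      qed
      then have shifts: "binomial_shift (-1) (h i) i = lex_count a (i - 1) + b" "binomial_shift 1 (h i) i = lex_count a (i + 1) + b"
        using binomial_shift_lex_count[of a i b] ab i1 by auto
      have up: "lex_count a (i + 1) + b = h i + a" using ab lex_count_Suc_right[of a i] by simp
      interpret swap r h i a b "i - a - b"
      proof
        show "a + b + (i - a - b) = i" using ab by simp
        show "lex_count a (i - 1) + b < h (i - 1)" using prev_less shifts by simp
        show "h (Suc i) < h i + a" using le nxt shifts up by simp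
      qed (fact i ab(3))+
      let ?L = "\<lambda>d. polys (lex_monoms d) :: 'k mpoly set" and ?M = "exchange :: nat \<Rightarrow> 'k mpoly set"
      have "is_socle_vector_for TYPE('k) h (socle_family r ?L)" "is_socle_vector_for TYPE('k) h (socle_family r ?M)"
        unfolding iff using algebra_family_lex algebra_family_exchange by blast+
      then have "socle_family r ?L = socle_family r ?M" using uniq by blast
      then show False using socle_family_less[where 'k = 'k] by simp
    qed
  next
    assume cond: "\<forall>i\<ge>2. binomial_shift (-1) (h i) i \<noteq> h (i - 1) \<longrightarrow> binomial_shift 1 (h i) i = h (i + 1)"
    \<comment> \<open>The common socle-vector. Degree 0 belongs to \<open>i = 1\<close>, outside the
      range of the condition; the socle is zero there because \<open>V 1\<close> is zero.\<close>
    define s0 where "s0 d = (if d = 0 then 0 else h d - binomial_shift (-1) (h (Suc d)) (Suc d))" for d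
    have "socle_family r V = s0" if V: "algebra_family r V" "h_family r V = h" for V :: "nat \<Rightarrow> 'k mpoly set"
    proof
      fix d
      have g: "graded_family r V" using V by (simp add: algebra_family_def)
      show "socle_family r V d = s0 d"
      proof (cases "d = 0")
        case True
        have "V (Suc 0) = {0}" using V by (simp add: algebra_family_def)
        moreover have "colon r 0 {0} = ({0} :: 'k mpoly set)" using r by (intro colon_zero) auto
        ultimately have "codim r 0 (colon r 0 (V (Suc 0))) = 1" using codim_zero[OF r, of 0, where 'k = 'k] by simp
        then show ?thesis using True codim_h[OF V(2), of 0] h_0 by (simp add: socle_family_def s0_def)
      next
        case False
        have "codim r d (colon r d (V (Suc d))) = binomial_shift (-1) (h (Suc d)) (Suc d)"
        \<comment> \<open>If the shift equals \<open>h d\<close>, the codimension is squeezed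
          between the two; otherwise the condition supplies the equality case of the colon
          bound.\<close>
        proof (cases "binomial_shift (-1) (h (Suc d)) (Suc d) = h d")
          case True
          then show ?thesis
            using colon_ge_shift(1)[OF r g, of "Suc d"] colon_le[OF g V(2), of "Suc d"] codim_h[OF V(2)] by simp
        next
          case neq: False
          then have "binomial_shift 1 (h (Suc d)) (Suc d) = h (Suc d + 1)"
            using cond[rule_format, of "Suc d"] False by simp
          then show ?thesis
            using colon_ge_shift(2)[OF r g, of "Suc d"] codim_h[OF V(2)] by simp
        qed
        then show ?thesis using False codim_h[OF V(2), of d] by (simp add: socle_family_def s0_def)
      qed
    qed
    then have "s = s0" if "is_socle_vector_for TYPE('k) h s" for s
      using that unfolding iff by blast
    then show "\<exists>!s. is_socle_vector_for TYPE('k) h s"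
      using \<open>\<exists>s. is_socle_vector_for TYPE('k) h s\<close> by metis
  qed
qed

end
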